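(* Let $\mathbf s$ be a (finite) sequence in $\widehat{\mathcal S}$ such that $\widehat{\mathcal G}_{J(\mathbf s)}$ satisfies the GKM-property. Then there exist a $\mathcal Z(J(\mathbf s))$-module isomorphism $\varphi(\mathbf s):\Gamma(\mathscr B(\mathbf s))\to\mathcal X(\mathbf s)$ and, for each $x\in\widehat{\mathcal W}$, an $S$-module isomorphism $\varphi_x(\mathbf s):\mathscr B(\mathbf s)^x\to\mathcal X(\mathbf s)^x$ such that for each $x\in\widehat{\mathcal W}$ and each $m\in\Gamma(\mathscr B(\mathbf s))$ one has $\varphi_x(\mathbf s)(m_x)=\varphi(\mathbf s)(m)|_{I(\mathbf s)_x}$.
   Context: Affine setting. $R$ is an irreducible reduced finite root system in a finite-dimensional $\mathbb Q$-vector space $V$, with weight lattice $X=\{\lambda\in V:\langle\lambda,\alpha^\vee\rangle\in\mathbb Z\ \forall\alpha\in R\}$, positive roots $R^+$, simple roots $\Pi$, highest root $\tilde\alpha$. The affine Weyl group $\widehat{\mathcal W}$ is the group of transformations of $V^*$ generated by $s_{\alpha,n}(v)=v-(\langle\alpha,v\rangle-n)\alpha^\vee$ ($\alpha\in R,n\in\mathbb Z$). Affine roots: $\widehat R=R\times\mathbb Z\subset\widehat X:=X\oplus\mathbb Z\subset\widehat V:=V\oplus\mathbb Q$, with $s_{(\alpha,-n)}:=s_{\alpha,n}$; $\widehat R^+=\{(\alpha,n):n>0\}\cup\{(\alpha,0):\alpha\in R^+\}$; $\widehat\Pi=\{(\alpha,0):\alpha\in\Pi\}\cup\{(-\tilde\alpha,1)\}$;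 $\widehat{\mathcal S}=\{s_\gamma:\gamma\in\widehat\Pi\}$. $(\widehat{\mathcal W},\widehat{\mathcal S})$ is a Coxeter system with length $\ell$, Bruhat order $\le$, unit $e$. $\widehat{\mathcal W}$ acts linearly on $\widehat V$ by $s_\alpha(\beta)=\beta-\langle\{\beta\},\{\alpha\}^\vee\rangle\alpha$, where $\{(\lambda,n)\}=\lambda$. $\mathbb F$ is a field of characteristic $\neq2$, $\mathsf V=\widehat X\otimes_{\mathbb Z}\mathbb F$, $S$ is the symmetric algebra of $\mathsf V$, $\mathbb Z$-graded with $\mathsf V$ in degree $2$; $\bar\lambda:=\lambda\otimes1$ for $\lambda\in\widehat X$. The moment graph $\widehat{\mathcal G}$ has vertex poset $(\widehat{\mathcal W},\le)$ and an edge $x\to y$ labelled $\bar\alpha$ iff $x<y$ and $y=s_\alpha x$, $\alpha\in\widehat R^+$. If $E$ is an edge between $x$ and $y$ then $Es$ denotes the edge between $xs$ and $ys$. For $s\in\widehat{\mathcal S}$, $\widehat{\mathcal G}^s$ has vertices $\bar x=\{x,xs\}$, order: $\bar x<\bar y$ iff $\bar x\ne\bar y$ and $u<v$ for some $u\in\bar x,v\in\bar y$; an edge $\bar x\to\bar y$ labelled $\bar\alpha$ iff $\bar x<\bar y$ and $s_\alpha\bar x=\bar y$, $\alpha\in\widehat R^+$; $\bar E$ denotes the edge induced by $E:x\to y$. $\widehat{\mathcal G}_\Omega$ is the full subgraph on $\Omega\subset\widehat{\mathcal W}$. GKM-property: labels of any two distinct edges with a common vertex are not proportional over $\mathbb F$.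 Sheaves. A sheaf $\mathscr M$ on a moment graph consists of graded $S$-modules $\mathscr M^x$ (vertices $x$), graded $S$-modules $\mathscr M^E$ with $l(E)\mathscr M^E=0$ (edges $E$ with label $l(E)$), and degree-$0$ homomorphisms $\rho_{x,E}:\mathscr M^x\to\mathscr M^E$ for $x$ on $E$. For a set $\mathcal I$ of vertices, $\Gamma(\mathcal I,\mathscr M)=\{m\in\prod_{x\in\mathcal I}\mathscr M^x:\rho_{x,E}(m_x)=\rho_{y,E}(m_y)$ for all edges $E$ joining $x,y\in\mathcal I\}$; $\Gamma(\mathscr M)$ is the case of all vertices. Bott–Samelson sheaves. $\vartheta^s_{on}\mathscr P=\mathscr N$ is the sheaf on $\widehat{\mathcal G}^s$ with $\mathscr N^{\bar x}=\Gamma(\{x,xs\},\mathscr P)$; for $\bar E:\bar x\to\bar y$ induced by $E:x\to y$, $\mathscr N^{\bar E}$ is the image of $\mathscr N^{\bar y}$ under $\rho_{y,E}\oplus\rho_{ys,Es}$, and $\rho_{\bar y,\bar E},\rho_{\bar x,\bar E}$ are the restrictions of $\rho_{y,E}\oplus\rho_{ys,Es}$, $\rho_{x,E}\oplus\rho_{xs,Es}$. $\vartheta^s_{out}\mathscr Q=\mathscr M$ is the sheaf on $\widehat{\mathcal G}$ with $\mathscr M^x=\mathscr Q^{\bar x}$; if $E$ joins $x$ and $xs$, $\mathscr M^E=\mathscr Q^{\bar x}/l(E)\mathscr Q^{\bar x}$ with natural projections; otherwise $\mathscr M^E=\mathscr Q^{\bar E}$ with $\rho_{x,E}=\rho_{\bar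 x,\bar E}$. $\vartheta^s=\vartheta^s_{out}\circ\vartheta^s_{on}$. $\mathscr B(e)$ is the sheaf with $\mathscr B(e)^e=S$ and all other $\mathscr B(e)^x$, $\mathscr B(e)^E$ zero. For $\mathbf s=(s_1,\dots,s_l)$ with $\widehat{\mathcal G}_{J(\mathbf s)}$ GKM, $\mathscr B(\mathbf s):=\vartheta^{s_l}\circ\cdots\circ\vartheta^{s_1}\mathscr B(e)$ (this is well defined, with support in $J(\mathbf s)$). Sequences. A subsequence of $\mathbf s=(s_1,\dots,s_l)$ is obtained by replacing some entries by the blank symbol $\ast$; $I(\mathbf s)$ is the set of all $2^l$ subsequences; $\operatorname{ev}(\sigma)\in\widehat{\mathcal W}$ is the ordered product of the non-blank entries of $\sigma$; $I(\mathbf s)_x=\{\sigma\in I(\mathbf s):\operatorname{ev}(\sigma)=x\}$; $J(\mathbf s)=\{\operatorname{ev}(\sigma):\sigma\in I(\mathbf s)\}$; $\mathbf s'=(s_1,\dots,s_{l-1})$. Structure algebra and $\mathcal X(\mathbf s)$. For $\mathcal I\subset\widehat{\mathcal W}$, $\mathcal Z(\mathcal I)=\{z\in\prod_{x\in\mathcal I}S: z_x\equiv z_{s_\alpha x}\ (\mathrm{mod}\ \bar\alpha)$ whenever $\alpha\in\widehat R$, $x,s_\alpha x\in\mathcal I\}$, an $S$-algebra acting componentwise on $\Gamma(\mathscr M)$ when $\operatorname{supp}\mathscr M\subset\mathcal I$, and on $\bigoplus_{\sigma\in I(\mathbf s)}S$ (for $J(\mathbf s)\subset\mathcal I$) by $(zf)_\sigma=z_{\operatorname{ev}(\sigma)}f_\sigma$.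 For $\lambda\in\widehat X$, $c^\lambda$ is the element with $c^\lambda_x=\overline{x(\lambda)}$. $\Delta:\bigoplus_{\sigma\in I(\mathbf s')}S\to\bigoplus_{\sigma\in I(\mathbf s)}S$ is $\Delta(f)_{\sigma\ast}=\Delta(f)_{\sigma s_l}=f_\sigma$ (appending $\ast$ or $s_l$ to $\sigma\in I(\mathbf s')$). $\mathcal X(\emptyset)=\bigoplus_{\sigma\in I(\emptyset)}S\cong S$, and $\mathcal X(\mathbf s)=\Delta(\mathcal X(\mathbf s'))+c^{\alpha_l}\Delta(\mathcal X(\mathbf s'))$ for $\mathbf s\neq\emptyset$, where $\alpha_l\in\widehat\Pi$, $s_l=s_{\alpha_l}$. $\mathcal X(\mathbf s)^x:=\{f|_{I(\mathbf s)_x}:f\in\mathcal X(\mathbf s)\}$. *)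

theory Defs
  imports Complex_Main "HOL-Library.Poly_Mapping" "HOL-Library.Product_Plus"
    "HOL-Algebra.Bij" "HOL-Algebra.Generated_Groups" "HOL-Algebra.QuotRing" "HOL-Algebra.Module"
begin

class rat_vector = ab_group_add +
  fixes scaleQ :: "rat \<Rightarrow> 'a \<Rightarrow> 'a"  (infixr \<open>*\<^sub>Q\<close> 75)
  assumes scaleQ_add_right: "a *\<^sub>Q (x + y) = a *\<^sub>Q x + a *\<^sub>Q y"
    and scaleQ_add_left: "(a + b) *\<^sub>Q x = a *\<^sub>Q x + b *\<^sub>Q x"
    and scaleQ_scaleQ: "a *\<^sub>Q (b *\<^sub>Q x) = (a * b) *\<^sub>Q x"
    and scaleQ_one: "1 *\<^sub>Q x = x"

global_interpretation rat_vec: vector_space "scaleQ :: rat \<Rightarrow> 'a::rat_vector \<Rightarrow> 'a"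
  by unfold_locales (simp_all add: scaleQ_add_right scaleQ_add_left scaleQ_scaleQ scaleQ_one)

definition dual_space :: "('v::rat_vector \<Rightarrow> rat) set" where
  "dual_space = {f. Vector_Spaces.linear scaleQ (*) f}"

text \<open>In a finite set \<open>R\<close> spanning the space, a vector has at most one such coroot, so the
  description operator below picks it out for every element of a root system.\<close>

definition is_coroot :: "'v::rat_vector set \<Rightarrow> 'v \<Rightarrow> ('v \<Rightarrow> rat) \<Rightarrow> bool" where
  "is_coroot R a f \<longleftrightarrow> f \<in> dual_space \<and> f a = 2 \<and> (\<lambda>v. v - f v *\<^sub>Q a) ` R = R"

definition coroot :: "'v::rat_vector set \<Rightarrow> 'v \<Rightarrow> ('v \<Rightarrow> rat)" where
  "coroot R a = (THE f. is_coroot R a f)"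

text \<open>Finite-dimensionality of the space follows from the first and third conditions.\<close>

definition root_system :: "'v::rat_vector set \<Rightarrow> bool" where
  "root_system R \<longleftrightarrow>
     finite R \<and> 0 \<notin> R \<and> rat_vec.span R = UNIV \<and>
     (\<forall>a\<in>R. \<exists>f. is_coroot R a f) \<and>
     (\<forall>a\<in>R. \<forall>b\<in>R. coroot R a b \<in> \<int>)"

definition reduced_roots :: "'v::rat_vector set \<Rightarrow> bool" where
  "reduced_roots R \<longleftrightarrow> (\<forall>a\<in>R. \<forall>c. c *\<^sub>Q a \<in> R \<longrightarrow> c = 1 \<or> c = -1)"

definition irreducible_roots :: "'v::rat_vector set \<Rightarrow> bool" where
  "irreducible_roots R \<longleftrightarrow> R \<noteq> {} \<and>
     \<not> (\<exists>R1 R2. R1 \<noteq> {} \<and> R2 \<noteq> {} \<and> R1 \<union> R2 = R \<and> R1 \<inter> R2 = {} \<and>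
          (\<forall>a\<in>R1. \<forall>b\<in>R2. coroot R a b = 0 \<and> coroot R b a = 0))"

definition nonneg_comb :: "'v::rat_vector set \<Rightarrow> 'v set" where
  "nonneg_comb B = {\<Sum>b\<in>B. rat_of_nat (n b) *\<^sub>Q b | n. True}"

definition root_base :: "'v::rat_vector set \<Rightarrow> 'v set \<Rightarrow> bool" where
  "root_base R B \<longleftrightarrow> B \<subseteq> R \<and> \<not> rat_vec.dependent B \<and>
     (\<forall>a\<in>R. a \<in> nonneg_comb B \<or> - a \<in> nonneg_comb B)"

definition pos_roots :: "'v::rat_vector set \<Rightarrow> 'v set \<Rightarrow> 'v set" where
  "pos_roots R B = R \<inter> nonneg_comb B"

definition highest_root :: "'v::rat_vector set \<Rightarrow> 'v set \<Rightarrow> 'v" where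
  "highest_root R B = (THE a. a \<in> R \<and> (\<forall>b\<in>R. a - b \<in> nonneg_comb B))"

definition weight_lattice :: "'v::rat_vector set \<Rightarrow> 'v set" where
  "weight_lattice R = {v. \<forall>a\<in>R. coroot R a v \<in> \<int>}"

text \<open>The space of affine weights is \<open>'v \<times> rat\<close>.\<close>

definition aff_weights :: "'v::rat_vector set \<Rightarrow> ('v \<times> rat) set" where
  "aff_weights R = weight_lattice R \<times> \<int>"

definition aff_roots :: "'v::rat_vector set \<Rightarrow> ('v \<times> rat) set" where
  "aff_roots R = R \<times> \<int>"

definition aff_pos_roots :: "'v::rat_vector set \<Rightarrow> 'v set \<Rightarrow> ('v \<times> rat) set" where
  "aff_pos_roots R B = {(a, n). a \<in> R \<and> n \<in> \<int> \<and> n > 0} \<union> {(a, 0) | a. a \<in> pos_roots R B}"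

definition aff_simple_roots :: "'v::rat_vector set \<Rightarrow> 'v set \<Rightarrow> ('v \<times> rat) set" where
  "aff_simple_roots R B = {(a, 0) | a. a \<in> B} \<union> {(- highest_root R B, 1)}"

type_synonym 'v aff_map = "('v \<Rightarrow> rat) \<Rightarrow> ('v \<Rightarrow> rat)"

text \<open>Transformations of the dual space are functions on \<^term>\<open>dual_space\<close>, extended by
  \<^term>\<open>undefined\<close>, as in \<^const>\<open>BijGroup\<close>.\<close>

definition aff_refl :: "'v::rat_vector set \<Rightarrow> 'v \<Rightarrow> rat \<Rightarrow> 'v aff_map" where
  "aff_refl R a n = (\<lambda>f\<in>dual_space. \<lambda>v. f v - (f a - n) * coroot R a v)"

definition root_refl :: "'v::rat_vector set \<Rightarrow> 'v \<times> rat \<Rightarrow> 'v aff_map" where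
  "root_refl R \<gamma> = aff_refl R (fst \<gamma>) (- snd \<gamma>)"

definition aff_weyl :: "'v::rat_vector set \<Rightarrow> 'v aff_map monoid" where
  "aff_weyl R = (BijGroup dual_space)
     \<lparr>carrier := generate (BijGroup dual_space) {aff_refl R a n | a n. a \<in> R \<and> n \<in> \<int>}\<rparr>"

definition simple_refls :: "'v::rat_vector set \<Rightarrow> 'v set \<Rightarrow> 'v aff_map set" where
  "simple_refls R B = root_refl R ` aff_simple_roots R B"

definition word_prod :: "('g, 'b) monoid_scheme \<Rightarrow> 'g list \<Rightarrow> 'g" where
  "word_prod G ws = foldr (\<lambda>x y. x \<otimes>\<^bsub>G\<^esub> y) ws \<one>\<^bsub>G\<^esub>"

definition word_length :: "('g, 'b) monoid_scheme \<Rightarrow> 'g set \<Rightarrow> 'g \<Rightarrow> nat" where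
  "word_length G S w = (LEAST n. \<exists>ws. set ws \<subseteq> S \<and> length ws = n \<and> word_prod G ws = w)"

definition bruhat_less :: "('g, 'b) monoid_scheme \<Rightarrow> 'g set \<Rightarrow> ('g \<times> 'g) set" where
  "bruhat_less G S =
     {(x, t \<otimes>\<^bsub>G\<^esub> x) | x t. x \<in> carrier G \<and>
        (\<exists>w\<in>carrier G. \<exists>s\<in>S. t = w \<otimes>\<^bsub>G\<^esub> s \<otimes>\<^bsub>G\<^esub> inv\<^bsub>G\<^esub> w) \<and>
        word_length G S x < word_length G S (t \<otimes>\<^bsub>G\<^esub> x)}\<^sup>+"

definition aff_less :: "'v::rat_vector set \<Rightarrow> 'v set \<Rightarrow> ('v aff_map \<times> 'v aff_map) set" where
  "aff_less R B = bruhat_less (aff_weyl R) (simple_refls R B)"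

text \<open>The linear action on affine weights is prescribed on the reflections; the result does not
  depend on how an element is written as a product of reflections, because
  \<open>(l, n)\<close> is the affine function \<open>f \<mapsto> f l + n\<close> on the dual space, on which the group acts by
  precomposition with inverses.\<close>

definition lin_refl :: "'v::rat_vector set \<Rightarrow> 'v \<times> rat \<Rightarrow> 'v \<times> rat \<Rightarrow> 'v \<times> rat" where
  "lin_refl R \<gamma> \<beta> =
     (fst \<beta> - coroot R (fst \<gamma>) (fst \<beta>) *\<^sub>Q fst \<gamma>,
      snd \<beta> - coroot R (fst \<gamma>) (fst \<beta>) * snd \<gamma>)"

inductive acts_as :: "'v::rat_vector set \<Rightarrow> 'v aff_map \<Rightarrow> ('v \<times> rat \<Rightarrow> 'v \<times> rat) \<Rightarrow> bool"
  for R where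
  "acts_as R \<one>\<^bsub>aff_weyl R\<^esub> id"
| "\<gamma> \<in> aff_roots R \<Longrightarrow> acts_as R w T \<Longrightarrow>
     acts_as R (root_refl R \<gamma> \<otimes>\<^bsub>aff_weyl R\<^esub> w) (lin_refl R \<gamma> \<circ> T)"

definition weyl_act :: "'v::rat_vector set \<Rightarrow> 'v aff_map \<Rightarrow> 'v \<times> rat \<Rightarrow> 'v \<times> rat" where
  "weyl_act R w = (THE T. acts_as R w T)"

definition poly_ring_on :: "'a set \<Rightarrow> (('a \<Rightarrow>\<^sub>0 nat) \<Rightarrow>\<^sub>0 'f::field) ring" where
  "poly_ring_on A = \<lparr>carrier = {p. \<forall>m\<in>Poly_Mapping.keys p. Poly_Mapping.keys m \<subseteq> A},
     monoid.mult = (*), one = 1, zero = 0, add = (+)\<rparr>"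

definition poly_var :: "'a \<Rightarrow> (('a \<Rightarrow>\<^sub>0 nat) \<Rightarrow>\<^sub>0 'f::field)" where
  "poly_var a = Poly_Mapping.single (Poly_Mapping.single a 1) 1"

text \<open>For a subgroup \<open>A\<close> of the ambient group, the symmetric algebra of the \<open>'f\<close>-space
  \<open>A \<otimes> 'f\<close> is the free commutative \<open>'f\<close>-algebra on symbols \<open>a \<otimes> 1\<close>, for \<open>a \<in> A\<close>, modulo
  additivity of \<open>a \<mapsto> a \<otimes> 1\<close>.\<close>

definition sym_ideal :: "'a::ab_group_add set \<Rightarrow> (('a \<Rightarrow>\<^sub>0 nat) \<Rightarrow>\<^sub>0 'f::field) set" where
  "sym_ideal A = Idl\<^bsub>poly_ring_on A\<^esub>
     {poly_var (a + b) - poly_var a - poly_var b | a b. a \<in> A \<and> b \<in> A}"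

definition sym_alg :: "'a::ab_group_add set \<Rightarrow> (('a \<Rightarrow>\<^sub>0 nat) \<Rightarrow>\<^sub>0 'f::field) set ring" where
  "sym_alg A = poly_ring_on A Quot sym_ideal A"

definition sym_var :: "'a::ab_group_add set \<Rightarrow> 'a \<Rightarrow> (('a \<Rightarrow>\<^sub>0 nat) \<Rightarrow>\<^sub>0 'f::field) set" where
  "sym_var A a = sym_ideal A +>\<^bsub>poly_ring_on A\<^esub> poly_var a"

definition sym_const :: "'a::ab_group_add set \<Rightarrow> 'f::field \<Rightarrow> (('a \<Rightarrow>\<^sub>0 nat) \<Rightarrow>\<^sub>0 'f) set" where
  "sym_const A c = sym_ideal A +>\<^bsub>poly_ring_on A\<^esub> Poly_Mapping.single 0 c"

type_synonym ('v, 'f) sym = "((('v \<times> rat) \<Rightarrow>\<^sub>0 nat) \<Rightarrow>\<^sub>0 'f) set"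

definition aff_sym :: "'v::rat_vector set \<Rightarrow> ('v, 'f::field) sym ring" where
  "aff_sym R = sym_alg (aff_weights R)"

definition bar :: "'v::rat_vector set \<Rightarrow> 'v \<times> rat \<Rightarrow> ('v, 'f::field) sym" where
  "bar R l = sym_var (aff_weights R) l"

definition proportional :: "'v::rat_vector set \<Rightarrow> ('v, 'f::field) sym \<Rightarrow> ('v, 'f) sym \<Rightarrow> bool" where
  "proportional R a b \<longleftrightarrow>
     (\<exists>c. a = sym_const (aff_weights R) c \<otimes>\<^bsub>aff_sym R\<^esub> b \<or>
          b = sym_const (aff_weights R) c \<otimes>\<^bsub>aff_sym R\<^esub> a)"

text \<open>An edge \<open>x \<rightarrow> y\<close> is a triple \<open>(x, y, i)\<close>; the third component tells parallel edges apart.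
  In the graphs below it is the positive affine root whose image in the symmetric algebra is
  the label.\<close>

type_synonym ('x, 'i) edge = "'x \<times> 'x \<times> 'i"

record ('x, 'i, 's) moment_graph =
  verts :: "'x set"
  edges :: "('x, 'i) edge set"
  label :: "('x, 'i) edge \<Rightarrow> 's"

definition full_subgraph ::
  "('x, 'i, 's) moment_graph \<Rightarrow> 'x set \<Rightarrow> ('x, 'i, 's) moment_graph" where
  "full_subgraph G I = \<lparr>verts = verts G \<inter> I,
     edges = {(x, y, i). (x, y, i) \<in> edges G \<and> x \<in> I \<and> y \<in> I}, label = label G\<rparr>"

fun ends :: "('x, 'i) edge \<Rightarrow> 'x set" where
  "ends (x, y, i) = {x, y}"

definition gkm ::
  "'v::rat_vector set \<Rightarrow> ('x, 'i, ('v, 'f::field) sym) moment_graph \<Rightarrow> bool" where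
  "gkm R G \<longleftrightarrow> (\<forall>E\<in>edges G. \<forall>E'\<in>edges G. E \<noteq> E' \<and> ends E \<inter> ends E' \<noteq> {} \<longrightarrow>
     \<not> proportional R (label G E) (label G E'))"

definition aff_graph :: "'v::rat_vector set \<Rightarrow> 'v set \<Rightarrow>
    ('v aff_map, 'v \<times> rat, ('v, 'f::field) sym) moment_graph" where
  "aff_graph R B = \<lparr>verts = carrier (aff_weyl R),
     edges = {(x, y, \<gamma>). (x, y) \<in> aff_less R B \<and> \<gamma> \<in> aff_pos_roots R B \<and>
                y = root_refl R \<gamma> \<otimes>\<^bsub>aff_weyl R\<^esub> x},
     label = (\<lambda>(x, y, \<gamma>). bar R \<gamma>)\<rparr>"

definition pair_coset :: "'v::rat_vector set \<Rightarrow> 'v aff_map \<Rightarrow> 'v aff_map \<Rightarrow> 'v aff_map set" where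
  "pair_coset R s x = {x, x \<otimes>\<^bsub>aff_weyl R\<^esub> s}"

definition quot_graph :: "'v::rat_vector set \<Rightarrow> 'v set \<Rightarrow> 'v aff_map \<Rightarrow>
    ('v aff_map set, 'v \<times> rat, ('v, 'f::field) sym) moment_graph" where
  "quot_graph R B s = \<lparr>verts = pair_coset R s ` carrier (aff_weyl R),
     edges = {(X, Y, \<gamma>). X \<in> pair_coset R s ` carrier (aff_weyl R) \<and>
                Y \<in> pair_coset R s ` carrier (aff_weyl R) \<and>
                X \<noteq> Y \<and> (\<exists>u\<in>X. \<exists>v\<in>Y. (u, v) \<in> aff_less R B) \<and>
                \<gamma> \<in> aff_pos_roots R B \<and> (\<lambda>x. root_refl R \<gamma> \<otimes>\<^bsub>aff_weyl R\<^esub> x) ` X = Y},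
     label = (\<lambda>(X, Y, \<gamma>). bar R \<gamma>)\<rparr>"

fun bar_edge :: "'v::rat_vector set \<Rightarrow> 'v aff_map \<Rightarrow> ('v aff_map, 'i) edge \<Rightarrow>
    ('v aff_map set, 'i) edge" where
  "bar_edge R s (x, y, i) = (pair_coset R s x, pair_coset R s y, i)"

text \<open>The module records of \<^theory>\<open>HOL-Algebra.Module\<close> contain fields for a ring multiplication,
  which are irrelevant for modules and left \<^term>\<open>undefined\<close>.\<close>

definition ring_module :: "'s ring \<Rightarrow> ('s, 's) module" where
  "ring_module S = \<lparr>carrier = carrier S, monoid.mult = undefined, one = undefined,
     zero = zero S, add = add S, smult = monoid.mult S\<rparr>"

definition zero_module :: "'m \<Rightarrow> ('s, 'm) module" where
  "zero_module z = \<lparr>carrier = {z}, monoid.mult = undefined, one = undefined,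
     zero = z, add = (\<lambda>_ _. z), smult = (\<lambda>_ _. z)\<rparr>"

definition prod_module :: "'i set \<Rightarrow> ('i \<Rightarrow> ('s, 'm) module) \<Rightarrow> ('s, 'i \<Rightarrow> 'm) module" where
  "prod_module I M = \<lparr>carrier = (\<Pi>\<^sub>E i\<in>I. carrier (M i)), monoid.mult = undefined, one = undefined,
     zero = (\<lambda>i\<in>I. \<zero>\<^bsub>M i\<^esub>), add = (\<lambda>f g. \<lambda>i\<in>I. f i \<oplus>\<^bsub>M i\<^esub> g i),
     smult = (\<lambda>a f. \<lambda>i\<in>I. a \<odot>\<^bsub>M i\<^esub> f i)\<rparr>"

definition quot_module :: "('s, 'm) module \<Rightarrow> 'm set \<Rightarrow> ('s, 'm set) module" where
  "quot_module M N = \<lparr>carrier = a_rcosets\<^bsub>M\<^esub> N, monoid.mult = undefined, one = undefined,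
     zero = N, add = set_add M, smult = (\<lambda>a A. \<Union>m\<in>A. N +>\<^bsub>M\<^esub> (a \<odot>\<^bsub>M\<^esub> m))\<rparr>"

text \<open>Transport of the module structure along an injection \<open>f\<close> with left inverse \<open>g\<close>.\<close>

definition map_module :: "('m \<Rightarrow> 'n) \<Rightarrow> ('n \<Rightarrow> 'm) \<Rightarrow> ('s, 'm) module \<Rightarrow> ('s, 'n) module" where
  "map_module f g M = \<lparr>carrier = f ` carrier M, monoid.mult = undefined, one = undefined,
     zero = f \<zero>\<^bsub>M\<^esub>, add = (\<lambda>x y. f (g x \<oplus>\<^bsub>M\<^esub> g y)), smult = (\<lambda>a x. f (a \<odot>\<^bsub>M\<^esub> g x))\<rparr>"

definition module_iso :: "'s ring \<Rightarrow> ('s, 'm) module \<Rightarrow> ('s, 'n) module \<Rightarrow> ('m \<Rightarrow> 'n) \<Rightarrow> bool" where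
  "module_iso S M N h \<longleftrightarrow> Module.module S M \<and> Module.module S N \<and>
     h \<in> iso (add_monoid M) (add_monoid N) \<and>
     (\<forall>a\<in>carrier S. \<forall>m\<in>carrier M. h (a \<odot>\<^bsub>M\<^esub> m) = a \<odot>\<^bsub>N\<^esub> h m)"

text \<open>The grading is not recorded: none of the modules below depends on it.\<close>

record ('x, 'i, 's, 'm, 'n) graph_sheaf =
  graph :: "('x, 'i, 's) moment_graph"
  stalk :: "'x \<Rightarrow> ('s, 'm) module"
  edge_stalk :: "('x, 'i) edge \<Rightarrow> ('s, 'n) module"
  res :: "'x \<Rightarrow> ('x, 'i) edge \<Rightarrow> 'm \<Rightarrow> 'n"

definition sections ::
  "('x, 'i, 's, 'm, 'n) graph_sheaf \<Rightarrow> 'x set \<Rightarrow> ('s, 'x \<Rightarrow> 'm) module" where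
  "sections M I = (prod_module I (stalk M))
     \<lparr>carrier := {m \<in> (\<Pi>\<^sub>E x\<in>I. carrier (stalk M x)).
        \<forall>(x, y, i)\<in>edges (graph M). x \<in> I \<and> y \<in> I \<longrightarrow>
          res M x (x, y, i) (m x) = res M y (x, y, i) (m y)}\<rparr>"

text \<open>Iterating the translation functors produces ever deeper families, so the stalks of all
  Bott--Samelson sheaves live in a type closed under forming families: over vertices for the
  stalks at vertices, over edges for the stalks at edges.  The latter start from
  cosets of elements of the former.\<close>

datatype ('i, 'a) nest = Elt (elt: 'a) | Fam (fam: "'i \<Rightarrow> ('i, 'a) nest")

type_synonym ('v, 'f) vert_elt = "('v aff_map, ('v, 'f) sym) nest"
type_synonym ('v, 'f) edge_elt =
  "(('v aff_map, 'v \<times> rat) edge, ('v, 'f) vert_elt set) nest"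
type_synonym ('v, 'f) aff_sheaf =
  "('v aff_map, 'v \<times> rat, ('v, 'f) sym, ('v, 'f) vert_elt, ('v, 'f) edge_elt) graph_sheaf"
type_synonym ('v, 'f) quot_sheaf =
  "('v aff_map set, 'v \<times> rat, ('v, 'f) sym, ('v, 'f) vert_elt, ('v, 'f) edge_elt) graph_sheaf"

text \<open>If \<open>E\<close> is induced by \<open>E'\<close> then the edges inducing \<open>E\<close> are exactly \<open>E'\<close> and \<open>E's\<close>.\<close>

definition edge_lifts :: "'v::rat_vector set \<Rightarrow> 'v aff_map \<Rightarrow>
    ('v aff_map, 'i, 's) moment_graph \<Rightarrow> ('v aff_map set, 'i) edge \<Rightarrow> ('v aff_map, 'i) edge set" where
  "edge_lifts R s G E = {E' \<in> edges G. bar_edge R s E' = E}"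

text \<open>The endpoint of an edge lying in a given set that contains exactly one of its endpoints.\<close>

fun end_in :: "'x set \<Rightarrow> ('x, 'i) edge \<Rightarrow> 'x" where
  "end_in X (x, y, i) = (if x \<in> X then x else y)"

definition on_res :: "'v::rat_vector set \<Rightarrow> 'v aff_map \<Rightarrow> ('v, 'f::field) aff_sheaf \<Rightarrow>
    'v aff_map set \<Rightarrow> ('v aff_map set, 'v \<times> rat) edge \<Rightarrow>
    ('v, 'f) vert_elt \<Rightarrow> ('v, 'f) edge_elt" where
  "on_res R s M X E m =
     Fam (\<lambda>E'\<in>edge_lifts R s (graph M) E. res M (end_in X E') E' (fam m (end_in X E')))"

definition theta_on :: "'v::rat_vector set \<Rightarrow> 'v set \<Rightarrow> 'v aff_map \<Rightarrow>
    ('v, 'f::field) aff_sheaf \<Rightarrow> ('v, 'f) quot_sheaf" where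
  "theta_on R B s M = \<lparr>graph = quot_graph R B s,
     stalk = (\<lambda>X. map_module Fam fam (sections M X)),
     edge_stalk = (\<lambda>(X, Y, \<gamma>).
       (map_module Fam fam (prod_module (edge_lifts R s (graph M) (X, Y, \<gamma>)) (edge_stalk M)))
         \<lparr>carrier := on_res R s M Y (X, Y, \<gamma>) ` Fam ` carrier (sections M Y)\<rparr>),
     res = on_res R s M\<rparr>"

definition smult_image :: "('s, 'm) module \<Rightarrow> 's \<Rightarrow> 'm set" where
  "smult_image M a = {a \<odot>\<^bsub>M\<^esub> m | m. m \<in> carrier M}"

definition theta_out :: "'v::rat_vector set \<Rightarrow> 'v set \<Rightarrow> 'v aff_map \<Rightarrow>
    ('v, 'f::field) quot_sheaf \<Rightarrow> ('v, 'f) aff_sheaf" where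
  "theta_out R B s Q = \<lparr>graph = aff_graph R B,
     stalk = (\<lambda>x. stalk Q (pair_coset R s x)),
     edge_stalk = (\<lambda>(x, y, \<gamma>).
       if y = x \<otimes>\<^bsub>aff_weyl R\<^esub> s then
         map_module Elt elt (quot_module (stalk Q (pair_coset R s x))
           (smult_image (stalk Q (pair_coset R s x)) (bar R \<gamma>)))
       else edge_stalk Q (bar_edge R s (x, y, \<gamma>))),
     res = (\<lambda>z (x, y, \<gamma>) m.
       if y = x \<otimes>\<^bsub>aff_weyl R\<^esub> s then
         Elt (smult_image (stalk Q (pair_coset R s x)) (bar R \<gamma>)
           +>\<^bsub>stalk Q (pair_coset R s x)\<^esub> m)
       else res Q (pair_coset R s z) (bar_edge R s (x, y, \<gamma>)) m)\<rparr>"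

definition theta :: "'v::rat_vector set \<Rightarrow> 'v set \<Rightarrow> 'v aff_map \<Rightarrow>
    ('v, 'f::field) aff_sheaf \<Rightarrow> ('v, 'f) aff_sheaf" where
  "theta R B s M = theta_out R B s (theta_on R B s M)"

definition unit_sheaf :: "'v::rat_vector set \<Rightarrow> 'v set \<Rightarrow> ('v, 'f::field) aff_sheaf" where
  "unit_sheaf R B = \<lparr>graph = aff_graph R B,
     stalk = (\<lambda>x. if x = \<one>\<^bsub>aff_weyl R\<^esub> then map_module Elt elt (ring_module (aff_sym R))
                  else zero_module (Elt \<zero>\<^bsub>aff_sym R\<^esub>)),
     edge_stalk = (\<lambda>E. zero_module (Elt {})),
     res = (\<lambda>x E m. Elt {})\<rparr>"

definition bott_samelson :: "'v::rat_vector set \<Rightarrow> 'v set \<Rightarrow> 'v aff_map list \<Rightarrow>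
    ('v, 'f::field) aff_sheaf" where
  "bott_samelson R B ss = foldl (\<lambda>M s. theta R B s M) (unit_sheaf R B) ss"

text \<open>The blank symbol is \<^const>\<open>None\<close>.\<close>

definition subseqs_of :: "'g list \<Rightarrow> 'g option list set" where
  "subseqs_of ss = {\<sigma>. list_all2 (\<lambda>u s. u = None \<or> u = Some s) \<sigma> ss}"

definition ev :: "'v::rat_vector set \<Rightarrow> 'v aff_map option list \<Rightarrow> 'v aff_map" where
  "ev R \<sigma> = word_prod (aff_weyl R) (map the (filter (\<lambda>u. u \<noteq> None) \<sigma>))"

definition subseqs_at :: "'v::rat_vector set \<Rightarrow> 'v aff_map list \<Rightarrow> 'v aff_map \<Rightarrow>
    'v aff_map option list set" where
  "subseqs_at R ss x = {\<sigma> \<in> subseqs_of ss. ev R \<sigma> = x}"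

definition ev_set :: "'v::rat_vector set \<Rightarrow> 'v aff_map list \<Rightarrow> 'v aff_map set" where
  "ev_set R ss = ev R ` subseqs_of ss"

definition struct_alg :: "'v::rat_vector set \<Rightarrow> 'v aff_map set \<Rightarrow>
    ('v aff_map \<Rightarrow> ('v, 'f::field) sym) ring" where
  "struct_alg R I = \<lparr>carrier = {z \<in> (\<Pi>\<^sub>E x\<in>I. carrier (aff_sym R)).
       \<forall>\<gamma>\<in>aff_roots R. \<forall>x\<in>I. root_refl R \<gamma> \<otimes>\<^bsub>aff_weyl R\<^esub> x \<in> I \<longrightarrow>
         z x \<ominus>\<^bsub>aff_sym R\<^esub> z (root_refl R \<gamma> \<otimes>\<^bsub>aff_weyl R\<^esub> x) \<in> PIdl\<^bsub>aff_sym R\<^esub> (bar R \<gamma>)},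
     monoid.mult = (\<lambda>z z'. \<lambda>x\<in>I. z x \<otimes>\<^bsub>aff_sym R\<^esub> z' x),
     one = (\<lambda>x\<in>I. \<one>\<^bsub>aff_sym R\<^esub>),
     zero = (\<lambda>x\<in>I. \<zero>\<^bsub>aff_sym R\<^esub>),
     add = (\<lambda>z z'. \<lambda>x\<in>I. z x \<oplus>\<^bsub>aff_sym R\<^esub> z' x)\<rparr>"

text \<open>The action on global sections of a sheaf supported in \<open>I\<close>: outside \<open>I\<close> the
  stalks vanish.\<close>

definition global_sections :: "'v::rat_vector set \<Rightarrow> 'v aff_map set \<Rightarrow> ('v, 'f::field) aff_sheaf \<Rightarrow>
    ('v aff_map \<Rightarrow> ('v, 'f) sym, 'v aff_map \<Rightarrow> ('v, 'f) vert_elt) module" where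
  "global_sections R I M = \<lparr>carrier = carrier (sections M (verts (graph M))),
     monoid.mult = undefined, one = undefined,
     zero = zero (sections M (verts (graph M))),
     add = add (sections M (verts (graph M))),
     smult = (\<lambda>z m. \<lambda>x\<in>verts (graph M).
       if x \<in> I then z x \<odot>\<^bsub>stalk M x\<^esub> m x else \<zero>\<^bsub>stalk M x\<^esub>)\<rparr>"

type_synonym ('v, 'f) subseq_fun = "'v aff_map option list \<Rightarrow> ('v, 'f) sym"

definition subseq_module :: "'v::rat_vector set \<Rightarrow> 'v aff_map list \<Rightarrow>
    ('v aff_map \<Rightarrow> ('v, 'f::field) sym, ('v, 'f) subseq_fun) module" where
  "subseq_module R ss = \<lparr>carrier = (\<Pi>\<^sub>E \<sigma>\<in>subseqs_of ss. carrier (aff_sym R)),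
     monoid.mult = undefined, one = undefined,
     zero = (\<lambda>\<sigma>\<in>subseqs_of ss. \<zero>\<^bsub>aff_sym R\<^esub>),
     add = (\<lambda>f g. \<lambda>\<sigma>\<in>subseqs_of ss. f \<sigma> \<oplus>\<^bsub>aff_sym R\<^esub> g \<sigma>),
     smult = (\<lambda>z f. \<lambda>\<sigma>\<in>subseqs_of ss. z (ev R \<sigma>) \<otimes>\<^bsub>aff_sym R\<^esub> f \<sigma>)\<rparr>"

definition weight_elt :: "'v::rat_vector set \<Rightarrow> 'v aff_map set \<Rightarrow> 'v \<times> rat \<Rightarrow>
    'v aff_map \<Rightarrow> ('v, 'f::field) sym" where
  "weight_elt R I l = (\<lambda>x\<in>I. bar R (weyl_act R x l))"

definition simple_root_of :: "'v::rat_vector set \<Rightarrow> 'v set \<Rightarrow> 'v aff_map \<Rightarrow> 'v \<times> rat" where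
  "simple_root_of R B s = (THE \<gamma>. \<gamma> \<in> aff_simple_roots R B \<and> root_refl R \<gamma> = s)"

definition dup :: "'g list \<Rightarrow> ('g option list \<Rightarrow> 's) \<Rightarrow> ('g option list \<Rightarrow> 's)" where
  "dup ss f = (\<lambda>\<sigma>\<in>subseqs_of ss. f (butlast \<sigma>))"

function X_carrier :: "'v::rat_vector set \<Rightarrow> 'v set \<Rightarrow> 'v aff_map list \<Rightarrow>
    ('v, 'f::field) subseq_fun set" where
  "X_carrier R B ss =
     (if ss = [] then carrier (subseq_module R [])
      else {dup ss f \<oplus>\<^bsub>subseq_module R ss\<^esub>
              (weight_elt R (ev_set R ss) (simple_root_of R B (last ss))
                 \<odot>\<^bsub>subseq_module R ss\<^esub> dup ss g) | f g.
              f \<in> X_carrier R B (butlast ss) \<and> g \<in> X_carrier R B (butlast ss)})"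
  by pat_completeness auto
termination by (relation "measure (\<lambda>(R, B, ss). length ss)") auto

declare X_carrier.simps [simp del]

definition X_module :: "'v::rat_vector set \<Rightarrow> 'v set \<Rightarrow> 'v aff_map list \<Rightarrow>
    ('v aff_map \<Rightarrow> ('v, 'f::field) sym, ('v, 'f) subseq_fun) module" where
  "X_module R B ss = (subseq_module R ss)\<lparr>carrier := X_carrier R B ss\<rparr>"

definition X_stalk :: "'v::rat_vector set \<Rightarrow> 'v set \<Rightarrow> 'v aff_map list \<Rightarrow> 'v aff_map \<Rightarrow>
    (('v, 'f::field) sym, ('v, 'f) subseq_fun) module" where
  "X_stalk R B ss x = (prod_module (subseqs_at R ss x) (\<lambda>_. ring_module (aff_sym R)))
     \<lparr>carrier := {restrict f (subseqs_at R ss x) | f. f \<in> X_carrier R B ss}\<rparr>"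

end

theory Submission
  imports Defs "HOL-Computational_Algebra.Polynomial"
begin

text \<open>The stalk \<open>\<B>(s)\<^sup>x\<close> embeds into the functions on \<open>I(s)\<^sub>x\<close> by reading off nested families, and
  under this embedding \<open>\<X>(s) = \<Delta>\<X>(s') + c \<Delta>\<X>(s')\<close> says that every global section \<open>m\<close> of
  \<open>\<vartheta>\<^sup>s M\<close> has the form \<open>b + c\<^sup>\<alpha> a\<close> with global sections \<open>a, b\<close> of \<open>M\<close>.  On a pair \<open>{x, xs}\<close> the elements
  \<open>a, b\<close> are obtained by halving, as \<open>c\<^sup>\<alpha>\<close> changes sign along the edge from \<open>x\<close> to \<open>xs\<close>; that they are
  compatible along any other edge \<open>E\<close> at \<open>x\<close> follows by cancelling \<open>x(\<alpha>)\<close>, which by the GKM property is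
  not proportional to the label of \<open>E\<close>.  For this one carries along the induction that the stalks are
  torsion free, that \<open>c m = d n\<close> with non-proportional labels \<open>c, d\<close> makes \<open>m\<close> divisible by \<open>d\<close>, and
  that a scalar not proportional to the label of an edge may be cancelled in the relation of agreeing
  on that edge.

  That global sections surject onto stalks is proved by extending sections from all left translates of
  lower sets of the Bruhat order, among which are the singletons.\<close>

section \<open>Finite root systems\<close>

text \<open>A stalk of a translated sheaf consists of sections over a pair {x, xs}. Surjectivity of
  global sections onto stalks can therefore not be carried through the induction alone: extending
  from a point after a translation means extending from a pair before it, and from larger sets
  before that. The class of sets used must contain all points, be closed under passing to the
  largest subset and to the smallest superset stable under right multiplication by s, and allow a
  section to be made constant on pairs that it meets only halfway. Lower sets have the last two
  properties because a simple reflection changes the sign of only one positive root; both survive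
  left translation, which carries the lower set {1} to any point.

  The affine Weyl group is developed just far enough for one fact: for a positive root \<gamma>, the
  edge between x and \<open>rr \<gamma>\<close> x points away from x exactly when the inverse of x
  sends \<gamma> to a positive root. Arguments about the order then become arguments about signs of
  roots.\<close>

lemma dual_space_iff:
  "f \<in> dual_space \<longleftrightarrow> (\<forall>x y. f (x + y) = f x + f y) \<and> (\<forall>c x. f (c *\<^sub>Q x) = c * f x)"
  unfolding dual_space_def Vector_Spaces.linear_iff
  by (auto simp: rat_vec.vector_space_axioms vector_space_def algebra_simps)

lemma dual_add: "f \<in> dual_space \<Longrightarrow> f (x + y) = f x + f y"
  and dual_scale: "f \<in> dual_space \<Longrightarrow> f (c *\<^sub>Q x) = c * f x"
  by (auto simp: dual_space_iff)

lemma dual_zero: "f \<in> dual_space \<Longrightarrow> f 0 = 0"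
  using dual_scale[of f 0 0] by simp

lemma dual_uminus: "f \<in> dual_space \<Longrightarrow> f (- x) = - f x"
  using dual_add[of f x "- x"] by (simp add: dual_zero)

lemma dual_diff: "f \<in> dual_space \<Longrightarrow> f (x - y) = f x - f y"
  using dual_add[of f x "- y"] by (simp add: dual_uminus)

lemma dual_sum: "f \<in> dual_space \<Longrightarrow> f (sum g A) = (\<Sum>x\<in>A. f (g x))"
  by (induction A rule: infinite_finite_induct) (auto simp: dual_zero dual_add)

lemmas dual_simps = dual_add dual_scale dual_zero dual_uminus dual_diff

lemma dual_separates:
  fixes v :: "'v::rat_vector"
  assumes "\<And>f. f \<in> dual_space \<Longrightarrow> f v = 0"
  shows "v = 0"
proof (rule ccontr)
  assume "v \<noteq> 0"
  interpret vs: vector_space "(*) :: rat \<Rightarrow> rat \<Rightarrow> rat"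
    by unfold_locales (auto simp: algebra_simps)
  interpret p: vector_space_pair "scaleQ :: rat \<Rightarrow> 'v \<Rightarrow> 'v" "(*) :: rat \<Rightarrow> rat \<Rightarrow> rat" ..
  have "rat_vec.independent {v}" using \<open>v \<noteq> 0\<close> by simp
  from p.linear_independent_extend[OF this, of "\<lambda>_. 1"]
  obtain f where "Vector_Spaces.linear scaleQ (*) f" "f v = 1" by auto
  with assms[of f] show False by (simp add: dual_space_def)
qed

lemma dual_eq_on_span:
  fixes f g :: "'v::rat_vector \<Rightarrow> rat"
  assumes "f \<in> dual_space" "g \<in> dual_space" "\<And>x. x \<in> A \<Longrightarrow> f x = g x" "x \<in> rat_vec.span A"
  shows "f x = g x"
proof -
  interpret vs: vector_space "(*) :: rat \<Rightarrow> rat \<Rightarrow> rat"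
    by unfold_locales (auto simp: algebra_simps)
  interpret p: vector_space_pair "scaleQ :: rat \<Rightarrow> 'v \<Rightarrow> 'v" "(*) :: rat \<Rightarrow> rat \<Rightarrow> rat" ..
  show ?thesis using assms p.linear_eq_on[of f g x A] by (auto simp: dual_space_def)
qed

lemma dual_zero_mem: "(\<lambda>_. 0) \<in> dual_space"
  by (auto simp: dual_space_iff)

text \<open>Two coroots of \<open>a\<close> differ by a unipotent transformation permuting \<open>R\<close>.\<close>

lemma is_coroot_unique:
  assumes "finite R" "rat_vec.span R = UNIV" "is_coroot R a f" "is_coroot R a g"
  shows "f = g"
proof -
  have df: "f \<in> dual_space" "g \<in> dual_space" and fa: "f a = 2" "g a = 2"
    using assms by (auto simp: is_coroot_def)
  define h where "h v = g v - f v" for v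
  have h: "h \<in> dual_space" using df by (auto simp: h_def dual_space_iff algebra_simps)
  have a0: "a \<noteq> 0" using fa df by (auto simp: dual_zero)
  have ha: "h a = 0" by (simp add: h_def fa)
  have step: "v + h v *\<^sub>Q a \<in> R" if "v \<in> R" for v
  proof -
    have 1: "v - g v *\<^sub>Q a \<in> R" using assms(4) that by (auto simp: is_coroot_def)
    have "(v - g v *\<^sub>Q a) - f (v - g v *\<^sub>Q a) *\<^sub>Q a \<in> R"
      using assms(3) 1 unfolding is_coroot_def by blast
    moreover have "(v - g v *\<^sub>Q a) - f (v - g v *\<^sub>Q a) *\<^sub>Q a = v + h v *\<^sub>Q a"
    proof -
      have *: "f (v - g v *\<^sub>Q a) = f v - (g v + g v)" by (simp add: dual_simps df fa)
      show ?thesis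
        unfolding * h_def rat_vec.scale_left_diff_distrib scaleQ_add_left by (simp add: algebra_simps)
    qed
    ultimately show ?thesis by simp
  qed
  \<comment> \<open>As \<open>h\<close> kills \<open>a\<close>, iterating the shift produces an
    arithmetic progression inside the finite set \<open>R\<close>.\<close>
  have iter: "v + (of_nat n * h v) *\<^sub>Q a \<in> R" if "v \<in> R" for v n
  proof (induction n)
    case (Suc n)
    have "h (v + (of_nat n * h v) *\<^sub>Q a) = h v" by (simp add: dual_simps h ha)
    with step[OF Suc] show ?case by (simp add: algebra_simps scaleQ_add_left)
  qed (use that in simp)
  have hz: "h v = 0" if "v \<in> R" for v
  proof (rule ccontr)
    assume "h v \<noteq> 0"
    then have "inj (\<lambda>n. v + (of_nat n * h v) *\<^sub>Q a)"
      using a0 by (auto simp: inj_def)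
    moreover have "range (\<lambda>n. v + (of_nat n * h v) *\<^sub>Q a) \<subseteq> R" using iter that by auto
    ultimately show False
      using assms(1) by (meson finite_subset infinite_UNIV_nat finite_imageD)
  qed
  have "g x = f x" for x
    by (rule dual_eq_on_span[of g f R]) (use df hz assms(2) in \<open>auto simp: h_def\<close>)
  then show ?thesis by auto
qed

locale finite_root_system =
  fixes R :: "'v::rat_vector set"
  assumes roots: "root_system R"
begin

lemma finR: "finite R" and zero_notin: "0 \<notin> R" and spanR: "rat_vec.span R = UNIV"
  and ex_coroot: "a \<in> R \<Longrightarrow> \<exists>f. is_coroot R a f"
  and coroot_Ints: "a \<in> R \<Longrightarrow> b \<in> R \<Longrightarrow> coroot R a b \<in> \<int>"
  using roots by (auto simp: root_system_def)

lemma is_coroot_eq: "is_coroot R a f \<Longrightarrow> coroot R a = f"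
  unfolding coroot_def using is_coroot_unique[OF finR spanR] by blast

lemma is_coroot_coroot: "a \<in> R \<Longrightarrow> is_coroot R a (coroot R a)"
  using ex_coroot is_coroot_eq by metis

lemma coroot_dual: "a \<in> R \<Longrightarrow> coroot R a \<in> dual_space"
  and coroot_self: "a \<in> R \<Longrightarrow> coroot R a a = 2"
  using is_coroot_coroot by (auto simp: is_coroot_def)

lemmas coroot_simps = dual_simps[OF coroot_dual] coroot_self

abbreviation rfl :: "'v \<Rightarrow> 'v \<Rightarrow> 'v" where
  "rfl a v \<equiv> v - coroot R a v *\<^sub>Q a"

lemma rfl_image: "a \<in> R \<Longrightarrow> rfl a ` R = R"
  using is_coroot_coroot by (auto simp: is_coroot_def)

lemma rfl_in: "a \<in> R \<Longrightarrow> b \<in> R \<Longrightarrow> rfl a b \<in> R"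
  using rfl_image by blast

lemma two_scale: "2 *\<^sub>Q a = a + (a :: 'w::rat_vector)"
  using scaleQ_add_left[of 1 1 a] by (simp add: scaleQ_one)

lemma rfl_self: "a \<in> R \<Longrightarrow> rfl a a = - a"
  by (simp add: coroot_self two_scale)

lemma rfl_rfl: "a \<in> R \<Longrightarrow> rfl a (rfl a v) = v"
  by (simp add: coroot_simps)

lemma neg_in: "a \<in> R \<Longrightarrow> - a \<in> R"
  using rfl_in rfl_self by metis

text \<open>Conjugating the reflection in \<open>b\<close> by the one in \<open>a\<close> gives a
  reflection along \<open>rfl a b\<close> that permutes \<open>R\<close>, so uniqueness of coroots
  identifies its functional.\<close>

lemma coroot_rfl:
  assumes "a \<in> R" "b \<in> R"
  shows "coroot R (rfl a b) = (\<lambda>v. coroot R b (rfl a v))"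
proof (rule is_coroot_eq, unfold is_coroot_def, intro conjI)
  show "(\<lambda>v. coroot R b (rfl a v)) \<in> dual_space"
    unfolding dual_space_iff by (simp add: coroot_simps assms algebra_simps)
  show "coroot R b (rfl a (rfl a b)) = 2"
    by (simp add: rfl_rfl[OF assms(1)] coroot_self assms)
  have eq: "v - coroot R b (rfl a v) *\<^sub>Q rfl a b = rfl a (rfl b (rfl a v))" for v
    using assms
    by (simp add: rfl_rfl coroot_simps algebra_simps rat_vec.scale_right_diff_distrib
        rat_vec.scale_left_diff_distrib)
  have "(\<lambda>v. v - coroot R b (rfl a v) *\<^sub>Q rfl a b) ` R = rfl a ` rfl b ` rfl a ` R"
    unfolding eq by (simp add: image_image)
  also have "\<dots> = R" by (simp add: rfl_image assms)
  finally show "(\<lambda>v. v - coroot R b (rfl a v) *\<^sub>Q rfl a b) ` R = R" .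
qed

lemma coroot_neg: "a \<in> R \<Longrightarrow> coroot R (- a) v = - coroot R a v"
  using coroot_rfl[of a a] by (simp only: rfl_self) (simp add: fun_eq_iff coroot_simps)

text \<open>The canonical invariant form of the root system. Summing over all coroots makes
  invariance a reindexing and semidefiniteness a sum of squares; definiteness amounts to
  \<open>coroots_separate\<close>.\<close>

definition ip :: "'v \<Rightarrow> 'v \<Rightarrow> rat" where
  "ip u v = (\<Sum>a\<in>R. coroot R a u * coroot R a v)"

lemma ip_commute: "ip u v = ip v u"
  by (simp add: ip_def mult.commute)

lemma ip_dual: "ip u \<in> dual_space"
  unfolding dual_space_iff ip_def
  by (simp add: coroot_simps distrib_left sum.distrib sum_distrib_left mult.left_commute)

lemmas ip_simps_right = dual_simps[OF ip_dual]

lemma ip_add_left: "ip (u + v) w = ip u w + ip v w"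
  and ip_scale_left: "ip (c *\<^sub>Q u) w = c * ip u w"
  and ip_uminus_left: "ip (- u) w = - ip u w"
  and ip_diff_left: "ip (u - v) w = ip u w - ip v w"
  and ip_zero_left: "ip 0 w = 0"
  by (simp_all add: ip_commute[of _ w] ip_simps_right)

lemmas ip_simps = ip_simps_right ip_add_left ip_scale_left ip_uminus_left ip_diff_left ip_zero_left

lemma inj_rfl: "a \<in> R \<Longrightarrow> inj_on (rfl a) A"
  by (metis (no_types, lifting) inj_on_inverseI rfl_rfl)

lemma ip_rfl: "a \<in> R \<Longrightarrow> ip (rfl a u) (rfl a v) = ip u v"
proof -
  assume a: "a \<in> R"
  have "ip u v = (\<Sum>b\<in>rfl a ` R. coroot R b u * coroot R b v)"
    unfolding rfl_image[OF a] ip_def ..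
  also have "\<dots> = (\<Sum>b\<in>R. coroot R (rfl a b) u * coroot R (rfl a b) v)"
    by (subst sum.reindex[OF inj_rfl[OF a]]) simp
  also have "\<dots> = ip (rfl a u) (rfl a v)"
    unfolding ip_def by (rule sum.cong) (simp_all add: coroot_rfl[OF a])
  finally show ?thesis by simp
qed

text \<open>Invariance under the reflection in \<open>a\<close>, which negates \<open>a\<close>. It
  converts coroot values into inner products, so that \<open>coroot R a b\<close> and
  \<open>coroot R b a\<close> have the same sign.\<close>

lemma ip_root: "a \<in> R \<Longrightarrow> 2 * ip a v = coroot R a v * ip a a"
  using ip_rfl[of a a v] by (simp add: rfl_self ip_simps)

lemma ip_nonneg: "ip v v \<ge> 0"
  by (simp add: ip_def sum_nonneg)

lemma ip_self_zero: "ip v v = 0 \<Longrightarrow> a \<in> R \<Longrightarrow> coroot R a v = 0"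
  using finR by (simp add: ip_def sum_nonneg_eq_0_iff)

lemma ip_root_pos: "a \<in> R \<Longrightarrow> ip a a > 0"
  using ip_nonneg[of a] ip_self_zero[of a a] by (fastforce simp: coroot_self)

lemma coroot_pos_iff:
  assumes "a \<in> R"
  shows "coroot R a v > 0 \<longleftrightarrow> ip a v > 0"
proof -
  have "0 < ip a v \<longleftrightarrow> 0 < 2 * ip a v" by simp
  then show ?thesis
    unfolding ip_root[OF assms] using ip_root_pos[OF assms] by (simp add: zero_less_mult_iff)
qed

lemma coroot_zero_iff: "a \<in> R \<Longrightarrow> coroot R a v = 0 \<longleftrightarrow> ip a v = 0"
  using ip_root[of a v] ip_root_pos[of a] by auto

lemma coroot_neg_iff: "a \<in> R \<Longrightarrow> coroot R a v < 0 \<longleftrightarrow> ip a v < 0"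
  using coroot_pos_iff[of a v] coroot_zero_iff[of a v] by linarith

lemma coroot_pos_sym: "a \<in> R \<Longrightarrow> b \<in> R \<Longrightarrow> coroot R a b > 0 \<longleftrightarrow> coroot R b a > 0"
  and coroot_neg_sym: "a \<in> R \<Longrightarrow> b \<in> R \<Longrightarrow> coroot R a b < 0 \<longleftrightarrow> coroot R b a < 0"
  by (simp_all add: coroot_pos_iff coroot_neg_iff ip_commute)

text \<open>The operator \<open>w \<mapsto> \<Sum>\<^sub>a \<langle>w, a\<^sup>\<or>\<rangle> a\<close> commutes with the reflections, hence scales every root, by a
  positive factor.\<close>

lemma sum_coroots_root:
  assumes "b \<in> R"
  shows "\<exists>c>0. (\<Sum>a\<in>R. coroot R a b *\<^sub>Q a) = c *\<^sub>Q b"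
proof -
  define P where "P w = (\<Sum>a\<in>R. coroot R a w *\<^sub>Q a)" for w
  have "P (rfl b b) = (\<Sum>a\<in>rfl b ` R. coroot R a (rfl b b) *\<^sub>Q a)"
    unfolding rfl_image[OF assms] P_def ..
  also have "\<dots> = (\<Sum>a\<in>R. coroot R (rfl b a) (rfl b b) *\<^sub>Q rfl b a)"
    by (subst sum.reindex[OF inj_rfl[OF assms]]) simp
  also have "\<dots> = (\<Sum>a\<in>R. coroot R a b *\<^sub>Q rfl b a)"
    by (rule sum.cong) (simp_all add: coroot_rfl[OF assms] rfl_rfl[OF assms])
  also have "\<dots> = rfl b (P b)"
    unfolding P_def
    by (simp add: dual_sum[OF coroot_dual[OF assms]] coroot_simps assms sum_subtractf
        rat_vec.scale_right_diff_distrib rat_vec.scale_sum_left)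
  finally have "P (- b) = rfl b (P b)" by (simp add: rfl_self assms)
  moreover have "P (- b) = - P b"
    by (simp add: P_def coroot_simps sum_negf)
  ultimately have "P b + P b = coroot R b (P b) *\<^sub>Q b" by (simp add: algebra_simps)
  then have "(1/2::rat) *\<^sub>Q (2 *\<^sub>Q P b) = (1/2) *\<^sub>Q coroot R b (P b) *\<^sub>Q b"
    by (simp add: two_scale)
  then have "P b = (coroot R b (P b) / 2) *\<^sub>Q b" by (simp add: scaleQ_scaleQ scaleQ_one)
  moreover have "coroot R b (P b) > 0"
  proof -
    have "coroot R b (P b) = (\<Sum>a\<in>R. coroot R a b * coroot R b a)"
      unfolding P_def by (simp add: dual_sum[OF coroot_dual[OF assms]] coroot_simps assms)
    \<comment> \<open>In each term both factors have the same sign, and the term for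
      \<open>b\<close> itself is 4.\<close>
    also have "\<dots> > 0"
    proof (rule sum_pos2[OF finR assms])
      show "0 < coroot R b b * coroot R b b" by (simp add: coroot_self assms)
      fix a assume a: "a \<in> R"
      show "0 \<le> coroot R a b * coroot R b a"
        using coroot_pos_sym[OF a assms] coroot_neg_sym[OF a assms]
        by (metis linorder_not_le mult_less_0_iff not_less_iff_gr_or_eq)
    qed
    finally show ?thesis .
  qed
  ultimately show ?thesis unfolding P_def
    by (intro exI[of _ "coroot R b (P b) / 2"]) (auto simp: P_def)
qed

text \<open>In a basis consisting of roots the operator of \<open>sum_coroots_root\<close> is
  diagonal with positive entries, hence injective, and a vector with all pairings zero lies in its
  kernel.\<close>

lemma coroots_separate:
  assumes "\<And>a. a \<in> R \<Longrightarrow> coroot R a v = 0"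
  shows "v = 0"
proof -
  obtain E where E: "E \<subseteq> R" "rat_vec.independent E" "R \<subseteq> rat_vec.span E"
    using rat_vec.maximal_independent_subset by blast
  have spE: "rat_vec.span E = UNIV"
    using E spanR by (metis rat_vec.span_minimal rat_vec.subspace_span top.extremum_uniqueI)
  have finE: "finite E" using E finR finite_subset by blast
  define q where "q = rat_vec.representation E v"
  have v: "v = (\<Sum>e\<in>E. q e *\<^sub>Q e)"
    unfolding q_def using rat_vec.sum_representation_eq[of E v E] E spE finE by simp
  obtain l where l: "\<And>e. e \<in> E \<Longrightarrow> l e > 0 \<and> (\<Sum>a\<in>R. coroot R a e *\<^sub>Q a) = l e *\<^sub>Q e"
    using sum_coroots_root E(1) by (metis subsetD)
  have "0 = (\<Sum>a\<in>R. coroot R a v *\<^sub>Q a)" using assms by simp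
  also have "\<dots> = (\<Sum>a\<in>R. \<Sum>e\<in>E. (q e * coroot R a e) *\<^sub>Q a)"
    by (subst v, rule sum.cong)
      (auto simp: dual_sum[OF coroot_dual] coroot_simps rat_vec.scale_sum_left)
  also have "\<dots> = (\<Sum>e\<in>E. q e *\<^sub>Q (\<Sum>a\<in>R. coroot R a e *\<^sub>Q a))"
    by (subst sum.swap) (simp add: rat_vec.scale_sum_right scaleQ_scaleQ)
  also have "\<dots> = (\<Sum>e\<in>E. (q e * l e) *\<^sub>Q e)"
    by (rule sum.cong) (auto simp: l scaleQ_scaleQ)
  finally have "(\<Sum>e\<in>E. (q e * l e) *\<^sub>Q e) = 0" by simp
  then have "q e * l e = 0" if "e \<in> E" for e
    using rat_vec.independentD[OF E(2) finE order_refl _ that, of "\<lambda>e. q e * l e"] by simp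
  then have "q e = 0" if "e \<in> E" for e using l[OF that] that by fastforce
  then show "v = 0" using v by simp
qed

text \<open>If one of the two negative integers is -1, then \<open>a + b\<close> is the reflection
  of one root in the other. Otherwise both are at most -2, which forces the squared norm of
  \<open>a + b\<close> to be at most 0, hence \<open>b = - a\<close>.\<close>

lemma add_root:
  assumes "a \<in> R" "b \<in> R" "coroot R a b < 0" "b \<noteq> - a"
  shows "a + b \<in> R"
proof -
  have n: "coroot R b a < 0" using assms coroot_neg_sym by blast
  consider "coroot R a b = -1" | "coroot R b a = -1" | "coroot R a b \<le> -2" "coroot R b a \<le> -2"
  proof -
    obtain i j where ij: "coroot R a b = of_int i" "coroot R b a = of_int j"
      using coroot_Ints[OF assms(1,2)] coroot_Ints[OF assms(2,1)] by (auto elim!: Ints_cases)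
    then have "i = -1 \<or> j = -1 \<or> i \<le> -2 \<and> j \<le> -2" using assms(3) n by auto
    then have "coroot R a b = -1 \<or> coroot R b a = -1 \<or> coroot R a b \<le> -2 \<and> coroot R b a \<le> -2"
      unfolding ij by linarith
    then show thesis using that by blast
  qed
  then show ?thesis
  proof cases
    case 1
    then show ?thesis using rfl_in[OF assms(1,2)] by (simp add: scaleQ_one add.commute)
  next
    case 2
    then show ?thesis using rfl_in[OF assms(2,1)] by (simp add: scaleQ_one add.commute)
  next
    case 3
    have "2 * ip a b \<le> -2 * ip a a" "2 * ip b a \<le> -2 * ip b b"
      using ip_root[OF assms(1), of b] ip_root[OF assms(2), of a]
        mult_right_mono[OF 3(1) ip_nonneg[of a]] mult_right_mono[OF 3(2) ip_nonneg[of b]]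
      by simp_all
    then have "ip (a + b) (a + b) \<le> 0" by (simp add: ip_simps ip_commute[of b a])
    then have "ip (a + b) (a + b) = 0" using ip_nonneg[of "a + b"] by simp
    then have "a + b = 0" using ip_self_zero coroots_separate by blast
    then show ?thesis using assms(4) by (simp add: add_eq_0_iff)
  qed
qed

end

section \<open>Bases and the highest root\<close>

locale irreducible_root_system = finite_root_system R for R :: "'v::rat_vector set" +
  fixes B :: "'v set"
  assumes reduced: "reduced_roots R" and irreducible: "irreducible_roots R" and base: "root_base R B"
begin

lemma base_sub: "B \<subseteq> R" and base_indep: "rat_vec.independent B"
  and base_sign: "a \<in> R \<Longrightarrow> a \<in> nonneg_comb B \<or> - a \<in> nonneg_comb B"
  using base by (auto simp: root_base_def)

lemma base_root: "b \<in> B \<Longrightarrow> b \<in> R"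
  using base_sub by blast

lemma base_finite: "finite B"
  using base_sub finR finite_subset by blast

lemma base_span: "rat_vec.span B = UNIV"
proof -
  have nn: "nonneg_comb B \<subseteq> rat_vec.span B"
    unfolding nonneg_comb_def by (auto intro!: rat_vec.span_sum rat_vec.span_scale intro: rat_vec.span_base)
  then have "R \<subseteq> rat_vec.span B"
    using base_sign rat_vec.span_neg by (metis minus_minus subsetD subsetI)
  then show ?thesis
    using spanR by (metis rat_vec.span_minimal rat_vec.subspace_span top.extremum_uniqueI)
qed

definition co :: "'v \<Rightarrow> 'v \<Rightarrow> rat" where
  "co b v = rat_vec.representation B v b"

lemma co_dual: "co b \<in> dual_space"
  unfolding dual_space_iff co_def
  using base_indep base_span by (simp add: rat_vec.representation_add rat_vec.representation_scale)

lemmas co_simps = dual_simps[OF co_dual]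

lemma co_base: "b \<in> B \<Longrightarrow> co c b = (if c = b then 1 else 0)"
  unfolding co_def using base_indep by (simp add: rat_vec.representation_basis)

lemma co_expand: "v = (\<Sum>b\<in>B. co b v *\<^sub>Q b)"
  unfolding co_def
  using rat_vec.sum_representation_eq[of B v B] base_indep base_span base_finite by simp

lemma co_eqI: "(\<And>b. b \<in> B \<Longrightarrow> co b u = co b v) \<Longrightarrow> u = v"
  using co_expand[of u] co_expand[of v] by simp

lemma dual_expand: "f \<in> dual_space \<Longrightarrow> f v = (\<Sum>b\<in>B. co b v * f b)"
  by (subst co_expand[of v]) (simp add: dual_sum dual_scale)

lemma co_sum: "c \<in> B \<Longrightarrow> co c (\<Sum>b\<in>B. q b *\<^sub>Q b) = q c"
  using base_finite
  by (simp add: dual_sum[OF co_dual] co_simps co_base if_distrib[of "\<lambda>x. _ * x"] cong: if_cong)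

lemma nonneg_comb_iff: "v \<in> nonneg_comb B \<longleftrightarrow> (\<forall>b\<in>B. co b v \<in> \<nat>)"
proof
  assume "v \<in> nonneg_comb B"
  then show "\<forall>b\<in>B. co b v \<in> \<nat>" by (auto simp: nonneg_comb_def co_sum)
next
  assume "\<forall>b\<in>B. co b v \<in> \<nat>"
  then have "\<forall>b\<in>B. \<exists>n. co b v = rat_of_nat n" by (auto elim!: Nats_cases)
  then obtain n where "\<forall>b\<in>B. co b v = rat_of_nat (n b)" by (auto dest!: bchoice)
  then have "v = (\<Sum>b\<in>B. rat_of_nat (n b) *\<^sub>Q b)" using co_expand[of v] by simp
  then show "v \<in> nonneg_comb B" by (auto simp: nonneg_comb_def)
qed

lemma nonneg_comb_add: "u \<in> nonneg_comb B \<Longrightarrow> v \<in> nonneg_comb B \<Longrightarrow> u + v \<in> nonneg_comb B"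
  by (auto simp: nonneg_comb_iff co_simps)

lemma nonneg_combD: "v \<in> nonneg_comb B \<Longrightarrow> b \<in> B \<Longrightarrow> co b v \<ge> 0"
  by (auto simp: nonneg_comb_iff elim!: Nats_cases)

lemma nonneg_comb_antisym: "v \<in> nonneg_comb B \<Longrightarrow> - v \<in> nonneg_comb B \<Longrightarrow> v = 0"
  by (rule co_eqI) (use nonneg_combD[of v] nonneg_combD[of "- v"] in \<open>fastforce simp: co_simps\<close>)

lemma pos_rootI: "a \<in> R \<Longrightarrow> b \<in> B \<Longrightarrow> co b a > 0 \<Longrightarrow> a \<in> nonneg_comb B"
  using base_sign[of a] nonneg_combD[of "- a" b] by (auto simp: co_simps)

lemma scaled_root:
  assumes "a \<in> R" "c *\<^sub>Q a \<in> R" "c \<ge> 0"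
  shows "c = 1"
proof -
  have "c = 1 \<or> c = -1" using assms(1,2) reduced unfolding reduced_roots_def by blast
  then show ?thesis using assms(3) by auto
qed

text \<open>Reducedness enters here: a positive root supported on the single simple root
  \<open>b\<close> would be a multiple of \<open>b\<close>.\<close>

lemma ex_other_co:
  assumes "a \<in> R" "a \<in> nonneg_comb B" "b \<in> B" "a \<noteq> b"
  shows "\<exists>c\<in>B. c \<noteq> b \<and> co c a > 0"
proof (rule ccontr)
  assume "\<not> ?thesis"
  then have z: "co c a = 0" if "c \<in> B" "c \<noteq> b" for c
    using nonneg_combD[OF assms(2) that(1)] that by force
  have "a = co b a *\<^sub>Q b"
    by (rule co_eqI) (use z assms(3) in \<open>auto simp: co_simps co_base\<close>)
  then have "co b a = 1"
    using scaled_root[of b "co b a"] assms base_root nonneg_combD by metis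
  with \<open>a = co b a *\<^sub>Q b\<close> assms(4) show False by (simp add: scaleQ_one)
qed

text \<open>The reflection in \<open>b\<close> changes only the coordinate at \<open>b\<close>, so
  some other positive coordinate survives, and one positive coordinate decides the sign of a
  root.\<close>

lemma rfl_simple_pos:
  assumes "a \<in> R" "a \<in> nonneg_comb B" "b \<in> B" "a \<noteq> b"
  shows "rfl b a \<in> nonneg_comb B"
proof -
  obtain c where "c \<in> B" "c \<noteq> b" "co c a > 0" using ex_other_co[OF assms] by blast
  then show ?thesis
    using pos_rootI[OF rfl_in[OF base_root[OF assms(3)] assms(1)], of c]
    by (simp add: co_simps co_base assms)
qed

text \<open>Otherwise expanding the second argument of \<open>ip a a\<close> in the base would make
  it a sum of nonpositive terms.\<close>

lemma ex_simple_coroot_pos: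
  assumes "a \<in> R" "a \<in> nonneg_comb B"
  shows "\<exists>b\<in>B. co b a > 0 \<and> coroot R b a > 0"
proof (rule ccontr)
  assume neg: "\<not> ?thesis"
  have "co b a * ip a b \<le> 0" if "b \<in> B" for b
  proof (cases "co b a = 0")
    case False
    then have "co b a > 0" using nonneg_combD[OF assms(2) that] by simp
    then have "ip a b \<le> 0"
      using neg that coroot_pos_iff[OF base_root[OF that], of a] by (auto simp: ip_commute)
    then show ?thesis using \<open>co b a > 0\<close> by (simp add: mult_nonneg_nonpos)
  qed simp
  then have "(\<Sum>b\<in>B. co b a * ip a b) \<le> 0" by (rule sum_nonpos)
  then show False using dual_expand[OF ip_dual, of a a] ip_root_pos[OF assms(1)] by simp
qed

text \<open>The reflection of \<open>c\<close> in \<open>b\<close> is a positive root whose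
  coordinate at \<open>b\<close> is minus this pairing.\<close>

lemma base_coroot_nonpos:
  assumes "b \<in> B" "c \<in> B" "b \<noteq> c"
  shows "coroot R b c \<le> 0"
proof (rule ccontr)
  assume "\<not> ?thesis"
  moreover have "c \<in> nonneg_comb B" by (auto simp: nonneg_comb_iff co_base assms)
  then have "rfl b c \<in> nonneg_comb B" using rfl_simple_pos assms base_root by metis
  from nonneg_combD[OF this assms(1)] have "coroot R b c \<le> 0"
    using assms by (simp add: co_simps co_base)
  ultimately show False by simp
qed

definition height :: "'v \<Rightarrow> rat" where
  "height v = (\<Sum>b\<in>B. co b v)"

lemma height_dual: "height \<in> dual_space"
  unfolding dual_space_iff height_def by (simp add: co_simps sum.distrib sum_distrib_left)

lemma height_base: "b \<in> B \<Longrightarrow> height b = 1"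
  using base_finite by (simp add: height_def co_base)

lemma height_nat: "v \<in> nonneg_comb B \<Longrightarrow> height v \<in> \<nat>"
proof -
  have "(\<And>x. x \<in> A \<Longrightarrow> f x \<in> \<nat>) \<Longrightarrow> sum f A \<in> \<nat>" for A and f :: "'v \<Rightarrow> rat"
    by (induction A rule: infinite_finite_induct) auto
  then show "v \<in> nonneg_comb B \<Longrightarrow> height v \<in> \<nat>"
    by (simp add: height_def nonneg_comb_iff)
qed

lemma height_pos: "v \<in> nonneg_comb B \<Longrightarrow> v \<noteq> 0 \<Longrightarrow> height v > 0"
proof -
  assume v: "v \<in> nonneg_comb B" "v \<noteq> 0"
  then obtain b where "b \<in> B" "co b v \<noteq> 0" using co_eqI[of v 0] by (auto simp: co_simps)
  then show ?thesis
    unfolding height_def using nonneg_combD[OF v(1)] base_finite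
    by (intro sum_pos2[of B b]) (auto simp: order_less_le)
qed

text \<open>If the base splits into two orthogonal parts then so does the root system: no reflection in a
  simple root of one part moves a root supported on the other.\<close>

lemma orthogonal_split_root:
  assumes "B1 \<union> B2 = B" "B1 \<inter> B2 = {}"
    and orth: "\<And>b c. b \<in> B1 \<Longrightarrow> c \<in> B2 \<Longrightarrow> ip b c = 0"
    and "a \<in> R" "a \<in> nonneg_comb B"
  shows "(\<forall>b\<in>B1. co b a = 0) \<or> (\<forall>b\<in>B2. co b a = 0)"
proof -
  obtain n where "height a = of_nat n" using height_nat assms(5) by (auto elim!: Nats_cases)
  then show ?thesis using assms(4,5)
  proof (induction n arbitrary: a rule: less_induct)
    case (less n)
    obtain b where b: "b \<in> B" "coroot R b a > 0"
      using ex_simple_coroot_pos less.prems by blast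
    show ?case
    proof (cases "a = b")
      case True
      then show ?thesis using assms(1,2) b(1) by (auto simp: co_base)
    next
      case False
      let ?a = "rfl b a"
      have a': "?a \<in> R" "?a \<in> nonneg_comb B"
        using less.prems b False rfl_in rfl_simple_pos base_root by auto
      obtain m where m: "height ?a = of_nat m" using height_nat a' by (auto elim!: Nats_cases)
      have "height ?a < height a"
        using b by (simp add: dual_simps[OF height_dual] height_base)
      then have "m < n" using m less.prems by simp
      from less.IH[OF this m a'] have IH: "(\<forall>b\<in>B1. co b ?a = 0) \<or> (\<forall>b\<in>B2. co b ?a = 0)" .
      \<comment> \<open>The reflected root still pairs nontrivially with \<open>b\<close>, so its
        support contains some \<open>c\<close> not orthogonal to \<open>b\<close>; by orthogonality
        of the parts, \<open>c\<close> lies in the same part as \<open>b\<close>.\<close>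
      have ip_neg: "ip b ?a \<noteq> 0"
        using coroot_zero_iff[OF base_root[OF b(1)], of ?a] b base_root by (auto simp: coroot_simps)
      have "ip b ?a = (\<Sum>c\<in>B. co c ?a * ip b c)" by (rule dual_expand[OF ip_dual])
      then obtain c where c: "c \<in> B" "co c ?a \<noteq> 0" "ip b c \<noteq> 0"
        using ip_neg by (metis (no_types, lifting) mult_eq_0_iff sum.neutral)
      have same: "b \<in> B1 \<and> c \<in> B1 \<or> b \<in> B2 \<and> c \<in> B2"
        using orth[of b c] orth[of c b] c b assms(1) by (auto simp: ip_commute)
      have eq: "co d a = co d ?a" if "d \<in> B" "d \<noteq> b" for d
        using that b by (simp add: co_simps co_base)
      show ?thesis
        using IH same c eq assms(1,2) by (metis IntI Un_iff empty_iff)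
    qed
  qed
qed

definition maximal_root :: "'v \<Rightarrow> bool" where
  "maximal_root a \<longleftrightarrow> a \<in> R \<and> (\<forall>b\<in>R. b - a \<in> nonneg_comb B \<longrightarrow> b = a)"

text \<open>A negative pairing would make \<open>b + t\<close> a root strictly above
  \<open>t\<close>. The exceptional case \<open>t = - b\<close> of \<open>add_root\<close> is
  excluded because \<open>b\<close> lies above \<open>- b\<close>.\<close>

lemma maximal_root_dominant:
  assumes "maximal_root t" "b \<in> B"
  shows "coroot R b t \<ge> 0"
proof (rule ccontr)
  have b: "b \<in> nonneg_comb B" by (auto simp: nonneg_comb_iff co_base assms)
  have t: "t \<in> R" using assms by (simp add: maximal_root_def)
  assume neg: "\<not> ?thesis"
  moreover have "t \<noteq> - b"
  proof
    assume "t = - b"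
    then have "b - t \<in> nonneg_comb B" using nonneg_comb_add[OF b b] by simp
    then have "b = t" using assms base_root by (auto simp: maximal_root_def)
    with neg show False using coroot_self[OF base_root[OF assms(2)]] by simp
  qed
  ultimately have "b + t \<in> R" using add_root[OF base_root[OF assms(2)] t] by auto
  moreover have "b + t - t \<in> nonneg_comb B" using b by simp
  ultimately have "b + t = t" using assms(1) unfolding maximal_root_def by blast
  then show False using base_root[OF assms(2)] zero_notin by simp
qed

lemma maximal_root_pos:
  assumes "maximal_root t"
  shows "t \<in> nonneg_comb B"
proof (rule ccontr)
  have t: "t \<in> R" using assms by (simp add: maximal_root_def)
  assume neg: "\<not> ?thesis"
  then have m: "- t \<in> nonneg_comb B" using base_sign t by blast
  then have "- t - t \<in> nonneg_comb B" using nonneg_comb_add[of "- t" "- t"] by simp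
  then have "- t = t" using assms neg_in[OF t] by (auto simp: maximal_root_def)
  then show False using neg m by simp
qed

text \<open>Dominance gives \<open>ip b t \<ge> 0\<close> for a simple root \<open>b\<close> outside
  the support of \<open>t\<close>, while every term of its expansion over the support is at most 0.
  All these terms vanish, so the support is orthogonal to its complement, and a nonempty complement
  would split the root system.\<close>

lemma maximal_root_full:
  assumes "maximal_root t" "b \<in> B"
  shows "co b t > 0"
proof -
  define B1 where "B1 = {b\<in>B. co b t > 0}"
  define B2 where "B2 = {b\<in>B. co b t = 0}"
  have t: "t \<in> R" "t \<in> nonneg_comb B"
    using assms maximal_root_pos by (auto simp: maximal_root_def)
  have un: "B1 \<union> B2 = B" "B1 \<inter> B2 = {}"
    using nonneg_combD[OF t(2)] by (auto simp: B1_def B2_def order_le_less)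
  have orth: "ip c b = 0" if "c \<in> B1" "b \<in> B2" for b c
  proof -
    have b: "b \<in> B" using that by (simp add: B2_def)
    have le: "co c t * ip b c \<le> 0" if "c \<in> B" for c
    proof (cases "c = b")
      case True
      then show ?thesis using \<open>b \<in> B2\<close> by (simp add: B2_def)
    next
      case False
      then have "ip b c \<le> 0"
        using base_coroot_nonpos[OF b that] coroot_pos_iff[OF base_root[OF b], of c] by force
      then show ?thesis using nonneg_combD[OF t(2) that] by (simp add: mult_nonneg_nonpos)
    qed
    have "ip b t \<ge> 0"
      using maximal_root_dominant[OF assms(1) b] coroot_neg_iff[OF base_root[OF b], of t] by force
    moreover have "ip b t = (\<Sum>c\<in>B. co c t * ip b c)" by (rule dual_expand[OF ip_dual])
    moreover have "(\<Sum>c\<in>B. co c t * ip b c) \<le> 0" using le by (rule sum_nonpos)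
    ultimately have "(\<Sum>c\<in>B. - (co c t * ip b c)) = 0" by (simp add: sum_negf)
    then have "\<forall>c\<in>B. - (co c t * ip b c) = 0"
      by (subst (asm) sum_nonneg_eq_0_iff[OF base_finite]) (use le in auto)
    then show ?thesis using that by (auto simp: B1_def ip_commute)
  qed
  show ?thesis
  proof (rule ccontr)
    assume "\<not> ?thesis"
    then have b2: "b \<in> B2" using assms(2) un by (auto simp: B1_def)
    obtain c where "c \<in> B" "co c t > 0" using ex_simple_coroot_pos[OF t] by blast
    then have c1: "c \<in> B1" by (simp add: B1_def)
    define R1 where "R1 = {a\<in>R. \<forall>b\<in>B2. co b a = 0}"
    define R2 where "R2 = {a\<in>R. \<forall>b\<in>B1. co b a = 0}"
    have "a \<in> R1 \<union> R2" if "a \<in> R" for a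
      using orthogonal_split_root[OF un orth, of a] orthogonal_split_root[OF un orth, of "- a"]
        base_sign[OF that] neg_in[OF that] that by (auto simp: R1_def R2_def co_simps)
    then have "R1 \<union> R2 = R" by (auto simp: R1_def R2_def)
    moreover have "R1 \<inter> R2 = {}"
    proof (rule ccontr)
      assume "R1 \<inter> R2 \<noteq> {}"
      then obtain a where a: "a \<in> R" "\<forall>b\<in>B. co b a = 0" using un by (auto simp: R1_def R2_def)
      then have "a = 0" by (intro co_eqI) (auto simp: co_simps)
      then show False using a zero_notin by simp
    qed
    moreover have "c \<in> R1" "b \<in> R2"
      using b2 c1 un base_root by (auto simp: R1_def R2_def co_base B1_def B2_def)
    moreover have "coroot R u v = 0 \<and> coroot R v u = 0" if "u \<in> R1" "v \<in> R2" for u v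
    proof -
      have "ip x v = 0" if "x \<in> B1" for x
      proof -
        have "ip x v = (\<Sum>y\<in>B. co y v * ip x y)" by (rule dual_expand[OF ip_dual])
        also have "\<dots> = 0"
          by (rule sum.neutral) (use \<open>v \<in> R2\<close> un orth \<open>x \<in> B1\<close> in \<open>auto simp: R2_def\<close>)
        finally show ?thesis .
      qed
      then have "(\<Sum>x\<in>B. co x u * ip v x) = 0"
        using \<open>u \<in> R1\<close> un by (intro sum.neutral) (auto simp: R1_def ip_commute)
      then have "ip v u = 0" using dual_expand[OF ip_dual, of v u] by simp
      then show ?thesis
        using that coroot_zero_iff[of u v] coroot_zero_iff[of v u] by (auto simp: R1_def R2_def ip_commute)
    qed
    ultimately show False using irreducible unfolding irreducible_roots_def by blast
  qed
qed

text \<open>Full support of one maximal root and dominance of the other make their inner product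
  positive, so their difference is a root. Its sign makes the two comparable, against
  maximality.\<close>

lemma maximal_root_unique:
  assumes "maximal_root t" "maximal_root u"
  shows "t = u"
proof (rule ccontr)
  assume ne: "t \<noteq> u"
  have t: "t \<in> R" "u \<in> R" "t \<in> nonneg_comb B"
    using assms maximal_root_pos by (auto simp: maximal_root_def)
  have dom: "ip t b \<ge> 0" if "b \<in> B" for b
    using maximal_root_dominant[OF assms(1) that] coroot_neg_iff[OF base_root[OF that], of t]
    by (force simp: ip_commute)
  obtain b where b: "b \<in> B" "coroot R b t > 0" using ex_simple_coroot_pos[OF t(1,3)] by blast
  have "ip t u = (\<Sum>b\<in>B. co b u * ip t b)" by (rule dual_expand[OF ip_dual])
  also have "\<dots> > 0"
  proof (rule sum_pos2[OF base_finite b(1)])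
    show "0 < co b u * ip t b"
      using maximal_root_full[OF assms(2) b(1)] coroot_pos_iff[OF base_root[OF b(1)], of t] b
      by (simp add: ip_commute)
    show "0 \<le> co c u * ip t c" if "c \<in> B" for c
      using maximal_root_full[OF assms(2) that] dom[OF that] by simp
  qed
  finally have "ip (- t) u < 0" by (simp add: ip_simps)
  then have "coroot R (- t) u < 0" using coroot_neg_iff neg_in t by blast
  then have "- t + u \<in> R" using add_root[OF neg_in[OF t(1)] t(2)] ne by auto
  then have "u - t \<in> nonneg_comb B \<or> t - u \<in> nonneg_comb B" using base_sign by fastforce
  then show False using assms ne t by (auto simp: maximal_root_def)
qed

text \<open>Among the finitely many roots above \<open>a\<close>, one of greatest height is maximal,
  as any root strictly above it would have larger height.\<close>

lemma ex_maximal_root_above: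
  assumes "a \<in> R"
  shows "\<exists>t. maximal_root t \<and> t - a \<in> nonneg_comb B"
proof -
  let ?A = "{r\<in>R. r - a \<in> nonneg_comb B}"
  have z: "0 \<in> nonneg_comb B" by (simp add: nonneg_comb_iff co_simps)
  have "finite ?A" "?A \<noteq> {}" using finR assms z by auto
  then have "Max (height ` ?A) \<in> height ` ?A" by (intro Max_in) auto
  then obtain t where t: "t \<in> ?A" and tmax: "Max (height ` ?A) = height t" by blast
  have max: "height r \<le> height t" if "r \<in> ?A" for r
    unfolding tmax[symmetric] using \<open>finite ?A\<close> that by (intro Max_ge) blast+
  have "b = t" if "b \<in> R" "b - t \<in> nonneg_comb B" for b
  proof (rule ccontr)
    assume "b \<noteq> t"
    then have "height (b - t) > 0" using that height_pos by simp
    moreover have "b - a \<in> nonneg_comb B" using nonneg_comb_add[of "b - t" "t - a"] that t by simp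
    ultimately show False using max[of b] that by (simp add: dual_simps[OF height_dual])
  qed
  then show ?thesis using t by (auto simp: maximal_root_def)
qed

abbreviation \<theta> :: 'v where
  "\<theta> \<equiv> highest_root R B"

lemma highest_root: "\<theta> \<in> R" and highest_root_ge: "a \<in> R \<Longrightarrow> \<theta> - a \<in> nonneg_comb B"
proof -
  obtain r where "r \<in> R" using irreducible by (auto simp: irreducible_roots_def)
  then obtain t where t: "maximal_root t" using ex_maximal_root_above by blast
  have ge: "\<forall>b\<in>R. t - b \<in> nonneg_comb B"
    using ex_maximal_root_above maximal_root_unique[OF t] by metis
  have "\<theta> = t"
    unfolding highest_root_def
  proof (rule the_equality)
    show "t \<in> R \<and> (\<forall>b\<in>R. t - b \<in> nonneg_comb B)" using t ge by (simp add: maximal_root_def)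
    fix u assume u: "u \<in> R \<and> (\<forall>b\<in>R. u - b \<in> nonneg_comb B)"
    then show "u = t" using t by (auto simp: maximal_root_def)
  qed
  then show "\<theta> \<in> R" "a \<in> R \<Longrightarrow> \<theta> - a \<in> nonneg_comb B"
    using t ge by (auto simp: maximal_root_def)
qed

lemma highest_root_pos: "\<theta> \<in> nonneg_comb B"
proof (rule ccontr)
  assume n: "\<theta> \<notin> nonneg_comb B"
  then have m: "- \<theta> \<in> nonneg_comb B" using base_sign highest_root by blast
  have "\<theta> - (- \<theta>) \<in> nonneg_comb B" using highest_root_ge[OF neg_in[OF highest_root]] .
  then have "\<theta> + \<theta> + - \<theta> \<in> nonneg_comb B" using m nonneg_comb_add by fastforce
  then show False using n by simp
qed

end

section \<open>The affine Weyl group and its length function\<close>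

lemma word_prod_Nil: "word_prod G [] = \<one>\<^bsub>G\<^esub>"
  and word_prod_Cons: "word_prod G (x # xs) = x \<otimes>\<^bsub>G\<^esub> word_prod G xs"
  by (simp_all add: word_prod_def)

text \<open>Evaluates an affine weight as an affine function on the dual space. The group acts on
  weights so as to preserve this value, and identities for the action are checked through
  it.\<close>

definition pairing :: "'v::rat_vector \<times> rat \<Rightarrow> ('v \<Rightarrow> rat) \<Rightarrow> rat" where
  "pairing \<beta> f = f (fst \<beta>) + snd \<beta>"

lemma pairing_uminus: "f \<in> dual_space \<Longrightarrow> pairing (- \<beta>) f = - pairing \<beta> f"
  by (simp add: pairing_def dual_simps)

lemma dual_diff_scale:
  "f \<in> dual_space \<Longrightarrow> g \<in> dual_space \<Longrightarrow> (\<lambda>v. f v - c * g v) \<in> dual_space"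
  by (simp add: dual_space_iff algebra_simps)

lemma pairing_separates:
  assumes "\<And>f. f \<in> dual_space \<Longrightarrow> pairing \<beta> f = pairing \<gamma> f"
  shows "\<beta> = \<gamma>"
proof -
  have s: "snd \<beta> = snd \<gamma>" using assms[OF dual_zero_mem] by (simp add: pairing_def)
  have "fst \<beta> - fst \<gamma> = 0"
    by (rule dual_separates) (use assms s in \<open>auto simp: pairing_def dual_simps\<close>)
  with s show ?thesis by (simp add: prod_eq_iff)
qed

context finite_root_system
begin

abbreviation W where "W \<equiv> aff_weyl R"
abbreviation affR ("\<Phi>") where "\<Phi> \<equiv> aff_roots R"
abbreviation rr where "rr \<equiv> root_refl R"
abbreviation act where "act \<equiv> weyl_act R"

lemma aff_root_iff: "\<gamma> \<in> \<Phi> \<longleftrightarrow> fst \<gamma> \<in> R \<and> snd \<gamma> \<in> \<int>"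
  by (cases \<gamma>) (auto simp: aff_roots_def)

lemma aff_root_fst: "\<gamma> \<in> \<Phi> \<Longrightarrow> fst \<gamma> \<in> R"
  by (simp add: aff_root_iff)

lemma neg_aff_root: "\<gamma> \<in> \<Phi> \<Longrightarrow> - \<gamma> \<in> \<Phi>"
  by (simp add: aff_root_iff neg_in)

lemma root_refl_apply:
  "f \<in> dual_space \<Longrightarrow> rr \<gamma> f = (\<lambda>v. f v - pairing \<gamma> f * coroot R (fst \<gamma>) v)"
  by (simp add: root_refl_def aff_refl_def pairing_def)

lemma root_refl_dual: "\<gamma> \<in> \<Phi> \<Longrightarrow> f \<in> dual_space \<Longrightarrow> rr \<gamma> f \<in> dual_space"
  by (simp add: root_refl_apply dual_diff_scale coroot_dual aff_root_fst)

lemma pairing_root_refl: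
  "\<gamma> \<in> \<Phi> \<Longrightarrow> f \<in> dual_space \<Longrightarrow> pairing \<beta> (rr \<gamma> f) = pairing (lin_refl R \<gamma> \<beta>) f"
  by (simp add: root_refl_apply) (simp add: pairing_def lin_refl_def dual_simps algebra_simps)

lemma lin_refl_self: "\<gamma> \<in> \<Phi> \<Longrightarrow> lin_refl R \<gamma> \<gamma> = - \<gamma>"
  by (simp add: lin_refl_def coroot_simps aff_root_fst two_scale prod_eq_iff)

lemma lin_refl_lin_refl: "\<gamma> \<in> \<Phi> \<Longrightarrow> lin_refl R \<gamma> (lin_refl R \<gamma> \<beta>) = \<beta>"
  by (simp add: lin_refl_def coroot_simps aff_root_fst prod_eq_iff)

lemma lin_refl_root: "\<gamma> \<in> \<Phi> \<Longrightarrow> \<beta> \<in> \<Phi> \<Longrightarrow> lin_refl R \<gamma> \<beta> \<in> \<Phi>"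
  by (simp add: aff_root_iff lin_refl_def rfl_in coroot_Ints)

lemma lin_refl_weight:
  "\<gamma> \<in> \<Phi> \<Longrightarrow> \<beta> \<in> aff_weights R \<Longrightarrow> lin_refl R \<gamma> \<beta> \<in> aff_weights R"
  by (cases \<beta>; cases \<gamma>)
    (auto simp: aff_weights_def weight_lattice_def lin_refl_def coroot_simps coroot_Ints aff_roots_def)

lemma root_refl_root_refl: "\<gamma> \<in> \<Phi> \<Longrightarrow> f \<in> dual_space \<Longrightarrow> rr \<gamma> (rr \<gamma> f) = f"
proof -
  assume a: "\<gamma> \<in> \<Phi>" "f \<in> dual_space"
  have "pairing \<gamma> (rr \<gamma> f) = - pairing \<gamma> f"
    using a by (simp add: pairing_root_refl lin_refl_self pairing_uminus)
  then have "rr \<gamma> (rr \<gamma> f) = (\<lambda>v. rr \<gamma> f v + pairing \<gamma> f * coroot R (fst \<gamma>) v)"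
    by (subst root_refl_apply) (use a root_refl_dual in auto)
  then show ?thesis using a by (simp add: root_refl_apply)
qed

lemma root_refl_neg: "\<gamma> \<in> \<Phi> \<Longrightarrow> rr (- \<gamma>) = rr \<gamma>"
proof -
  assume a: "\<gamma> \<in> \<Phi>"
  have "rr (- \<gamma>) f = rr \<gamma> f" for f
  proof (cases "f \<in> dual_space")
    case True
    then show ?thesis using a by (simp add: root_refl_apply pairing_uminus coroot_neg aff_root_fst)
  next
    case False
    then show ?thesis by (simp add: root_refl_def aff_refl_def)
  qed
  then show ?thesis by auto
qed

lemma root_refl_Bij: "\<gamma> \<in> \<Phi> \<Longrightarrow> rr \<gamma> \<in> Bij dual_space"
proof -
  assume "\<gamma> \<in> \<Phi>"
  then have "bij_betw (rr \<gamma>) dual_space dual_space"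
    by (intro bij_betwI[where g = "rr \<gamma>"]) (auto simp: root_refl_dual root_refl_root_refl)
  moreover have "rr \<gamma> \<in> extensional dual_space"
    by (simp add: root_refl_def aff_refl_def)
  ultimately show "rr \<gamma> \<in> Bij dual_space" by (simp add: Bij_def)
qed

lemma generators: "{aff_refl R a n | a n. a \<in> R \<and> n \<in> \<int>} = rr ` \<Phi>"
proof -
  have "aff_refl R a n \<in> rr ` \<Phi>" if "a \<in> R" "n \<in> \<int>" for a n
    using that by (intro image_eqI[of _ _ "(a, - n)"]) (auto simp: root_refl_def aff_roots_def)
  moreover have "rr \<gamma> \<in> {aff_refl R a n | a n. a \<in> R \<and> n \<in> \<int>}" if "\<gamma> \<in> \<Phi>" for \<gamma>
    using that by (auto simp: root_refl_def aff_root_iff intro!: exI[of _ "fst \<gamma>"] exI[of _ "- snd \<gamma>"])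
  ultimately show ?thesis by blast
qed

lemma generators_Bij: "rr ` \<Phi> \<subseteq> carrier (BijGroup dual_space)"
  using root_refl_Bij by (auto simp: BijGroup_def)

lemma carrier_W: "carrier W = generate (BijGroup dual_space) (rr ` \<Phi>)"
  by (simp add: aff_weyl_def generators)

lemma subgroup_W: "subgroup (carrier W) (BijGroup dual_space)"
  using group.generate_is_subgroup[OF group_BijGroup generators_Bij] by (simp add: carrier_W)

lemma group_W: "group W"
  using subgroup.subgroup_is_group[OF subgroup_W group_BijGroup]
  by (simp add: aff_weyl_def)

sublocale W: group W by (rule group_W)

lemma root_refl_W: "\<gamma> \<in> \<Phi> \<Longrightarrow> rr \<gamma> \<in> carrier W"
  unfolding carrier_W by (auto intro: generate.incl)

lemma W_Bij: "x \<in> carrier W \<Longrightarrow> x \<in> Bij dual_space"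
  using subgroup.subset[OF subgroup_W] by (auto simp: BijGroup_def)

lemma W_one: "f \<in> dual_space \<Longrightarrow> \<one>\<^bsub>W\<^esub> f = f"
  by (simp add: aff_weyl_def BijGroup_def)

lemma W_mult: "x \<in> carrier W \<Longrightarrow> y \<in> carrier W \<Longrightarrow> x \<otimes>\<^bsub>W\<^esub> y = compose dual_space x y"
proof -
  assume "x \<in> carrier W" "y \<in> carrier W"
  then have "x \<in> Bij dual_space" "y \<in> Bij dual_space" by (auto dest: W_Bij)
  moreover have "x \<otimes>\<^bsub>W\<^esub> y = x \<otimes>\<^bsub>BijGroup dual_space\<^esub> y" by (simp add: aff_weyl_def)
  ultimately show ?thesis by (simp add: BijGroup_def)
qed

lemma W_apply_mult:
  "x \<in> carrier W \<Longrightarrow> y \<in> carrier W \<Longrightarrow> f \<in> dual_space \<Longrightarrow> (x \<otimes>\<^bsub>W\<^esub> y) f = x (y f)"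
  by (simp add: W_mult compose_eq)

lemma W_dual: "x \<in> carrier W \<Longrightarrow> f \<in> dual_space \<Longrightarrow> x f \<in> dual_space"
  using W_Bij[of x] Bij_imp_funcset by blast

lemma W_eqI:
  assumes "x \<in> carrier W" "y \<in> carrier W" "\<And>f. f \<in> dual_space \<Longrightarrow> x f = y f"
  shows "x = y"
  by (rule extensionalityI[of _ dual_space])
    (use assms W_Bij[THEN Bij_imp_extensional] in auto)

lemma W_surj:
  assumes "x \<in> carrier W" "f \<in> dual_space"
  obtains g where "g \<in> dual_space" "x g = f"
proof -
  have "f \<in> x ` dual_space" using W_Bij[OF assms(1)] assms(2) by (simp add: Bij_def bij_betw_def)
  then show thesis using that by blast
qed

lemma root_refl_square: "\<gamma> \<in> \<Phi> \<Longrightarrow> rr \<gamma> \<otimes>\<^bsub>W\<^esub> rr \<gamma> = \<one>\<^bsub>W\<^esub>"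
  by (rule W_eqI) (auto simp: root_refl_W W_apply_mult root_refl_root_refl W_one)

lemma inv_root_refl: "\<gamma> \<in> \<Phi> \<Longrightarrow> inv\<^bsub>W\<^esub> rr \<gamma> = rr \<gamma>"
  by (simp add: W.inv_equality root_refl_W root_refl_square)

lemma root_refl_mult_cancel:
  "\<gamma> \<in> \<Phi> \<Longrightarrow> x \<in> carrier W \<Longrightarrow> rr \<gamma> \<otimes>\<^bsub>W\<^esub> (rr \<gamma> \<otimes>\<^bsub>W\<^esub> x) = x"
  by (metis W.inv_solve_left inv_root_refl root_refl_W W.m_closed)

text \<open>Invariance of the pairing characterises the linear map without reference to the word by
  which the group element was written. Uniqueness in \<open>acts_as_unique\<close>, and with it the
  well-definedness of \<open>weyl_act\<close>, rests on this.\<close>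

lemma acts_as_spec:
  "acts_as R w T \<Longrightarrow> w \<in> carrier W \<and> (\<forall>\<beta>. \<forall>f\<in>dual_space. pairing (T \<beta>) (w f) = pairing \<beta> f)"
proof (induction rule: acts_as.induct)
  case 1
  then show ?case by (simp add: W_one)
next
  case (2 \<gamma> w T)
  then show ?case
    by (auto simp: root_refl_W W_apply_mult pairing_root_refl W_dual lin_refl_lin_refl)
qed

lemma acts_as_ex:
  assumes "w \<in> carrier W"
  shows "\<exists>T. acts_as R w T"
proof -
  \<comment> \<open>\<open>acts_as\<close> grows by one reflection on the left, whereas
    \<open>generate\<close> forms arbitrary products. The induction therefore shows that left
    multiplication by w preserves the property of acting linearly.\<close>
  have "\<forall>v T. acts_as R v T \<longrightarrow> (\<exists>T'. acts_as R (w \<otimes>\<^bsub>W\<^esub> v) T')"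
    using assms unfolding carrier_W
  proof (induction rule: generate.induct)
    case one
    have "\<one>\<^bsub>BijGroup dual_space\<^esub> = \<one>\<^bsub>W\<^esub>" by (simp add: aff_weyl_def)
    then show ?case using acts_as_spec by (metis W.l_one)
  next
    case (incl h)
    then show ?case using acts_as.intros(2) by blast
  next
    case (inv h)
    then obtain \<gamma> where \<gamma>: "\<gamma> \<in> \<Phi>" "h = rr \<gamma>" by blast
    have "inv\<^bsub>BijGroup dual_space\<^esub> h = inv\<^bsub>W\<^esub> h"
      using group.m_inv_consistent[OF group_BijGroup subgroup_W] root_refl_W \<gamma>
      by (simp add: aff_weyl_def)
    then show ?case using acts_as.intros(2) \<gamma> inv_root_refl by metis
  next
    case (eng h1 h2)
    have "h1 \<otimes>\<^bsub>BijGroup dual_space\<^esub> h2 = h1 \<otimes>\<^bsub>W\<^esub> h2" by (simp add: aff_weyl_def)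
    moreover have "h1 \<in> carrier W" "h2 \<in> carrier W" using eng carrier_W by auto
    ultimately show ?case using eng.IH acts_as_spec by (metis W.m_assoc)
  qed
  then show ?thesis using acts_as.intros(1) assms by (metis W.r_one)
qed

lemma acts_as_unique:
  assumes "acts_as R w T" "acts_as R w T'"
  shows "T = T'"
proof
  fix \<beta>
  show "T \<beta> = T' \<beta>"
  proof (rule pairing_separates)
    fix f :: "'v \<Rightarrow> rat" assume "f \<in> dual_space"
    then obtain g where "g \<in> dual_space" "w g = f" using W_surj acts_as_spec[OF assms(1)] by metis
    then show "pairing (T \<beta>) f = pairing (T' \<beta>) f" using acts_as_spec assms by metis
  qed
qed

lemma acts_as_act: "w \<in> carrier W \<Longrightarrow> acts_as R w (act w)"
  unfolding weyl_act_def using acts_as_ex acts_as_unique by (metis theI)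

lemma pairing_act:
  "w \<in> carrier W \<Longrightarrow> f \<in> dual_space \<Longrightarrow> pairing (act w \<beta>) (w f) = pairing \<beta> f"
  using acts_as_spec[OF acts_as_act] by blast

lemma act_eqI:
  assumes "w \<in> carrier W" "\<And>f. f \<in> dual_space \<Longrightarrow> pairing \<xi> (w f) = pairing \<beta> f"
  shows "act w \<beta> = \<xi>"
proof (rule pairing_separates)
  fix f :: "'v \<Rightarrow> rat" assume "f \<in> dual_space"
  then obtain g where "g \<in> dual_space" "w g = f" using W_surj assms(1) by metis
  then show "pairing (act w \<beta>) f = pairing \<xi> f" using pairing_act assms by metis
qed

lemma act_one: "act \<one>\<^bsub>W\<^esub> \<beta> = \<beta>"
  by (rule act_eqI) (auto simp: W_one)

lemma act_mult:
  "x \<in> carrier W \<Longrightarrow> y \<in> carrier W \<Longrightarrow> act (x \<otimes>\<^bsub>W\<^esub> y) \<beta> = act x (act y \<beta>)"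
  by (rule act_eqI) (auto simp: W_apply_mult W_dual pairing_act)

lemma act_root_refl: "\<gamma> \<in> \<Phi> \<Longrightarrow> act (rr \<gamma>) \<beta> = lin_refl R \<gamma> \<beta>"
  by (rule act_eqI) (auto simp: root_refl_W pairing_root_refl lin_refl_lin_refl)

lemma act_inv_act: "x \<in> carrier W \<Longrightarrow> act (inv\<^bsub>W\<^esub> x) (act x \<beta>) = \<beta>"
  and act_act_inv: "x \<in> carrier W \<Longrightarrow> act x (act (inv\<^bsub>W\<^esub> x) \<beta>) = \<beta>"
  using act_mult[of "inv\<^bsub>W\<^esub> x" x \<beta>] act_mult[of x "inv\<^bsub>W\<^esub> x" \<beta>] by (simp_all add: act_one)

lemma act_neg: "x \<in> carrier W \<Longrightarrow> act x (- \<beta>) = - act x \<beta>"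
  by (rule act_eqI) (auto simp: pairing_uminus W_dual pairing_act)

lemma W_induct [consumes 1, case_names one refl]:
  assumes "w \<in> carrier W" "P \<one>\<^bsub>W\<^esub>"
    "\<And>\<gamma> w. \<gamma> \<in> \<Phi> \<Longrightarrow> w \<in> carrier W \<Longrightarrow> P w \<Longrightarrow> P (rr \<gamma> \<otimes>\<^bsub>W\<^esub> w)"
  shows "P w"
proof -
  have "acts_as R w T \<Longrightarrow> P w" for T
    by (induction rule: acts_as.induct) (use assms acts_as_spec in blast)+
  then show ?thesis using acts_as_ex assms(1) by blast
qed

lemma act_root: "x \<in> carrier W \<Longrightarrow> \<gamma> \<in> \<Phi> \<Longrightarrow> act x \<gamma> \<in> \<Phi>"
  by (induction rule: W_induct) (auto simp: act_one act_mult root_refl_W act_root_refl lin_refl_root)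

lemma root_refl_lin_refl:
  assumes "\<delta> \<in> \<Phi>" "\<gamma> \<in> \<Phi>"
  shows "rr (lin_refl R \<delta> \<gamma>) = rr \<delta> \<otimes>\<^bsub>W\<^esub> rr \<gamma> \<otimes>\<^bsub>W\<^esub> rr \<delta>"
proof (rule W_eqI)
  fix f :: "'v \<Rightarrow> rat" assume f: "f \<in> dual_space"
  let ?c = "coroot R (fst \<gamma>)" and ?d = "coroot R (fst \<delta>)" and ?g = "rr \<delta> f"
  let ?t = "pairing (lin_refl R \<delta> \<gamma>) f"
  have g: "?g \<in> dual_space" "rr \<gamma> ?g \<in> dual_space" using f assms root_refl_dual by auto
  have c: "coroot R (fst (lin_refl R \<delta> \<gamma>)) = (\<lambda>v. ?c (rfl (fst \<delta>) v))"
    using assms by (simp add: lin_refl_def aff_root_fst coroot_rfl)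
  have h: "rr \<gamma> ?g = (\<lambda>v. ?g v - ?t * ?c v)"
    using g f assms by (simp add: root_refl_apply[of ?g] pairing_root_refl)
  have "rr \<delta> (rr \<gamma> ?g) = (\<lambda>v. rr \<gamma> ?g v - pairing \<delta> (rr \<gamma> ?g) * ?d v)"
    using g by (simp add: root_refl_apply[of "rr \<gamma> ?g"])
  also have "\<dots> = (\<lambda>v. (?g v - pairing \<delta> ?g * ?d v) - ?t * (?c v - ?c (fst \<delta>) * ?d v))"
    unfolding h pairing_def by (simp add: algebra_simps)
  also have "\<dots> = (\<lambda>v. rr \<delta> ?g v - ?t * ?c (rfl (fst \<delta>) v))"
    using g assms by (simp add: root_refl_apply[of ?g] coroot_simps aff_root_fst algebra_simps)
  also have "\<dots> = rr (lin_refl R \<delta> \<gamma>) f"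
    unfolding root_refl_root_refl[OF assms(1) f] root_refl_apply[OF f, of "lin_refl R \<delta> \<gamma>"] c ..
  finally show "rr (lin_refl R \<delta> \<gamma>) f = (rr \<delta> \<otimes>\<^bsub>W\<^esub> rr \<gamma> \<otimes>\<^bsub>W\<^esub> rr \<delta>) f"
    using f g assms by (simp add: W_apply_mult root_refl_W)
qed (use assms in \<open>auto simp: root_refl_W lin_refl_root\<close>)

lemma root_refl_act:
  assumes "x \<in> carrier W" "\<gamma> \<in> \<Phi>"
  shows "rr (act x \<gamma>) = x \<otimes>\<^bsub>W\<^esub> rr \<gamma> \<otimes>\<^bsub>W\<^esub> inv\<^bsub>W\<^esub> x"
  using assms
proof (induction rule: W_induct)
  case one
  then show ?case by (simp add: act_one root_refl_W)
next
  case (refl \<delta> w)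
  then show ?case
    by (simp add: act_mult root_refl_W act_root_refl root_refl_lin_refl act_root W.inv_mult_group
        inv_root_refl W.m_assoc)
qed

lemma root_refl_act_mult:
  assumes "x \<in> carrier W" "\<gamma> \<in> \<Phi>"
  shows "rr (act x \<gamma>) \<otimes>\<^bsub>W\<^esub> x = x \<otimes>\<^bsub>W\<^esub> rr \<gamma>"
  using assms by (simp add: root_refl_act W.m_assoc root_refl_W)

lemma root_refl_ne_one: "\<gamma> \<in> \<Phi> \<Longrightarrow> rr \<gamma> \<noteq> \<one>\<^bsub>W\<^esub>"
proof
  assume a: "\<gamma> \<in> \<Phi>" "rr \<gamma> = \<one>\<^bsub>W\<^esub>"
  then have "- \<gamma> = \<gamma>" using act_root_refl[of \<gamma> \<gamma>] by (simp add: lin_refl_self act_one)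
  then have "- fst \<gamma> = fst \<gamma>" by (metis fst_uminus)
  then have "coroot R (fst \<gamma>) (fst \<gamma>) = - coroot R (fst \<gamma>) (fst \<gamma>)"
    using coroot_simps(4)[OF aff_root_fst[OF a(1)], of "fst \<gamma>"] by simp
  then show False using a coroot_self aff_root_fst by fastforce
qed

lemma root_refl_mult_ne: "\<gamma> \<in> \<Phi> \<Longrightarrow> x \<in> carrier W \<Longrightarrow> rr \<gamma> \<otimes>\<^bsub>W\<^esub> x \<noteq> x"
  using root_refl_ne_one root_refl_W by (metis W.l_one W.right_cancel W.one_closed)

end

section \<open>Positive affine roots and the orientation of edges\<close>

context irreducible_root_system
begin

abbreviation affP ("\<Phi>\<^sup>+") where "\<Phi>\<^sup>+ \<equiv> aff_pos_roots R B"
abbreviation simp_roots ("\<Delta>") where "\<Delta> \<equiv> aff_simple_roots R B"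
abbreviation simp_refls where "simp_refls \<equiv> simple_refls R B"

text \<open>The common reflection negates both roots, so \<delta> is a rational multiple of
  \<gamma>, and reducedness leaves only the two signs.\<close>

lemma root_refl_inj:
  assumes "\<gamma> \<in> \<Phi>" "\<delta> \<in> \<Phi>" "rr \<gamma> = rr \<delta>"
  shows "\<delta> = \<gamma> \<or> \<delta> = - \<gamma>"
proof -
  let ?c = "coroot R (fst \<gamma>) (fst \<delta>)"
  have "- \<delta> = lin_refl R \<gamma> \<delta>"
    using assms act_root_refl[of \<delta> \<delta>] act_root_refl[of \<gamma> \<delta>] by (simp add: lin_refl_self)
  then have eq: "2 *\<^sub>Q fst \<delta> = ?c *\<^sub>Q fst \<gamma>" "2 * snd \<delta> = ?c * snd \<gamma>"
    by (auto simp: lin_refl_def prod_eq_iff two_scale algebra_simps)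
  from arg_cong[OF eq(1), of "\<lambda>v. (1/2) *\<^sub>Q v"]
  have f: "fst \<delta> = (?c / 2) *\<^sub>Q fst \<gamma>" by (simp add: scaleQ_scaleQ scaleQ_one)
  then have "?c / 2 = 1 \<or> ?c / 2 = -1"
    using assms reduced aff_root_fst unfolding reduced_roots_def by metis
  then show ?thesis using eq(2) f by (auto simp: prod_eq_iff scaleQ_one)
qed

lemma pos_root_iff: "\<gamma> \<in> \<Phi>\<^sup>+ \<longleftrightarrow> \<gamma> \<in> \<Phi> \<and> (snd \<gamma> > 0 \<or> snd \<gamma> = 0 \<and> fst \<gamma> \<in> nonneg_comb B)"
  by (cases \<gamma>) (auto simp: aff_pos_roots_def aff_roots_def pos_roots_def)

lemma pos_root_root: "\<gamma> \<in> \<Phi>\<^sup>+ \<Longrightarrow> \<gamma> \<in> \<Phi>"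
  by (simp add: pos_root_iff)

lemma pos_or_neg: "\<gamma> \<in> \<Phi> \<Longrightarrow> \<gamma> \<in> \<Phi>\<^sup>+ \<or> - \<gamma> \<in> \<Phi>\<^sup>+"
  using base_sign[OF aff_root_fst, of \<gamma>] neg_aff_root[of \<gamma>] by (auto simp: pos_root_iff)

lemma pos_not_neg: "\<gamma> \<in> \<Phi>\<^sup>+ \<Longrightarrow> - \<gamma> \<notin> \<Phi>\<^sup>+"
  using nonneg_comb_antisym[of "fst \<gamma>"] zero_notin by (auto simp: pos_root_iff aff_root_iff)

text \<open>Coordinates with respect to the affine simple roots: (a, n) is n times (- \<theta>, 1)
  plus (a + n \<theta>, 0). So n is the coordinate at the affine simple root (- \<theta>, 1), and
  the others are those of a + n \<theta>.\<close>

definition aco :: "'v \<times> rat \<Rightarrow> 'v \<times> rat \<Rightarrow> rat" where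
  "aco \<alpha> \<gamma> = (if snd \<alpha> = 0 then co (fst \<alpha>) (fst \<gamma> + snd \<gamma> *\<^sub>Q \<theta>) else snd \<gamma>)"

lemma simple_iff: "\<alpha> \<in> \<Delta> \<longleftrightarrow> snd \<alpha> = 0 \<and> fst \<alpha> \<in> B \<or> \<alpha> = (- \<theta>, 1)"
  by (cases \<alpha>) (auto simp: aff_simple_roots_def)

lemma simple_pos: "\<alpha> \<in> \<Delta> \<Longrightarrow> \<alpha> \<in> \<Phi>\<^sup>+"
  by (auto simp: simple_iff pos_root_iff aff_root_iff base_root neg_in highest_root nonneg_comb_iff co_base)

lemma simple_root: "\<alpha> \<in> \<Delta> \<Longrightarrow> \<alpha> \<in> \<Phi>"
  using simple_pos pos_root_root by blast

lemma aco_lin_refl: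
  "aco \<alpha> (lin_refl R \<beta> \<gamma>) = aco \<alpha> \<gamma> - coroot R (fst \<beta>) (fst \<gamma>) * aco \<alpha> \<beta>"
  by (simp add: aco_def lin_refl_def co_simps rat_vec.scale_left_diff_distrib algebra_simps)

lemma aco_simple: "\<alpha> \<in> \<Delta> \<Longrightarrow> \<beta> \<in> \<Delta> \<Longrightarrow> aco \<alpha> \<beta> = (if \<alpha> = \<beta> then 1 else 0)"
  by (auto simp: simple_iff aco_def co_simps co_base scaleQ_one prod_eq_iff)

lemma aco_neg: "aco \<alpha> (- \<gamma>) = - aco \<alpha> \<gamma>"
  by (simp add: aco_def co_simps algebra_simps)

text \<open>For n at least 1 write a + n \<theta> = (\<theta> - (- a)) + (n - 1) \<theta>. Both
  summands are nonnegative combinations because \<theta> is above every root, in particular above -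
  a.\<close>

lemma pos_aco_nonneg:
  assumes "\<gamma> \<in> \<Phi>\<^sup>+" "\<alpha> \<in> \<Delta>"
  shows "aco \<alpha> \<gamma> \<in> \<nat>"
proof -
  obtain i where i: "snd \<gamma> = of_int i" and a: "fst \<gamma> \<in> R"
    using pos_root_root[OF assms(1)] by (auto simp: aff_root_iff elim!: Ints_cases)
  show ?thesis
  proof (cases "snd \<alpha> = 0")
    case False
    have "snd \<gamma> = of_nat (nat i)" using assms(1) i by (auto simp: pos_root_iff)
    then show ?thesis using False by (simp add: aco_def)
  next
    case True
    then have b: "fst \<alpha> \<in> B" using assms(2) by (auto simp: simple_iff)
    have "fst \<gamma> + snd \<gamma> *\<^sub>Q \<theta> \<in> nonneg_comb B"
    proof (cases "snd \<gamma> = 0")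
      case True
      then show ?thesis using assms(1) by (simp add: pos_root_iff)
    next
      case False
      then obtain n where "snd \<gamma> = 1 + of_nat n"
        using assms(1) i unfolding pos_root_iff
        by (metis False add.commute of_int_0_less_iff of_int_of_nat_eq of_nat_Suc zero_less_imp_eq_int
            Suc_pred gr0_conv_Suc)
      then have "fst \<gamma> + snd \<gamma> *\<^sub>Q \<theta> = (\<theta> - - fst \<gamma>) + of_nat n *\<^sub>Q \<theta>"
        by (simp add: scaleQ_add_left scaleQ_one)
      moreover have "of_nat n *\<^sub>Q \<theta> \<in> nonneg_comb B"
        using highest_root_pos by (auto simp: nonneg_comb_iff co_simps)
      ultimately show ?thesis
        using nonneg_comb_add highest_root_ge[OF neg_in[OF a]] by metis
    qed
    then show ?thesis using b True by (simp add: aco_def nonneg_comb_iff)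
  qed
qed

lemma pos_aco_ge: "\<gamma> \<in> \<Phi>\<^sup>+ \<Longrightarrow> \<alpha> \<in> \<Delta> \<Longrightarrow> aco \<alpha> \<gamma> \<ge> 0"
  using pos_aco_nonneg[of \<gamma> \<alpha>] Nats_cases[of "aco \<alpha> \<gamma>"] by force

lemma aco_pos_rootI: "\<gamma> \<in> \<Phi> \<Longrightarrow> \<alpha> \<in> \<Delta> \<Longrightarrow> aco \<alpha> \<gamma> > 0 \<Longrightarrow> \<gamma> \<in> \<Phi>\<^sup>+"
  using pos_or_neg[of \<gamma>] pos_aco_ge[of "- \<gamma>" \<alpha>] by (auto simp: aco_neg)

lemma aco_eqI:
  assumes "\<And>\<alpha>. \<alpha> \<in> \<Delta> \<Longrightarrow> aco \<alpha> \<gamma> = aco \<alpha> \<delta>"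
  shows "\<gamma> = \<delta>"
proof -
  have s: "snd \<gamma> = snd \<delta>" using assms[of "(- \<theta>, 1)"] by (simp add: simple_iff aco_def)
  have "fst \<gamma> + snd \<gamma> *\<^sub>Q \<theta> = fst \<delta> + snd \<delta> *\<^sub>Q \<theta>"
  proof (rule co_eqI)
    fix b assume "b \<in> B"
    then show "co b (fst \<gamma> + snd \<gamma> *\<^sub>Q \<theta>) = co b (fst \<delta> + snd \<delta> *\<^sub>Q \<theta>)"
      using assms[of "(b, 0)"] by (simp add: simple_iff aco_def)
  qed
  with s show ?thesis by (simp add: prod_eq_iff)
qed

text \<open>As in the finite case, only the coordinate at \<alpha> changes, and by reducedness a
  positive root other than \<alpha> has a further positive coordinate.\<close>

lemma simple_refl_pos:
  assumes "\<gamma> \<in> \<Phi>\<^sup>+" "\<alpha> \<in> \<Delta>" "\<gamma> \<noteq> \<alpha>"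
  shows "lin_refl R \<alpha> \<gamma> \<in> \<Phi>\<^sup>+"
proof -
  have "\<exists>\<beta>\<in>\<Delta>. \<beta> \<noteq> \<alpha> \<and> aco \<beta> \<gamma> > 0"
  proof (rule ccontr)
    assume "\<not> ?thesis"
    then have z: "aco \<beta> \<gamma> = 0" if "\<beta> \<in> \<Delta>" "\<beta> \<noteq> \<alpha>" for \<beta>
      using pos_aco_ge[OF assms(1) that(1)] that by force
    let ?k = "aco \<alpha> \<gamma>"
    have "\<gamma> = (?k *\<^sub>Q fst \<alpha>, ?k * snd \<alpha>)"
    proof (rule aco_eqI)
      fix \<beta> assume b: "\<beta> \<in> \<Delta>"
      have "aco \<beta> (?k *\<^sub>Q fst \<alpha>, ?k * snd \<alpha>) = ?k * aco \<beta> \<alpha>"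
        by (simp add: aco_def co_simps algebra_simps flip: scaleQ_scaleQ)
      then show "aco \<beta> \<gamma> = aco \<beta> (?k *\<^sub>Q fst \<alpha>, ?k * snd \<alpha>)"
        using z[OF b] aco_simple[OF b assms(2)] by auto
    qed
    moreover from this have "?k = 1"
      using scaled_root[of "fst \<alpha>" ?k] aff_root_fst[OF simple_root[OF assms(2)]]
        aff_root_fst[OF pos_root_root[OF assms(1)]] pos_aco_ge[OF assms(1,2)] by (metis fst_conv)
    ultimately show False using assms(3) by (auto simp: scaleQ_one prod_eq_iff)
  qed
  then obtain \<beta> where "\<beta> \<in> \<Delta>" "\<beta> \<noteq> \<alpha>" "aco \<beta> \<gamma> > 0" by blast
  then show ?thesis
    using aco_pos_rootI[of "lin_refl R \<alpha> \<gamma>" \<beta>] assms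
    by (simp add: lin_refl_root simple_root pos_root_root aco_lin_refl aco_simple)
qed

text \<open>The finite part of \<gamma> is the combination of the finite parts of the affine simple
  roots with the nonnegative coefficients \<open>aco\<close>; if all pairings were nonpositive, its
  squared norm would be too.\<close>

lemma ex_simple_coroot_pos_aff:
  assumes "\<gamma> \<in> \<Phi>\<^sup>+"
  shows "\<exists>\<alpha>\<in>\<Delta>. coroot R (fst \<alpha>) (fst \<gamma>) > 0"
proof (rule ccontr)
  assume neg: "\<not> ?thesis"
  let ?a = "fst \<gamma>"
  have a: "?a \<in> R" using assms pos_root_root aff_root_fst by blast
  have le: "aco \<alpha> \<gamma> * ip ?a (fst \<alpha>) \<le> 0" if "\<alpha> \<in> \<Delta>" for \<alpha>
    using neg that coroot_pos_iff[OF aff_root_fst[OF simple_root[OF that]], of ?a]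
      pos_aco_ge[OF assms that] by (auto simp: ip_commute mult_nonneg_nonpos)
  have "?a = (?a + snd \<gamma> *\<^sub>Q \<theta>) + snd \<gamma> *\<^sub>Q (- \<theta>)" by simp
  then have "ip ?a ?a = ip ?a (?a + snd \<gamma> *\<^sub>Q \<theta>) + snd \<gamma> * ip ?a (- \<theta>)"
    by (metis ip_simps_right(1,2))
  also have "ip ?a (?a + snd \<gamma> *\<^sub>Q \<theta>) = (\<Sum>b\<in>B. co b (?a + snd \<gamma> *\<^sub>Q \<theta>) * ip ?a b)"
    by (rule dual_expand[OF ip_dual])
  also have "\<dots> \<le> 0"
    by (rule sum_nonpos) (use le[of "(_, 0)"] in \<open>auto simp: simple_iff aco_def\<close>)
  also have "snd \<gamma> * ip ?a (- \<theta>) \<le> 0" using le[of "(- \<theta>, 1)"] by (simp add: simple_iff aco_def)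
  finally show False using ip_root_pos[OF a] by simp
qed

text \<open>The sum of all coordinates \<open>aco\<close>, that is, the height with respect to the
  affine simple roots.\<close>

definition aheight :: "'v \<times> rat \<Rightarrow> rat" where
  "aheight \<gamma> = snd \<gamma> + height (fst \<gamma> + snd \<gamma> *\<^sub>Q \<theta>)"

lemma aheight_nat: "\<gamma> \<in> \<Phi>\<^sup>+ \<Longrightarrow> aheight \<gamma> \<in> \<nat>"
proof -
  assume g: "\<gamma> \<in> \<Phi>\<^sup>+"
  have "snd \<gamma> \<in> \<nat>" using pos_aco_nonneg[OF g, of "(- \<theta>, 1)"] by (simp add: simple_iff aco_def)
  moreover have "fst \<gamma> + snd \<gamma> *\<^sub>Q \<theta> \<in> nonneg_comb B"
    using pos_aco_nonneg[OF g, of "(_, 0)"] by (simp add: simple_iff aco_def nonneg_comb_iff)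
  ultimately show ?thesis unfolding aheight_def using height_nat by simp
qed

lemma aheight_lin_refl: "\<alpha> \<in> \<Delta> \<Longrightarrow> aheight (lin_refl R \<alpha> \<gamma>) = aheight \<gamma> - coroot R (fst \<alpha>) (fst \<gamma>)"
proof -
  assume a: "\<alpha> \<in> \<Delta>"
  have "aheight (lin_refl R \<alpha> \<gamma>) = aheight \<gamma> - coroot R (fst \<alpha>) (fst \<gamma>) * aheight \<alpha>"
    by (simp add: aheight_def lin_refl_def dual_simps[OF height_dual] algebra_simps)
  moreover have "aheight \<alpha> = 1"
    using a by (auto simp: simple_iff aheight_def height_base dual_simps[OF height_dual] scaleQ_one)
  ultimately show ?thesis by simp
qed

lemma simple_refl_W: "s \<in> simp_refls \<Longrightarrow> s \<in> carrier W"
  by (auto simp: simple_refls_def simple_root root_refl_W)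

lemma word_prod_W: "set ws \<subseteq> simp_refls \<Longrightarrow> word_prod W ws \<in> carrier W"
  by (induction ws) (auto simp: word_prod_Nil word_prod_Cons simple_refl_W)

lemma word_prod_append:
  "set us \<subseteq> simp_refls \<Longrightarrow> set ws \<subseteq> simp_refls \<Longrightarrow>
    word_prod W (us @ ws) = word_prod W us \<otimes>\<^bsub>W\<^esub> word_prod W ws"
  by (induction us) (auto simp: word_prod_Nil word_prod_Cons simple_refl_W word_prod_W W.m_assoc)

text \<open>Reflecting in a simple root of positive pairing lowers the affine height, and the root
  stays positive until it is itself simple.\<close>

lemma pos_root_conjugate:
  assumes "\<gamma> \<in> \<Phi>\<^sup>+"
  shows "\<exists>ws \<alpha>. set ws \<subseteq> simp_refls \<and> \<alpha> \<in> \<Delta> \<and> \<gamma> = act (word_prod W ws) \<alpha>"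
proof -
  obtain n where "aheight \<gamma> = of_nat n" using aheight_nat[OF assms] by (auto elim!: Nats_cases)
  then show ?thesis using assms
  proof (induction n arbitrary: \<gamma> rule: less_induct)
    case (less n)
    obtain \<alpha> where \<alpha>: "\<alpha> \<in> \<Delta>" "coroot R (fst \<alpha>) (fst \<gamma>) > 0"
      using ex_simple_coroot_pos_aff less.prems by blast
    show ?case
    proof (cases "\<gamma> = \<alpha>")
      case True
      then show ?thesis
        using \<alpha> by (intro exI[of _ "[]"] exI[of _ \<alpha>]) (simp add: word_prod_Nil act_one)
    next
      case False
      let ?\<gamma> = "lin_refl R \<alpha> \<gamma>"
      have g: "?\<gamma> \<in> \<Phi>\<^sup>+" using simple_refl_pos less.prems \<alpha> False by blast
      obtain m where m: "aheight ?\<gamma> = of_nat m" using aheight_nat[OF g] by (auto elim!: Nats_cases)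
      then have "m < n" using less.prems \<alpha> by (simp add: aheight_lin_refl)
      from less.IH[OF this m g] obtain ws \<beta>
        where ws: "set ws \<subseteq> simp_refls" "\<beta> \<in> \<Delta>" "?\<gamma> = act (word_prod W ws) \<beta>" by blast
      have "\<gamma> = act (rr \<alpha>) ?\<gamma>" using \<alpha> by (simp add: act_root_refl simple_root lin_refl_lin_refl)
      also have "\<dots> = act (word_prod W (rr \<alpha> # ws)) \<beta>"
        using ws \<alpha> by (simp add: word_prod_Cons act_mult root_refl_W simple_root word_prod_W)
      finally show ?thesis
        using ws \<alpha> by (intro exI[of _ "rr \<alpha> # ws"] exI[of _ \<beta>]) (auto simp: simple_refls_def)
    qed
  qed
qed

lemma word_prod_rev:
  "set ws \<subseteq> simp_refls \<Longrightarrow> word_prod W (rev ws) = inv\<^bsub>W\<^esub> word_prod W ws"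
proof (induction ws)
  case (Cons s ws)
  then have "s \<in> simp_refls" by simp
  then have "inv\<^bsub>W\<^esub> s = s" by (auto simp: simple_refls_def inv_root_refl simple_root)
  with Cons show ?case
    by (simp add: word_prod_append word_prod_Cons word_prod_Nil simple_refl_W word_prod_W W.inv_mult_group)
qed (simp add: word_prod_Nil)

lemma ex_word:
  assumes "w \<in> carrier W"
  shows "\<exists>ws. set ws \<subseteq> simp_refls \<and> word_prod W ws = w"
  using assms
proof (induction rule: W_induct)
  case one
  show ?case by (intro exI[of _ "[]"]) (simp add: word_prod_Nil)
next
  case (refl \<gamma> w)
  obtain \<delta> where \<delta>: "\<delta> \<in> \<Phi>\<^sup>+" "rr \<delta> = rr \<gamma>"
    using pos_or_neg[OF refl(1)] root_refl_neg[OF refl(1)] by blast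
  obtain us \<alpha> where us: "set us \<subseteq> simp_refls" "\<alpha> \<in> \<Delta>" "\<delta> = act (word_prod W us) \<alpha>"
    using pos_root_conjugate[OF \<delta>(1)] by blast
  obtain ws where ws: "set ws \<subseteq> simp_refls" "word_prod W ws = w" using refl by blast
  have "rr \<gamma> = word_prod W us \<otimes>\<^bsub>W\<^esub> rr \<alpha> \<otimes>\<^bsub>W\<^esub> inv\<^bsub>W\<^esub> word_prod W us"
    using us \<delta> by (metis root_refl_act simple_root word_prod_W)
  \<comment> \<open>A conjugate of a simple reflection is spelled by a word, the simple letter, and
    the reversed word.\<close>
  then have "word_prod W (us @ rr \<alpha> # rev us @ ws) = rr \<gamma> \<otimes>\<^bsub>W\<^esub> w"
    using us ws refl
    by (simp add: word_prod_append word_prod_Cons word_prod_rev word_prod_W simple_root root_refl_W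
        simple_refls_def W.m_assoc)
  moreover have "set (us @ rr \<alpha> # rev us @ ws) \<subseteq> simp_refls"
    using us ws by (auto simp: simple_refls_def)
  ultimately show ?case by blast
qed

abbreviation len where "len \<equiv> word_length W simp_refls"

lemma len_le: "set ws \<subseteq> simp_refls \<Longrightarrow> len (word_prod W ws) \<le> length ws"
  unfolding word_length_def by (rule Least_le) blast

lemma ex_reduced_word:
  "w \<in> carrier W \<Longrightarrow> \<exists>ws. set ws \<subseteq> simp_refls \<and> length ws = len w \<and> word_prod W ws = w"
  unfolding word_length_def by (rule LeastI_ex) (use ex_word in blast)

text \<open>The strong exchange condition. Moving \<gamma> through the word from the left, it first
  turns negative at some letter. A simple reflection makes no positive root negative but its own, so
  \<gamma> has there become the root of that letter, and deleting the letter amounts to multiplying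
  by \<open>rr \<gamma>\<close>.\<close>

lemma exchange:
  assumes "set ws \<subseteq> simp_refls" "\<gamma> \<in> \<Phi>\<^sup>+" "act (inv\<^bsub>W\<^esub> word_prod W ws) \<gamma> \<notin> \<Phi>\<^sup>+"
  shows "\<exists>us. set us \<subseteq> simp_refls \<and> length us < length ws \<and>
    word_prod W us = rr \<gamma> \<otimes>\<^bsub>W\<^esub> word_prod W ws"
  using assms
proof (induction ws arbitrary: \<gamma>)
  case Nil
  then show ?case by (simp add: word_prod_Nil act_one)
next
  case (Cons s ws)
  then obtain \<alpha> where \<alpha>: "\<alpha> \<in> \<Delta>" "s = rr \<alpha>" by (auto simp: simple_refls_def)
  have ws: "set ws \<subseteq> simp_refls" "word_prod W ws \<in> carrier W" using Cons by (auto simp: word_prod_W)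
  have g: "\<gamma> \<in> \<Phi>" and sr: "rr \<alpha> \<in> carrier W" "\<alpha> \<in> \<Phi>"
    using Cons \<alpha> by (auto simp: pos_root_root simple_root root_refl_W)
  show ?case
  proof (cases "\<gamma> = \<alpha>")
    case True
    then show ?thesis
      using \<alpha> ws sr by (intro exI[of _ ws]) (simp add: word_prod_Cons root_refl_mult_cancel)
  next
    case False
    let ?\<gamma> = "lin_refl R \<alpha> \<gamma>"
    have g': "?\<gamma> \<in> \<Phi>\<^sup>+" using simple_refl_pos Cons.prems \<alpha> False by blast
    have "act (inv\<^bsub>W\<^esub> word_prod W ws) ?\<gamma> = act (inv\<^bsub>W\<^esub> word_prod W (s # ws)) \<gamma>"
      using \<alpha> ws sr
      by (simp add: word_prod_Cons W.inv_mult_group act_mult inv_root_refl act_root_refl)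
    with Cons.prems have "act (inv\<^bsub>W\<^esub> word_prod W ws) ?\<gamma> \<notin> \<Phi>\<^sup>+" by simp
    from Cons.IH[OF ws(1) g' this] obtain us where us: "set us \<subseteq> simp_refls"
      "length us < length ws" "word_prod W us = rr ?\<gamma> \<otimes>\<^bsub>W\<^esub> word_prod W ws" by blast
    have "word_prod W (s # us) = rr \<gamma> \<otimes>\<^bsub>W\<^esub> word_prod W (s # ws)"
      using us(3) \<alpha> ws sr g
      by (simp add: word_prod_Cons root_refl_lin_refl W.m_assoc root_refl_mult_cancel root_refl_W)
    then show ?thesis
      using us Cons.prems by (intro exI[of _ "s # us"]) auto
  qed
qed

lemma len_decrease:
  assumes "x \<in> carrier W" "\<gamma> \<in> \<Phi>\<^sup>+" "act (inv\<^bsub>W\<^esub> x) \<gamma> \<notin> \<Phi>\<^sup>+"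
  shows "len (rr \<gamma> \<otimes>\<^bsub>W\<^esub> x) < len x"
proof -
  obtain ws where ws: "set ws \<subseteq> simp_refls" "length ws = len x" "word_prod W ws = x"
    using ex_reduced_word assms(1) by blast
  from exchange[of ws \<gamma>] ws assms obtain us where "set us \<subseteq> simp_refls" "length us < length ws"
    "word_prod W us = rr \<gamma> \<otimes>\<^bsub>W\<^esub> x" by auto
  then show ?thesis using len_le[of us] ws by simp
qed

lemma act_inv_reflected:
  "x \<in> carrier W \<Longrightarrow> \<gamma> \<in> \<Phi> \<Longrightarrow>
    act (inv\<^bsub>W\<^esub> (rr \<gamma> \<otimes>\<^bsub>W\<^esub> x)) \<gamma> = - act (inv\<^bsub>W\<^esub> x) \<gamma>"
  by (simp add: W.inv_mult_group act_mult root_refl_W inv_root_refl act_root_refl lin_refl_self act_neg)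

text \<open>Length increases strictly along the Bruhat order, while by \<open>len_decrease\<close>
  it would drop if the transported root were not positive. Conversely the transported root has the
  opposite sign at the other endpoint, so the length rises and the pair is a single generating step
  of the order.\<close>

lemma aff_less_iff:
  assumes "x \<in> carrier W" "\<gamma> \<in> \<Phi>\<^sup>+"
  shows "(x, rr \<gamma> \<otimes>\<^bsub>W\<^esub> x) \<in> aff_less R B \<longleftrightarrow> act (inv\<^bsub>W\<^esub> x) \<gamma> \<in> \<Phi>\<^sup>+"
proof
  have "len a < len b" if "(a, b) \<in> aff_less R B" for a b
    using that unfolding aff_less_def bruhat_less_def by (induction rule: trancl_induct) auto
  then show "act (inv\<^bsub>W\<^esub> x) \<gamma> \<in> \<Phi>\<^sup>+" if "(x, rr \<gamma> \<otimes>\<^bsub>W\<^esub> x) \<in> aff_less R B"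
    using that len_decrease[OF assms] by (meson not_less_iff_gr_or_eq)
next
  assume pos: "act (inv\<^bsub>W\<^esub> x) \<gamma> \<in> \<Phi>\<^sup>+"
  let ?y = "rr \<gamma> \<otimes>\<^bsub>W\<^esub> x"
  have g: "\<gamma> \<in> \<Phi>" "rr \<gamma> \<in> carrier W" using assms by (auto simp: pos_root_root root_refl_W)
  have "act (inv\<^bsub>W\<^esub> ?y) \<gamma> \<notin> \<Phi>\<^sup>+"
    using pos pos_not_neg assms g by (simp add: act_inv_reflected)
  from len_decrease[OF _ assms(2) this] have "len x < len ?y"
    using assms g by (simp add: root_refl_mult_cancel)
  moreover obtain ws \<alpha> where ws: "set ws \<subseteq> simp_refls" "\<alpha> \<in> \<Delta>" "\<gamma> = act (word_prod W ws) \<alpha>"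
    using pos_root_conjugate[OF assms(2)] by blast
  then have "rr \<gamma> = word_prod W ws \<otimes>\<^bsub>W\<^esub> rr \<alpha> \<otimes>\<^bsub>W\<^esub> inv\<^bsub>W\<^esub> word_prod W ws"
    by (metis root_refl_act simple_root word_prod_W)
  then have "\<exists>w\<in>carrier W. \<exists>s\<in>simp_refls. rr \<gamma> = w \<otimes>\<^bsub>W\<^esub> s \<otimes>\<^bsub>W\<^esub> inv\<^bsub>W\<^esub> w"
    using ws word_prod_W by (auto simp: simple_refls_def)
  ultimately show "(x, ?y) \<in> aff_less R B"
    unfolding aff_less_def bruhat_less_def using assms(1) by (intro r_into_trancl) blast
qed

end

section \<open>The symmetric algebra\<close>

lemma (in abelian_group) diff_eq_zero_iff:
  "x \<in> carrier G \<Longrightarrow> y \<in> carrier G \<Longrightarrow> x \<ominus> y = \<zero> \<longleftrightarrow> x = y"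
  using minus_equality[of x "\<ominus> y"] by (auto simp: a_minus_def minus_minus r_neg)

lemma poly_mapping_single_induct [case_names single add]:
  assumes "\<And>m c. P (Poly_Mapping.single m c)" "\<And>p q. P p \<Longrightarrow> P q \<Longrightarrow> P (p + q)"
  shows "P (p :: 'm \<Rightarrow>\<^sub>0 'c::comm_monoid_add)"
proof -
  have sum: "P (\<Sum>m\<in>A. Poly_Mapping.single m (Poly_Mapping.lookup p m))" if "finite A" for A
    using that
  proof induction
    case empty
    show ?case using assms(1)[of undefined 0] by simp
  next
    case (insert a A)
    then show ?case by (simp add: assms)
  qed
  have "p = (\<Sum>m\<in>Poly_Mapping.keys p. Poly_Mapping.single m (Poly_Mapping.lookup p m))"
  proof (rule poly_mapping_eqI)
    fix k
    show "Poly_Mapping.lookup p k = Poly_Mapping.lookup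
        (\<Sum>m\<in>Poly_Mapping.keys p. Poly_Mapping.single m (Poly_Mapping.lookup p m)) k"
      by (simp add: lookup_sum lookup_single when_def in_keys_iff)
  qed
  then show ?thesis using sum[OF finite_keys, of p] by simp
qed

section \<open>Substitution in polynomials\<close>

definition pm_eval :: "('c::zero \<Rightarrow> 'r) \<Rightarrow> ('a \<Rightarrow> 'r) \<Rightarrow> (('a \<Rightarrow>\<^sub>0 nat) \<Rightarrow>\<^sub>0 'c) \<Rightarrow> 'r::comm_ring_1" where
  "pm_eval h \<phi> p = (\<Sum>m\<in>Poly_Mapping.keys p.
     h (Poly_Mapping.lookup p m) * (\<Prod>a\<in>Poly_Mapping.keys m. \<phi> a ^ Poly_Mapping.lookup m a))"

locale evaluation =
  fixes h :: "'f::field \<Rightarrow> 'r::comm_ring_1" and \<phi> :: "'a \<Rightarrow> 'r"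
  assumes h_add: "h (c + d) = h c + h d" and h_mult: "h (c * d) = h c * h d" and h_one: "h 1 = 1"
begin

lemma h_zero: "h 0 = 0"
  using h_add[of 0 0] by simp

abbreviation mono :: "('a \<Rightarrow>\<^sub>0 nat) \<Rightarrow> 'r" where
  "mono m \<equiv> (\<Prod>a\<in>Poly_Mapping.keys m. \<phi> a ^ Poly_Mapping.lookup m a)"

lemma mono_superset:
  "finite K \<Longrightarrow> Poly_Mapping.keys m \<subseteq> K \<Longrightarrow> mono m = (\<Prod>a\<in>K. \<phi> a ^ Poly_Mapping.lookup m a)"
  by (rule prod.mono_neutral_left) (auto simp: in_keys_iff)

lemma mono_add: "mono (m + n) = mono m * mono n"
proof -
  let ?K = "Poly_Mapping.keys m \<union> Poly_Mapping.keys n"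
  have "mono (m + n) = (\<Prod>a\<in>?K. \<phi> a ^ Poly_Mapping.lookup (m + n) a)"
    by (rule mono_superset) (use keys_add[of m n] in auto)
  also have "\<dots> = (\<Prod>a\<in>?K. \<phi> a ^ Poly_Mapping.lookup m a) * (\<Prod>a\<in>?K. \<phi> a ^ Poly_Mapping.lookup n a)"
    by (simp add: lookup_add power_add prod.distrib)
  also have "\<dots> = mono m * mono n"
    by (simp add: mono_superset[of ?K])
  finally show ?thesis .
qed

lemma eval_superset:
  "finite K \<Longrightarrow> Poly_Mapping.keys p \<subseteq> K \<Longrightarrow>
    pm_eval h \<phi> p = (\<Sum>m\<in>K. h (Poly_Mapping.lookup p m) * mono m)"
  unfolding pm_eval_def by (rule sum.mono_neutral_left) (auto simp: in_keys_iff h_zero)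

lemma eval_add: "pm_eval h \<phi> (p + q) = pm_eval h \<phi> p + pm_eval h \<phi> q"
proof -
  let ?K = "Poly_Mapping.keys p \<union> Poly_Mapping.keys q"
  have "pm_eval h \<phi> (p + q) = (\<Sum>m\<in>?K. h (Poly_Mapping.lookup (p + q) m) * mono m)"
    by (rule eval_superset) (use keys_add[of p q] in auto)
  also have "\<dots> = pm_eval h \<phi> p + pm_eval h \<phi> q"
    by (simp add: eval_superset[of ?K] lookup_add h_add distrib_right sum.distrib)
  finally show ?thesis .
qed

lemma eval_single: "pm_eval h \<phi> (Poly_Mapping.single m c) = h c * mono m"
  by (simp add: pm_eval_def h_zero)

lemma eval_mult: "pm_eval h \<phi> (p * q) = pm_eval h \<phi> p * pm_eval h \<phi> q"
proof (induction p rule: poly_mapping_single_induct)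
  case (single m c)
  show ?case
  proof (induction q rule: poly_mapping_single_induct)
    case (single n d)
    show ?case by (simp add: mult_single eval_single mono_add h_mult)
  qed (simp add: distrib_left eval_add)
qed (simp add: distrib_right eval_add)

lemma eval_zero: "pm_eval h \<phi> 0 = 0"
  by (simp add: pm_eval_def)

lemma eval_uminus: "pm_eval h \<phi> (- p) = - pm_eval h \<phi> p"
  using eval_add[of p "- p"] by (simp add: eval_zero eq_neg_iff_add_eq_0 add.commute)

lemma eval_diff: "pm_eval h \<phi> (p - q) = pm_eval h \<phi> p - pm_eval h \<phi> q"
  using eval_add[of p "- q"] by (simp add: eval_uminus)

lemma eval_const: "pm_eval h \<phi> (Poly_Mapping.single 0 c) = h c"
  by (simp add: eval_single)

lemma eval_var: "pm_eval h \<phi> (poly_var a) = \<phi> a"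
  by (simp add: poly_var_def eval_single h_one)

end

lemma single_sum: "finite K \<Longrightarrow> Poly_Mapping.single (sum m K) (1::'f::field) = (\<Prod>a\<in>K. Poly_Mapping.single (m a) 1)"
  for m :: "'k \<Rightarrow> ('b::comm_monoid_add)"
proof (induction K rule: finite_induct)
  case (insert x K)
  then show ?case by (simp add: mult_single flip: insert.IH)
qed simp

lemma poly_var_power: "(poly_var a :: ('a \<Rightarrow>\<^sub>0 nat) \<Rightarrow>\<^sub>0 'f::field) ^ n = Poly_Mapping.single (Poly_Mapping.single a n) 1"
  by (induction n) (simp_all add: poly_var_def mult_single flip: single_add)

lemma eval_id:
  "pm_eval (Poly_Mapping.single 0) poly_var p = (p :: ('a \<Rightarrow>\<^sub>0 nat) \<Rightarrow>\<^sub>0 'f::field)"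
proof -
  interpret evaluation "Poly_Mapping.single 0 :: 'f \<Rightarrow> ('a \<Rightarrow>\<^sub>0 nat) \<Rightarrow>\<^sub>0 'f" poly_var
    by unfold_locales (simp_all add: single_add mult_single)
  show ?thesis
  proof (induction p rule: poly_mapping_single_induct)
    case (single m c)
    have "m = (\<Sum>a\<in>Poly_Mapping.keys m. Poly_Mapping.single a (Poly_Mapping.lookup m a))"
      by (rule poly_mapping_eqI) (simp add: lookup_sum lookup_single when_def in_keys_iff)
    from arg_cong[OF this, of "\<lambda>n. Poly_Mapping.single n (1::'f)"]
    have "Poly_Mapping.single m (1::'f) = mono m"
      by (simp add: single_sum poly_var_power)
    then show ?case
      by (simp add: eval_single mult_single flip: \<open>Poly_Mapping.single m 1 = mono m\<close>)
  qed (simp add: eval_add)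
qed

section \<open>The quotient by the additivity relations\<close>

locale symmetric_algebra =
  fixes A :: "'a::ab_group_add set" and ty :: "'f::field itself"
  assumes A_zero: "0 \<in> A" and A_add: "a \<in> A \<Longrightarrow> b \<in> A \<Longrightarrow> a + b \<in> A"
    and A_uminus: "a \<in> A \<Longrightarrow> - a \<in> A"
begin

abbreviation P :: "(('a \<Rightarrow>\<^sub>0 nat) \<Rightarrow>\<^sub>0 'f) ring" where "P \<equiv> poly_ring_on A"
abbreviation I :: "(('a \<Rightarrow>\<^sub>0 nat) \<Rightarrow>\<^sub>0 'f) set" where "I \<equiv> sym_ideal A"
abbreviation S :: "(('a \<Rightarrow>\<^sub>0 nat) \<Rightarrow>\<^sub>0 'f) set ring" where "S \<equiv> sym_alg A"
abbreviation con :: "'f \<Rightarrow> ('a \<Rightarrow>\<^sub>0 nat) \<Rightarrow>\<^sub>0 'f" where "con \<equiv> Poly_Mapping.single 0"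
abbreviation var :: "'a \<Rightarrow> ('a \<Rightarrow>\<^sub>0 nat) \<Rightarrow>\<^sub>0 'f" where "var \<equiv> poly_var"

lemma P_simps: "monoid.mult P = (*)" "one P = 1" "zero P = 0" "add P = (+)"
  by (simp_all add: poly_ring_on_def)

lemma P_add: "p \<in> carrier P \<Longrightarrow> q \<in> carrier P \<Longrightarrow> p + q \<in> carrier P"
  using keys_add[of p q] by (auto simp: poly_ring_on_def)

lemma P_mult: "p \<in> carrier P \<Longrightarrow> q \<in> carrier P \<Longrightarrow> p * q \<in> carrier P"
proof -
  assume pq: "p \<in> carrier P" "q \<in> carrier P"
  have "Poly_Mapping.keys m \<subseteq> A" if "m \<in> Poly_Mapping.keys (p * q)" for m
  proof -
    obtain a b where ab: "m = a + b" "a \<in> Poly_Mapping.keys p" "b \<in> Poly_Mapping.keys q"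
      using keys_mult[of p q] \<open>m \<in> _\<close> by blast
    then have "Poly_Mapping.keys a \<subseteq> A" "Poly_Mapping.keys b \<subseteq> A"
      using pq by (auto simp: poly_ring_on_def)
    then show ?thesis using keys_add[of a b] ab(1) by blast
  qed
  then show "p * q \<in> carrier P" by (simp add: poly_ring_on_def)
qed

lemma P_uminus: "p \<in> carrier P \<Longrightarrow> - p \<in> carrier P"
  by (simp add: poly_ring_on_def)

lemma P_diff: "p \<in> carrier P \<Longrightarrow> q \<in> carrier P \<Longrightarrow> p - q \<in> carrier P"
  using P_add[OF _ P_uminus] by fastforce

lemma P_con: "con c \<in> carrier P" and P_zero: "0 \<in> carrier P" and P_one: "1 \<in> carrier P"
  by (simp_all add: poly_ring_on_def)

lemma P_var: "a \<in> A \<Longrightarrow> var a \<in> carrier P"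
  by (simp add: poly_ring_on_def poly_var_def)

lemma P_sum: "(\<And>x. x \<in> K \<Longrightarrow> f x \<in> carrier P) \<Longrightarrow> sum f K \<in> carrier P"
  by (induction K rule: infinite_finite_induct) (auto simp: P_zero P_add)

lemma P_power: "p \<in> carrier P \<Longrightarrow> p ^ n \<in> carrier P"
  by (induction n) (auto simp: P_one P_mult)

lemma cring_P: "cring P"
proof (rule cringI)
  show "abelian_group P"
    by (rule abelian_groupI)
      (auto simp: P_simps P_add P_zero algebra_simps intro: bexI[OF _ P_uminus])
  show "Group.comm_monoid P"
    by (rule comm_monoidI) (auto simp: P_simps P_mult P_one algebra_simps)
qed (auto simp: P_simps distrib_right)

sublocale P: cring P by (rule cring_P)

lemma P_a_inv: "p \<in> carrier P \<Longrightarrow> \<ominus>\<^bsub>P\<^esub> p = - p"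
  by (rule P.minus_equality) (auto simp: P_simps P_uminus)

definition rels :: "(('a \<Rightarrow>\<^sub>0 nat) \<Rightarrow>\<^sub>0 'f) set" where
  "rels = {var (a + b) - var a - var b | a b. a \<in> A \<and> b \<in> A}"

lemma I_eq: "I = Idl\<^bsub>P\<^esub> rels"
  by (simp add: sym_ideal_def rels_def)

lemma rels_P: "rels \<subseteq> carrier P"
  by (auto simp: rels_def intro!: P_diff P_var A_add)

lemma ideal_I: "ideal I P"
  unfolding I_eq by (rule P.genideal_ideal[OF rels_P])

sublocale I: ideal I P by (rule ideal_I)

lemma I_add: "p \<in> I \<Longrightarrow> q \<in> I \<Longrightarrow> p + q \<in> I"
  using I.a_closed by (simp add: P_simps)

lemma I_mult: "p \<in> I \<Longrightarrow> q \<in> carrier P \<Longrightarrow> q * p \<in> I"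
  using I.I_l_closed by (simp add: P_simps)

lemma I_zero: "0 \<in> I"
  using additive_subgroup.zero_closed[OF I.is_additive_subgroup] by (simp add: P_simps)

lemma I_sum: "(\<And>x. x \<in> K \<Longrightarrow> f x \<in> I) \<Longrightarrow> sum f K \<in> I"
  by (induction K rule: infinite_finite_induct) (auto simp: I_zero I_add)

lemma rels_I: "r \<in> rels \<Longrightarrow> r \<in> I"
  unfolding I_eq using P.genideal_self[OF rels_P] by blast

lemma I_induct:
  assumes "p \<in> I" "\<And>r. r \<in> rels \<Longrightarrow> Q r" "Q 0"
    "\<And>p q. p \<in> carrier P \<Longrightarrow> q \<in> carrier P \<Longrightarrow> Q p \<Longrightarrow> Q q \<Longrightarrow> Q (p + q)"
    "\<And>p q. p \<in> carrier P \<Longrightarrow> q \<in> carrier P \<Longrightarrow> Q p \<Longrightarrow> Q (q * p)"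
  shows "Q p"
proof -
  let ?T = "{p \<in> carrier P. Q p}"
  have neg: "- p \<in> ?T" if "p \<in> ?T" for p
    using that assms(5)[of p "- 1"] P_uminus[OF P_one] P_uminus by simp
  have "ideal ?T P"
  proof (rule idealI[OF P.ring_axioms])
    show "subgroup ?T (add_monoid P)"
      by (rule P.add.subgroupI)
        (use assms neg P_zero P_add in \<open>auto simp: P_simps P_a_inv a_inv_def[symmetric]\<close>)
  qed (use assms P_mult in \<open>auto simp: P_simps mult.commute\<close>)
  moreover have "rels \<subseteq> ?T" using assms(2) rels_P by blast
  ultimately have "I \<subseteq> ?T" unfolding I_eq by (rule P.genideal_minimal)
  then show ?thesis using assms(1) by blast
qed

definition cls :: "(('a \<Rightarrow>\<^sub>0 nat) \<Rightarrow>\<^sub>0 'f) \<Rightarrow> (('a \<Rightarrow>\<^sub>0 nat) \<Rightarrow>\<^sub>0 'f) set" where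
  "cls p = I +>\<^bsub>P\<^esub> p"

lemma cring_S: "cring S"
  unfolding sym_alg_def by (rule I.quotient_is_cring[OF cring_P])

sublocale S: cring S by (rule cring_S)

lemma cls_hom: "cls \<in> ring_hom P S"
  using I.rcos_ring_hom by (simp add: cls_def[abs_def] sym_alg_def)

lemma cls_S: "p \<in> carrier P \<Longrightarrow> cls p \<in> carrier S"
  and cls_mult: "p \<in> carrier P \<Longrightarrow> q \<in> carrier P \<Longrightarrow> cls (p * q) = cls p \<otimes>\<^bsub>S\<^esub> cls q"
  and cls_add: "p \<in> carrier P \<Longrightarrow> q \<in> carrier P \<Longrightarrow> cls (p + q) = cls p \<oplus>\<^bsub>S\<^esub> cls q"
  and cls_one: "cls 1 = \<one>\<^bsub>S\<^esub>"
  using cls_hom by (auto simp: ring_hom_def P_simps)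

lemma cls_surj:
  assumes "x \<in> carrier S"
  obtains p where "p \<in> carrier P" "x = cls p"
  using assms by (auto simp: sym_alg_def FactRing_def A_RCOSETS_def' cls_def)

lemma cls_zero_iff: "p \<in> carrier P \<Longrightarrow> cls p = \<zero>\<^bsub>S\<^esub> \<longleftrightarrow> p \<in> I"
  unfolding cls_def
  using I.a_rcos_const[of p] I.a_rcos_self[of p] by (auto simp: sym_alg_def FactRing_def)

lemma cls_zero: "cls 0 = \<zero>\<^bsub>S\<^esub>"
  by (simp add: cls_zero_iff P_zero I_zero)

lemma cls_uminus: "p \<in> carrier P \<Longrightarrow> cls (- p) = \<ominus>\<^bsub>S\<^esub> cls p"
  using cls_add[of "- p" p] by (intro S.minus_equality[symmetric]) (auto simp: P_uminus cls_S cls_zero)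

lemma cls_diff: "p \<in> carrier P \<Longrightarrow> q \<in> carrier P \<Longrightarrow> cls (p - q) = cls p \<ominus>\<^bsub>S\<^esub> cls q"
  using cls_add[of p "- q"] by (simp add: P_uminus cls_uminus a_minus_def)

lemma cls_eq_iff: "p \<in> carrier P \<Longrightarrow> q \<in> carrier P \<Longrightarrow> cls p = cls q \<longleftrightarrow> p - q \<in> I"
  using cls_zero_iff[of "p - q"] by (simp add: P_diff cls_diff cls_S S.diff_eq_zero_iff)

lemma sym_var_eq: "sym_var A a = cls (var a)"
  and sym_const_eq: "sym_const A c = cls (con c)"
  by (simp_all add: sym_var_def sym_const_def cls_def)

lemma sym_var_S: "a \<in> A \<Longrightarrow> sym_var A a \<in> carrier S"
  and sym_const_S: "sym_const A c \<in> carrier S"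
  by (simp_all add: sym_var_eq sym_const_eq cls_S P_var P_con)

lemma sym_var_add:
  assumes "a \<in> A" "b \<in> A"
  shows "sym_var A (a + b) = sym_var A a \<oplus>\<^bsub>S\<^esub> (sym_var A b :: (('a \<Rightarrow>\<^sub>0 nat) \<Rightarrow>\<^sub>0 'f) set)"
proof -
  have "var (a + b) - (var a + var b) \<in> I" using rels_I assms by (force simp: rels_def algebra_simps)
  then have "cls (var (a + b)) = cls (var a + var b)"
    using assms by (subst cls_eq_iff) (auto intro: P_var P_add A_add)
  then show ?thesis using assms by (simp add: sym_var_eq cls_add P_var)
qed

lemma sym_const_mult: "sym_const A (c * d) = sym_const A c \<otimes>\<^bsub>S\<^esub> (sym_const A d :: (('a \<Rightarrow>\<^sub>0 nat) \<Rightarrow>\<^sub>0 'f) set)"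
  using cls_mult[of "con c" "con d"] by (simp add: sym_const_eq P_con mult_single)

lemma sym_const_add: "sym_const A (c + d) = sym_const A c \<oplus>\<^bsub>S\<^esub> (sym_const A d :: (('a \<Rightarrow>\<^sub>0 nat) \<Rightarrow>\<^sub>0 'f) set)"
  using cls_add[of "con c" "con d"] by (simp add: sym_const_eq P_con single_add)

lemma sym_const_one: "sym_const A 1 = (\<one>\<^bsub>S\<^esub> :: (('a \<Rightarrow>\<^sub>0 nat) \<Rightarrow>\<^sub>0 'f) set)"
  and sym_const_zero: "sym_const A 0 = (\<zero>\<^bsub>S\<^esub> :: (('a \<Rightarrow>\<^sub>0 nat) \<Rightarrow>\<^sub>0 'f) set)"
  by (simp_all add: sym_const_eq cls_one cls_zero)

text \<open>For an additive functional \<open>l\<close> and a vector \<open>v\<close> with \<open>l(v) = 1\<close>, the homomorphism \<open>taylor\<close> sends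
  each vector \<open>x\<close> to \<open>(x - l(x) v) + l(x) T\<close>; it is split by \<open>T \<mapsto> v\<close>.  As it maps \<open>v\<close> to the
  indeterminate, it shows that \<open>v\<close> is not a zero divisor.\<close>

definition taylor ::
  "('a \<Rightarrow> 'f) \<Rightarrow> (('a \<Rightarrow>\<^sub>0 nat) \<Rightarrow>\<^sub>0 'f) \<Rightarrow> (('a \<Rightarrow>\<^sub>0 nat) \<Rightarrow>\<^sub>0 'f) \<Rightarrow> (('a \<Rightarrow>\<^sub>0 nat) \<Rightarrow>\<^sub>0 'f) poly"
  where "taylor l v = pm_eval (\<lambda>c. [:con c:]) (\<lambda>a. [:var a - con (l a) * v, con (l a):])"

lemma taylor_evaluation: "evaluation (\<lambda>c. [:con c:])"
  by unfold_locales (simp_all add: single_add mult_single one_pCons mult.commute)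

lemma taylor_add: "taylor l v (p + q) = taylor l v p + taylor l v q"
  and taylor_mult: "taylor l v (p * q) = taylor l v p * taylor l v q"
  and taylor_diff: "taylor l v (p - q) = taylor l v p - taylor l v q"
  and taylor_zero: "taylor l v 0 = 0"
  and taylor_const: "taylor l v (con c) = [:con c:]"
  and taylor_var: "taylor l v (var a) = [:var a - con (l a) * v, con (l a):]"
  unfolding taylor_def
  by (rule evaluation.eval_add[OF taylor_evaluation] evaluation.eval_mult[OF taylor_evaluation]
      evaluation.eval_diff[OF taylor_evaluation] evaluation.eval_zero[OF taylor_evaluation]
      evaluation.eval_const[OF taylor_evaluation] evaluation.eval_var[OF taylor_evaluation])+

lemma poly_taylor: "poly (taylor l v p) v = p"
proof -
  have "poly (taylor l v p) v = pm_eval con var p"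
    unfolding taylor_def pm_eval_def by (simp add: poly_sum poly_prod)
  then show ?thesis by (simp add: eval_id)
qed

definition coeffs_in :: "'b set \<Rightarrow> 'b::zero poly set" where
  "coeffs_in K = {q. \<forall>i. poly.coeff q i \<in> K}"

lemma coeffs_P_mult: "p \<in> coeffs_in (carrier P) \<Longrightarrow> q \<in> coeffs_in (carrier P) \<Longrightarrow> p * q \<in> coeffs_in (carrier P)"
  by (auto simp: coeffs_in_def coeff_mult intro!: P_sum P_mult)

lemma coeffs_P_sum: "(\<And>x. x \<in> K \<Longrightarrow> f x \<in> coeffs_in (carrier P)) \<Longrightarrow> sum f K \<in> coeffs_in (carrier P)"
  by (auto simp: coeffs_in_def coeff_sum intro!: P_sum)

lemma coeffs_P_pCons: "a \<in> carrier P \<Longrightarrow> q \<in> coeffs_in (carrier P) \<Longrightarrow> pCons a q \<in> coeffs_in (carrier P)"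
  by (auto simp: coeffs_in_def coeff_pCons split: nat.split)

lemma coeffs_P_zero: "0 \<in> coeffs_in (carrier P)"
  by (simp add: coeffs_in_def P_zero)

lemma coeffs_P_prod: "(\<And>x. x \<in> K \<Longrightarrow> f x \<in> coeffs_in (carrier P)) \<Longrightarrow> prod f K \<in> coeffs_in (carrier P)"
  by (induction K rule: infinite_finite_induct)
    (auto simp: one_pCons intro!: coeffs_P_mult coeffs_P_pCons P_one coeffs_P_zero)

lemma coeffs_P_power: "p \<in> coeffs_in (carrier P) \<Longrightarrow> p ^ n \<in> coeffs_in (carrier P)"
  by (induction n) (auto simp: one_pCons intro!: coeffs_P_mult coeffs_P_pCons P_one coeffs_P_zero)

lemma taylor_P:
  assumes "v \<in> carrier P" "p \<in> carrier P"
  shows "taylor l v p \<in> coeffs_in (carrier P)"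
proof -
  have "a \<in> A" if "m \<in> Poly_Mapping.keys p" "a \<in> Poly_Mapping.keys m" for m a
    using assms(2) that by (auto simp: poly_ring_on_def)
  then show ?thesis
    unfolding taylor_def pm_eval_def
    by (intro coeffs_P_sum coeffs_P_mult coeffs_P_prod coeffs_P_power coeffs_P_pCons coeffs_P_zero
        P_con P_diff P_mult P_var assms(1))
qed

text \<open>Additivity of \<open>l\<close> removes the linear coefficient of the image of a relation
  and leaves the relation itself as constant coefficient. Hence \<open>taylor\<close> descends to
  the quotient, coefficient by coefficient.\<close>

lemma taylor_I:
  assumes "v \<in> carrier P" "\<And>a b. a \<in> A \<Longrightarrow> b \<in> A \<Longrightarrow> l (a + b) = l a + l b" "p \<in> I"
  shows "taylor l v p \<in> coeffs_in I"
  using assms(3)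
proof (rule I_induct)
  fix r assume "r \<in> rels"
  then obtain a b where ab: "a \<in> A" "b \<in> A" "r = var (a + b) - var a - var b" by (auto simp: rels_def)
  then have "taylor l v r = [:r:]"
    unfolding ab(3) by (simp add: taylor_diff taylor_var assms(2) single_add) (simp add: algebra_simps)
  then show "taylor l v r \<in> coeffs_in I"
    using rels_I[OF \<open>r \<in> rels\<close>] by (auto simp: coeffs_in_def coeff_pCons I_zero split: nat.split)
next
  fix p q assume p: "p \<in> carrier P" "q \<in> carrier P" and pI: "taylor l v p \<in> coeffs_in I"
  have "taylor l v q \<in> coeffs_in (carrier P)" by (rule taylor_P[OF assms(1) p(2)])
  with pI show "taylor l v (q * p) \<in> coeffs_in I"
    by (auto simp: coeffs_in_def taylor_mult coeff_mult intro!: I_sum I_mult)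
  assume "taylor l v q \<in> coeffs_in I"
  with pI show "taylor l v (p + q) \<in> coeffs_in I" by (auto simp: coeffs_in_def taylor_add I_add)
qed (auto simp: taylor_zero coeffs_in_def I_zero)

text \<open>Represents a vector of the F-space that need not come from the lattice. Such vectors
  arise as projections of one lattice vector along another in
  \<open>sym_var_coprime\<close>.\<close>

definition lvec :: "'f \<Rightarrow> 'a \<Rightarrow> 'a \<Rightarrow> ('a \<Rightarrow>\<^sub>0 nat) \<Rightarrow>\<^sub>0 'f" where
  "lvec c a b = var a - con c * var b"

lemma lvec_P: "a \<in> A \<Longrightarrow> b \<in> A \<Longrightarrow> lvec c a b \<in> carrier P"
  by (simp add: lvec_def P_diff P_mult P_con P_var)

lemma taylor_lvec:
  assumes "l a - c * l b = 1"
  shows "taylor l (lvec c a b) (lvec c a b) = [:0, 1:]"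
proof -
  let ?v = "lvec c a b"
  have c: "con (l a) - con c * con (l b) = 1"
    using assms by (simp add: mult_single flip: single_diff single_one)
  have "var a - con (l a) * ?v - con c * (var b - con (l b) * ?v)
      = ?v - (con (l a) - con c * con (l b)) * ?v"
    by (simp add: lvec_def algebra_simps)
  then show ?thesis
    using c
    by (subst (2) lvec_def) (simp add: taylor_diff taylor_mult taylor_const taylor_var mult.commute)
qed

lemma lvec_regular:
  assumes "a \<in> A" "b \<in> A" "\<And>a b. a \<in> A \<Longrightarrow> b \<in> A \<Longrightarrow> l (a + b) = l a + l b" "l a - c * l b = 1"
    and "p \<in> carrier P" "lvec c a b * p \<in> I"
  shows "p \<in> I"
proof -
  let ?v = "lvec c a b"
  have v: "?v \<in> carrier P" using assms lvec_P by blast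
  have "taylor l ?v (?v * p) = pCons 0 (taylor l ?v p)"
    by (simp add: taylor_mult taylor_lvec[OF assms(4)])
  then have "pCons 0 (taylor l ?v p) \<in> coeffs_in I"
    using taylor_I[OF v assms(3,6)] by simp
  \<comment> \<open>These are the coefficients of the expansion of \<open>p\<close>, shifted by one
    degree; evaluating the expansion at the vector recovers \<open>p\<close>.\<close>
  then have "poly.coeff (pCons 0 (taylor l ?v p)) (Suc i) \<in> I" for i
    unfolding coeffs_in_def by blast
  then have "poly (taylor l ?v p) ?v \<in> I"
    unfolding poly_altdef by (intro I_sum) (subst mult.commute, auto intro: I_mult P_power v)
  then show ?thesis by (simp add: poly_taylor)
qed

lemma taylor_split:
  assumes "v \<in> carrier P" "p \<in> carrier P"
  obtains q where "q \<in> carrier P" "p = poly.coeff (taylor l v p) 0 + v * q"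
proof -
  obtain a r where ar: "taylor l v p = pCons a r" by (cases "taylor l v p") auto
  have "poly.coeff r i \<in> carrier P" for i
    using taylor_P[OF assms, of l] unfolding ar coeffs_in_def by (auto dest: spec[of _ "Suc i"])
  then have "poly r v \<in> carrier P"
    unfolding poly_altdef by (auto intro!: P_sum P_mult P_power assms)
  moreover have "p = a + v * poly r v" using poly_taylor[of l v p] by (simp add: ar)
  moreover have "poly.coeff (taylor l v p) 0 = a" by (simp add: ar)
  ultimately show thesis using that by metis
qed

lemma sym_var_regular:
  assumes "a \<in> A" "\<And>a b. a \<in> A \<Longrightarrow> b \<in> A \<Longrightarrow> l (a + b) = l a + l b" "l a = (1::'f)"
    and "x \<in> carrier S" "sym_var A a \<otimes>\<^bsub>S\<^esub> x = \<zero>\<^bsub>S\<^esub>"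
  shows "x = \<zero>\<^bsub>S\<^esub>"
proof -
  obtain p where p: "p \<in> carrier P" "x = cls p" using cls_surj assms(4) by blast
  \<comment> \<open>With coefficient 0 the vector \<open>lvec 0 a a\<close> is \<open>var a\<close>
    itself.\<close>
  have "cls (lvec 0 a a * p) = \<zero>\<^bsub>S\<^esub>"
    using assms p by (simp add: lvec_def cls_mult P_var sym_var_eq)
  then have "lvec 0 a a * p \<in> I" using cls_zero_iff[of "lvec 0 a a * p"] p assms by (simp add: lvec_P P_mult)
  then have "p \<in> I" using lvec_regular[of a a l 0 p] assms p by simp
  then show ?thesis using p by (simp add: cls_zero_iff)
qed

text \<open>Reduction modulo \<open>a\<close> is the constant coefficient of \<open>taylor\<close>:
  it kills \<open>a\<close> and sends \<open>b\<close> to b - l(b) a. The functional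
  \<open>m\<close> shows this vector to be nonzero, so it is regular, and the reduction of
  \<open>x\<close> must vanish; \<open>x\<close> is then a multiple of \<open>a\<close> by
  \<open>taylor_split\<close>.\<close>

lemma sym_var_coprime:
  assumes "a \<in> A" "b \<in> A"
    and l: "\<And>a b. a \<in> A \<Longrightarrow> b \<in> A \<Longrightarrow> l (a + b) = l a + l b" "l a = (1::'f)"
    and m: "\<And>a b. a \<in> A \<Longrightarrow> b \<in> A \<Longrightarrow> m (a + b) = m a + m b" "m b \<noteq> l b * m a"
    and xy: "x \<in> carrier S" "y \<in> carrier S" "sym_var A b \<otimes>\<^bsub>S\<^esub> x = sym_var A a \<otimes>\<^bsub>S\<^esub> y"
  shows "\<exists>z\<in>carrier S. x = sym_var A a \<otimes>\<^bsub>S\<^esub> z"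
proof -
  obtain p where p: "p \<in> carrier P" "x = cls p" using cls_surj xy by blast
  obtain q where q: "q \<in> carrier P" "y = cls q" using cls_surj xy by blast
  let ?t = "taylor l (var a)"
  let ?c = "l b"
  have P: "var a \<in> carrier P" "var b \<in> carrier P" using assms by (auto intro: P_var)
  have "cls (var b * p) = cls (var a * q)" using xy p q P by (simp add: sym_var_eq cls_mult)
  then have "var b * p - var a * q \<in> I" using cls_eq_iff p q P by (simp add: P_mult)
  from taylor_I[OF P(1) l(1) this] have "poly.coeff (?t (var b * p - var a * q)) 0 \<in> I"
    by (auto simp: coeffs_in_def)
  moreover have "?t (var a) = [:0, 1:]" using l(2) by (simp add: taylor_var)
  ultimately have "lvec ?c b a * poly.coeff (?t p) 0 \<in> I"
    by (simp add: taylor_diff taylor_mult taylor_var coeff_mult lvec_def)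
  \<comment> \<open>The value of \<open>m\<close> on b - l(b) a; dividing \<open>m\<close> by it
    yields the functional of value 1 that \<open>lvec_regular\<close> asks for.\<close>
  moreover define d where "d = m b - ?c * m a"
  have "d \<noteq> 0" using m(2) by (simp add: d_def)
  have "m b / d - ?c * (m a / d) = (m b - ?c * m a) / d" by (simp add: diff_divide_distrib)
  then have "m b / d - ?c * (m a / d) = 1" using \<open>d \<noteq> 0\<close> by (simp add: d_def)
  moreover have "poly.coeff (?t p) 0 \<in> carrier P"
    using taylor_P[OF P(1) p(1)] by (auto simp: coeffs_in_def)
  ultimately have pI: "poly.coeff (?t p) 0 \<in> I"
    using lvec_regular[of b a "\<lambda>x. m x / d" ?c "poly.coeff (?t p) 0"] assms
    by (simp add: add_divide_distrib)
  obtain r where r: "r \<in> carrier P" "p = poly.coeff (?t p) 0 + var a * r"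
    using taylor_split[OF P(1) p(1)] by blast
  then have "p - var a * r \<in> I" using pI by (metis add_diff_cancel_right')
  then have "cls p = cls (var a * r)" using p r P by (subst cls_eq_iff) (auto simp: P_mult)
  then show ?thesis using p r P by (intro bexI[of _ "cls r"]) (auto simp: sym_var_eq cls_mult cls_S)
qed

lemma sym_var_zero: "sym_var A 0 = (\<zero>\<^bsub>S\<^esub> :: (('a \<Rightarrow>\<^sub>0 nat) \<Rightarrow>\<^sub>0 'f) set)"
  using sym_var_add[of 0 0] by (simp add: A_zero sym_var_S S.add.l_cancel_one)

lemma sym_var_uminus:
  "a \<in> A \<Longrightarrow> sym_var A (- a) = \<ominus>\<^bsub>S\<^esub> (sym_var A a :: (('a \<Rightarrow>\<^sub>0 nat) \<Rightarrow>\<^sub>0 'f) set)"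
  using sym_var_add[of "- a" a]
  by (intro S.minus_equality[symmetric]) (auto simp: A_uminus sym_var_S sym_var_zero)

end

section \<open>Labels: cancellation, divisibility and proportionality\<close>

locale labelled_root_system = irreducible_root_system R B
  for R B :: "'v::rat_vector set" and F :: "'f::field itself" +
  assumes char: "CHAR('f) \<noteq> 2"
begin

abbreviation X where "X \<equiv> aff_weights R"
abbreviation S :: "('v, 'f) sym ring" where "S \<equiv> aff_sym R"
abbreviation lab :: "'v \<times> rat \<Rightarrow> ('v, 'f) sym" where "lab \<equiv> bar R"
abbreviation cst :: "'f \<Rightarrow> ('v, 'f) sym" where "cst \<equiv> sym_const X"
abbreviation prp :: "('v, 'f) sym \<Rightarrow> ('v, 'f) sym \<Rightarrow> bool" where "prp \<equiv> proportional R"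

lemma X_iff: "\<beta> \<in> X \<longleftrightarrow> (\<forall>a\<in>R. coroot R a (fst \<beta>) \<in> \<int>) \<and> snd \<beta> \<in> \<int>"
  by (cases \<beta>) (auto simp: aff_weights_def weight_lattice_def)

lemma root_X: "\<gamma> \<in> \<Phi> \<Longrightarrow> \<gamma> \<in> X"
  by (auto simp: X_iff aff_root_iff coroot_Ints)

sublocale SA: symmetric_algebra X F
  by unfold_locales (auto simp: X_iff coroot_simps)

sublocale S: cring S
  unfolding aff_sym_def by (rule SA.cring_S)

lemma lab_S: "\<beta> \<in> X \<Longrightarrow> lab \<beta> \<in> carrier S"
  by (simp add: aff_sym_def bar_def SA.sym_var_S)

lemma lab_root_S: "\<gamma> \<in> \<Phi> \<Longrightarrow> lab \<gamma> \<in> carrier S"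
  by (simp add: lab_S root_X)

lemma lab_add: "\<beta> \<in> X \<Longrightarrow> \<gamma> \<in> X \<Longrightarrow> lab (\<beta> + \<gamma>) = lab \<beta> \<oplus>\<^bsub>S\<^esub> lab \<gamma>"
  by (simp add: aff_sym_def bar_def SA.sym_var_add)

lemma lab_neg: "\<beta> \<in> X \<Longrightarrow> lab (- \<beta>) = \<ominus>\<^bsub>S\<^esub> lab \<beta>"
  by (simp add: aff_sym_def bar_def SA.sym_var_uminus)

lemma lab_zero: "lab 0 = \<zero>\<^bsub>S\<^esub>"
  by (simp add: aff_sym_def bar_def SA.sym_var_zero)

lemma cst_S: "cst c \<in> carrier S"
  by (simp add: aff_sym_def SA.sym_const_S)

lemma cst_mult: "cst (c * d) = cst c \<otimes>\<^bsub>S\<^esub> cst d"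
  and cst_add: "cst (c + d) = cst c \<oplus>\<^bsub>S\<^esub> cst d"
  and cst_one: "cst 1 = \<one>\<^bsub>S\<^esub>"
  and cst_zero: "cst 0 = \<zero>\<^bsub>S\<^esub>"
  by (simp_all add: aff_sym_def SA.sym_const_mult SA.sym_const_add SA.sym_const_one SA.sym_const_zero)

lemma cst_uminus: "cst (- c) = \<ominus>\<^bsub>S\<^esub> cst c"
  using cst_add[of "- c" c] by (intro S.minus_equality[symmetric]) (auto simp: cst_S cst_zero)

definition zmult :: "int \<Rightarrow> 'v \<times> rat \<Rightarrow> 'v \<times> rat" where
  "zmult k \<beta> = (of_int k *\<^sub>Q fst \<beta>, of_int k * snd \<beta>)"

lemma zmult_X: "\<beta> \<in> X \<Longrightarrow> zmult k \<beta> \<in> X"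
  by (auto simp: X_iff zmult_def coroot_simps)

lemma lab_zmult: "\<beta> \<in> X \<Longrightarrow> lab (zmult k \<beta>) = cst (of_int k) \<otimes>\<^bsub>S\<^esub> lab \<beta>"
proof (induction k rule: int_induct[of _ 0])
  case base
  then show ?case by (simp add: zmult_def lab_zero cst_zero lab_S flip: zero_prod_def)
next
  case (step1 i)
  have "zmult (i + 1) \<beta> = zmult i \<beta> + \<beta>"
    by (simp add: zmult_def prod_eq_iff scaleQ_add_left scaleQ_one algebra_simps)
  with step1 show ?case
    by (simp add: lab_add zmult_X lab_S cst_add cst_one cst_S S.l_distr)
next
  case (step2 i)
  have "zmult (i - 1) \<beta> = zmult i \<beta> + - \<beta>"
    by (simp add: zmult_def prod_eq_iff rat_vec.scale_left_diff_distrib scaleQ_one algebra_simps)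
  moreover have "(of_int (i - 1) :: 'f) = of_int i + - 1" by simp
  ultimately show ?case
    using step2 SA.A_uminus
    by (simp only: lab_add zmult_X lab_neg lab_S cst_add cst_one cst_S cst_uminus S.l_distr S.a_inv_closed
        S.l_minus S.l_one S.one_closed)
qed

lemma two_ne_zero: "(2::'f) \<noteq> 0"
proof
  assume "(2::'f) = 0"
  then have "of_nat 2 = (0::'f)" by simp
  then have "CHAR('f) dvd 2" by (simp only: of_nat_eq_0_iff_char_dvd)
  moreover have "CHAR('f) \<noteq> 1" by simp
  ultimately show False using char by (metis prime_nat_iff two_is_prime_nat)
qed

definition half :: "('v, 'f) sym" where
  "half = cst (1 / 2)"

lemma half_S: "half \<in> carrier S"
  by (simp add: half_def cst_S)

lemma half_half: "half \<oplus>\<^bsub>S\<^esub> half = \<one>\<^bsub>S\<^esub>"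
  using two_ne_zero by (simp add: half_def flip: cst_add cst_one)

text \<open>On the weight lattice the pairing is an integer, and the floor merely carries it into
  the field. Since 2 is invertible there, half of it is a functional with value 1 on
  \<gamma>.\<close>

definition pairF :: "'v \<times> rat \<Rightarrow> 'v \<times> rat \<Rightarrow> 'f" where
  "pairF \<gamma> \<beta> = of_int \<lfloor>coroot R (fst \<gamma>) (fst \<beta>)\<rfloor>"

lemma floor_add_Ints: "x \<in> \<int> \<Longrightarrow> y \<in> \<int> \<Longrightarrow> \<lfloor>x + y\<rfloor> = \<lfloor>x\<rfloor> + \<lfloor>y\<rfloor>" for x y :: rat
  by (auto elim!: Ints_cases simp flip: of_int_add)

lemma pairF_add: "\<gamma> \<in> \<Phi> \<Longrightarrow> \<beta> \<in> X \<Longrightarrow> \<beta>' \<in> X \<Longrightarrow> pairF \<gamma> (\<beta> + \<beta>') = pairF \<gamma> \<beta> + pairF \<gamma> \<beta>'"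
  by (simp add: pairF_def coroot_simps aff_root_fst X_iff floor_add_Ints)

lemma pairF_self: "\<gamma> \<in> \<Phi> \<Longrightarrow> pairF \<gamma> \<gamma> / 2 = 1"
  using two_ne_zero by (simp add: pairF_def coroot_simps aff_root_fst)

lemma lab_regular:
  assumes "\<gamma> \<in> \<Phi>" "x \<in> carrier S" "lab \<gamma> \<otimes>\<^bsub>S\<^esub> x = \<zero>\<^bsub>S\<^esub>"
  shows "x = \<zero>\<^bsub>S\<^esub>"
  using SA.sym_var_regular[of \<gamma> "\<lambda>\<beta>. pairF \<gamma> \<beta> / 2" x] assms
  by (simp add: pairF_add pairF_self root_X aff_sym_def bar_def add_divide_distrib)

text \<open>A vector of the lattice all of whose coroot pairings vanish in the field is divisible, within
  the lattice, by the characteristic.\<close>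

lemma lab_eq_zero:
  assumes "\<beta> \<in> X" "\<And>a. a \<in> R \<Longrightarrow> of_int \<lfloor>coroot R a (fst \<beta>)\<rfloor> = (0::'f)" "of_int \<lfloor>snd \<beta>\<rfloor> = (0::'f)"
  shows "lab \<beta> = \<zero>\<^bsub>S\<^esub>"
proof -
  let ?p = "int CHAR('f)"
  have dv: "?p dvd \<lfloor>coroot R a (fst \<beta>)\<rfloor>" if "a \<in> R" for a
    using assms(2)[OF that] by (simp add: of_int_eq_0_iff_char_dvd)
  have ds: "?p dvd \<lfloor>snd \<beta>\<rfloor>" using assms(3) by (simp add: of_int_eq_0_iff_char_dvd)
  have fl: "coroot R a (fst \<beta>) = of_int \<lfloor>coroot R a (fst \<beta>)\<rfloor>" if "a \<in> R" for a
    using assms(1) that by (auto simp: X_iff dest!: bspec elim!: Ints_cases)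
  have fs: "snd \<beta> = of_int \<lfloor>snd \<beta>\<rfloor>"
    using assms(1) by (auto simp: X_iff elim!: Ints_cases)
  show ?thesis
  proof (cases "CHAR('f) = 0")
    case True
    then have "fst \<beta> = 0" "snd \<beta> = 0"
      using dv ds fl fs by (auto intro!: coroots_separate)
    then have "\<beta> = 0" by (simp add: prod_eq_iff)
    then show ?thesis by (simp add: lab_zero)
  next
    case False
    define \<beta>' where "\<beta>' = ((1 / of_int ?p) *\<^sub>Q fst \<beta>, snd \<beta> / of_int ?p)"
    have div_Ints: "x / of_int ?p \<in> \<int>" if "x = of_int i" "?p dvd i" for x :: rat and i
    proof -
      from that(2) obtain j where "i = ?p * j" by (auto elim: dvdE)
      then have "x / of_int ?p = of_int j" using that(1) False by simp
      then show ?thesis by simp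
    qed
    have "\<beta>' \<in> X"
      using div_Ints[OF fl dv] div_Ints[OF fs ds] by (simp add: X_iff \<beta>'_def coroot_simps)
    moreover have "\<beta> = zmult ?p \<beta>'"
      using False by (simp add: zmult_def \<beta>'_def prod_eq_iff scaleQ_scaleQ scaleQ_one)
    ultimately have "lab \<beta> = cst (of_int ?p) \<otimes>\<^bsub>S\<^esub> lab \<beta>'" using lab_zmult by metis
    then show ?thesis using \<open>\<beta>' \<in> X\<close> by (simp add: cst_zero lab_S)
  qed
qed

text \<open>By \<open>sym_var_coprime\<close> it suffices that some functional tells \<delta> from
  l(\<delta>) \<gamma>. The candidates are the coroot pairings and the second component. If all of
  them fail, a lattice vector lying over twice the difference has label zero, and the two labels are
  proportional.\<close>

lemma lab_coprime:
  assumes "\<gamma> \<in> \<Phi>" "\<delta> \<in> \<Phi>" "\<not> prp (lab \<delta>) (lab \<gamma>)"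
    and "x \<in> carrier S" "y \<in> carrier S" "lab \<delta> \<otimes>\<^bsub>S\<^esub> x = lab \<gamma> \<otimes>\<^bsub>S\<^esub> y"
  shows "\<exists>z\<in>carrier S. x = lab \<gamma> \<otimes>\<^bsub>S\<^esub> z"
proof -
  let ?l = "\<lambda>\<beta>. pairF \<gamma> \<beta> / 2"
  have l: "?l (a + b) = ?l a + ?l b" if "a \<in> X" "b \<in> X" for a b
    using assms that by (simp add: pairF_add add_divide_distrib)
  have main: ?thesis if "\<And>a b. a \<in> X \<Longrightarrow> b \<in> X \<Longrightarrow> m (a + b) = m a + m b" "m \<delta> \<noteq> ?l \<delta> * m \<gamma>" for m
    using SA.sym_var_coprime[of \<gamma> \<delta> ?l m x y] l that assms
    by (simp add: root_X pairF_self aff_sym_def bar_def)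
  obtain k where k: "coroot R (fst \<gamma>) (fst \<delta>) = of_int k"
    using coroot_Ints assms aff_root_fst by (metis Ints_cases)
  show ?thesis
  proof (rule ccontr)
    assume neg: "\<not> ?thesis"
    \<comment> \<open>Here l(\<delta>) is the image of k/2 in the field; doubling clears the
      denominator, so that the difference lies in the lattice.\<close>
    define \<beta> where "\<beta> = \<delta> + \<delta> + zmult (- k) \<gamma>"
    have bX: "\<beta> \<in> X" using assms SA.A_add zmult_X root_X by (simp add: \<beta>_def)
    have lk: "?l \<delta> * 2 = of_int k" using two_ne_zero by (simp add: pairF_def k)
    have c0: "of_int \<lfloor>coroot R a (fst \<beta>)\<rfloor> = (0::'f)" if a: "a \<in> R" for a
    proof -
      have aX: "(a, 0) \<in> \<Phi>" using a by (simp add: aff_roots_def)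
      obtain i j where ij: "coroot R a (fst \<delta>) = of_int i" "coroot R a (fst \<gamma>) = of_int j"
        using coroot_Ints a assms aff_root_fst by (metis Ints_cases)
      have "pairF (a, 0) \<delta> = ?l \<delta> * pairF (a, 0) \<gamma>"
        using main[of "pairF (a, 0)"] pairF_add[OF aX] neg by blast
      then have "of_int i * 2 = (?l \<delta> * 2) * (of_int j :: 'f)"
        by (simp add: pairF_def ij)
      then have eq: "of_int i * 2 = (of_int k * of_int j :: 'f)" unfolding lk .
      have "coroot R a (fst \<beta>) = of_int (i * 2 - k * j)"
        using a by (simp add: \<beta>_def zmult_def coroot_simps ij)
      then have "\<lfloor>coroot R a (fst \<beta>)\<rfloor> = i * 2 - k * j" by (simp only: floor_of_int)
      then show ?thesis using eq by simp
    qed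
    have s0: "of_int \<lfloor>snd \<beta>\<rfloor> = (0::'f)"
    proof -
      let ?m = "\<lambda>\<beta>. of_int \<lfloor>snd \<beta>\<rfloor> :: 'f"
      obtain i j where ij: "snd \<delta> = of_int i" "snd \<gamma> = of_int j"
        using assms aff_root_iff by (metis Ints_cases)
      have "?m \<delta> = ?l \<delta> * ?m \<gamma>"
        using main[of ?m] neg by (fastforce simp: X_iff floor_add_Ints)
      then have "of_int i * 2 = (?l \<delta> * 2) * (of_int j :: 'f)" by (simp add: ij)
      then have eq: "of_int i * 2 = (of_int k * of_int j :: 'f)" unfolding lk .
      have "snd \<beta> = of_int (i * 2 - k * j)" by (simp add: \<beta>_def zmult_def ij)
      then have "\<lfloor>snd \<beta>\<rfloor> = i * 2 - k * j" by (simp only: floor_of_int)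
      then show ?thesis using eq by simp
    qed
    have "lab \<beta> = \<zero>\<^bsub>S\<^esub>" using lab_eq_zero[OF bX c0 s0] .
    moreover have "\<delta> + \<delta> = \<beta> + zmult k \<gamma>" by (simp add: \<beta>_def zmult_def prod_eq_iff)
    ultimately have "lab \<delta> \<oplus>\<^bsub>S\<^esub> lab \<delta> = cst (of_int k) \<otimes>\<^bsub>S\<^esub> lab \<gamma>"
      using assms bX lab_add[of \<delta> \<delta>] lab_add[of \<beta> "zmult k \<gamma>"]
      by (simp add: root_X zmult_X lab_zmult lab_S cst_S)
    then have "half \<otimes>\<^bsub>S\<^esub> (lab \<delta> \<oplus>\<^bsub>S\<^esub> lab \<delta>) = cst (of_int k / 2) \<otimes>\<^bsub>S\<^esub> lab \<gamma>"
      using cst_mult[of "1/2" "of_int k"] assms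
      by (simp add: half_def cst_S lab_root_S S.m_assoc)
    moreover have "half \<otimes>\<^bsub>S\<^esub> (lab \<delta> \<oplus>\<^bsub>S\<^esub> lab \<delta>) = (half \<oplus>\<^bsub>S\<^esub> half) \<otimes>\<^bsub>S\<^esub> lab \<delta>"
      using assms half_S by (simp add: S.l_distr S.r_distr lab_root_S)
    ultimately have "lab \<delta> = cst (of_int k / 2) \<otimes>\<^bsub>S\<^esub> lab \<gamma>"
      using half_half assms by (simp add: lab_root_S)
    then show False using assms(3) by (auto simp: proportional_def)
  qed
qed

lemma prp_sym: "prp (lab \<gamma>) (lab \<delta>) \<longleftrightarrow> prp (lab \<delta>) (lab \<gamma>)"
  by (auto simp: proportional_def)

lemma prp_zero: "\<gamma> \<in> \<Phi> \<Longrightarrow> lab \<gamma> = \<zero>\<^bsub>S\<^esub> \<Longrightarrow> \<delta> \<in> \<Phi> \<Longrightarrow> prp (lab \<gamma>) (lab \<delta>)"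
  unfolding proportional_def by (intro exI[of _ 0]) (simp add: cst_zero lab_root_S)

lemma cst_invert:
  assumes "c \<noteq> 0" "x \<in> carrier S" "y \<in> carrier S" "y = cst c \<otimes>\<^bsub>S\<^esub> x"
  shows "x = cst (1 / c) \<otimes>\<^bsub>S\<^esub> y"
proof -
  have "cst (1 / c) \<otimes>\<^bsub>S\<^esub> cst c = \<one>\<^bsub>S\<^esub>"
    using assms(1) by (simp add: cst_one flip: cst_mult)
  then show ?thesis using assms by (simp add: cst_S flip: S.m_assoc)
qed

lemma prp_nonzero_unit:
  assumes "\<gamma> \<in> \<Phi>" "\<epsilon> \<in> \<Phi>" "prp (lab \<gamma>) (lab \<epsilon>)" "lab \<gamma> \<noteq> \<zero>\<^bsub>S\<^esub>"
  shows "\<exists>c. lab \<epsilon> = cst c \<otimes>\<^bsub>S\<^esub> lab \<gamma>"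
proof -
  obtain c where "lab \<gamma> = cst c \<otimes>\<^bsub>S\<^esub> lab \<epsilon> \<or> lab \<epsilon> = cst c \<otimes>\<^bsub>S\<^esub> lab \<gamma>"
    using assms(3) unfolding proportional_def by (rule exE)
  then show ?thesis
  proof
    assume eq: "lab \<gamma> = cst c \<otimes>\<^bsub>S\<^esub> lab \<epsilon>"
    have "c \<noteq> 0"
    proof
      assume "c = 0"
      from eq[unfolded this] show False using assms(4) by (simp add: cst_zero lab_root_S assms(2))
    qed
    from cst_invert[OF this lab_root_S[OF assms(2)] lab_root_S[OF assms(1)] eq] show ?thesis ..
  qed (rule exI)
qed

text \<open>A zero label would be proportional to everything, so the middle label must be nonzero.
  If it vanished, regularity of root labels would make \<open>lab \<gamma>\<close> vanish as well,
  which is one of the trivial cases.\<close>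

lemma prp_trans:
  assumes "\<gamma> \<in> \<Phi>" "\<delta> \<in> \<Phi>" "\<epsilon> \<in> \<Phi>" "prp (lab \<gamma>) (lab \<epsilon>)" "prp (lab \<delta>) (lab \<epsilon>)"
  shows "prp (lab \<gamma>) (lab \<delta>)"
proof -
  consider "lab \<gamma> = \<zero>\<^bsub>S\<^esub>" | "lab \<delta> = \<zero>\<^bsub>S\<^esub>"
    | "lab \<gamma> \<noteq> \<zero>\<^bsub>S\<^esub>" "lab \<delta> \<noteq> \<zero>\<^bsub>S\<^esub>" by argo
  then show ?thesis
  proof cases
    case 1
    show ?thesis by (rule prp_zero[OF assms(1) 1 assms(2)])
  next
    case 2
    show ?thesis by (rule prp_sym[THEN iffD1, OF prp_zero[OF assms(2) 2 assms(1)]])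
  next
    case 3
    obtain c where c: "lab \<epsilon> = cst c \<otimes>\<^bsub>S\<^esub> lab \<gamma>"
      using prp_nonzero_unit[OF assms(1,3,4) 3(1)] by (rule exE)
    obtain d where d: "lab \<epsilon> = cst d \<otimes>\<^bsub>S\<^esub> lab \<delta>"
      using prp_nonzero_unit[OF assms(2,3,5) 3(2)] by (rule exE)
    have e: "lab \<epsilon> \<noteq> \<zero>\<^bsub>S\<^esub>"
    proof
      assume "lab \<epsilon> = \<zero>\<^bsub>S\<^esub>"
      then have "lab \<epsilon> \<otimes>\<^bsub>S\<^esub> lab \<gamma> = \<zero>\<^bsub>S\<^esub>" using lab_root_S[OF assms(1)] by simp
      from lab_regular[OF assms(3) lab_root_S[OF assms(1)] this] show False using 3(1) by (rule notE[rotated])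
    qed
    have "d \<noteq> 0"
    proof
      assume "d = 0"
      from d[unfolded this] show False using e by (simp add: cst_zero lab_root_S assms(2))
    qed
    from cst_invert[OF this lab_root_S[OF assms(2)] lab_root_S[OF assms(3)] d]
    have "lab \<delta> = cst (1 / d) \<otimes>\<^bsub>S\<^esub> (cst c \<otimes>\<^bsub>S\<^esub> lab \<gamma>)" unfolding c .
    also have "\<dots> = cst (1 / d * c) \<otimes>\<^bsub>S\<^esub> lab \<gamma>"
      unfolding cst_mult[of "1 / d" c] by (rule S.m_assoc[symmetric]) (simp_all add: cst_S lab_root_S assms(1))
    finally show ?thesis unfolding proportional_def by (intro exI[of _ "1 / d * c"] disjI2)
  qed
qed

lemma prp_neg:
  assumes "\<gamma> \<in> \<Phi>" "\<delta> \<in> \<Phi>" "prp (lab (- \<gamma>)) (lab \<delta>)"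
  shows "prp (lab \<gamma>) (lab \<delta>)"
proof -
  have "lab (- \<gamma>) = cst (- 1) \<otimes>\<^bsub>S\<^esub> lab \<gamma>"
    using assms by (simp add: lab_neg root_X cst_uminus cst_one lab_root_S S.l_minus)
  then have "prp (lab \<gamma>) (lab (- \<gamma>))" unfolding proportional_def by blast
  then show ?thesis
    using prp_trans[OF assms(1,2) neg_aff_root[OF assms(1)] _ prp_sym[THEN iffD1, OF assms(3)]]
    by blast
qed

text \<open>The difference of a weight and its reflection is an integral multiple of \<gamma>. This
  congruence is what makes the weights x(\<alpha>) compatible along edges.\<close>

lemma lab_lin_refl:
  assumes "\<gamma> \<in> \<Phi>" "\<beta> \<in> X"
  shows "\<exists>e\<in>carrier S. lab \<beta> = lab (lin_refl R \<gamma> \<beta>) \<oplus>\<^bsub>S\<^esub> lab \<gamma> \<otimes>\<^bsub>S\<^esub> e"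
proof -
  obtain k where k: "coroot R (fst \<gamma>) (fst \<beta>) = of_int k"
    using assms X_iff aff_root_fst by (metis Ints_cases)
  have "\<beta> = lin_refl R \<gamma> \<beta> + zmult k \<gamma>"
    by (simp add: lin_refl_def zmult_def k prod_eq_iff)
  then have "lab \<beta> = lab (lin_refl R \<gamma> \<beta>) \<oplus>\<^bsub>S\<^esub> lab (zmult k \<gamma>)"
    using lab_add[of "lin_refl R \<gamma> \<beta>" "zmult k \<gamma>"] assms by (simp add: lin_refl_weight zmult_X root_X)
  then show ?thesis
    using assms by (intro bexI[of _ "cst (of_int k)"])
      (auto simp: lab_zmult root_X cst_S lab_root_S S.m_comm)
qed

end

section \<open>Sheaves on the moment graph\<close>

lemma module_ring_module:
  assumes "cring S"
  shows "Module.module S (ring_module S)"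
proof -
  interpret cring S by fact
  have ab: "abelian_group (ring_module S)"
  proof (rule abelian_groupI)
    fix x assume "x \<in> carrier (ring_module S)"
    then show "\<exists>y\<in>carrier (ring_module S). y \<oplus>\<^bsub>ring_module S\<^esub> x = \<zero>\<^bsub>ring_module S\<^esub>"
      by (intro bexI[of _ "\<ominus>\<^bsub>S\<^esub> x"]) (auto simp: ring_module_def l_neg)
  qed (auto simp: ring_module_def a_ac)
  show ?thesis
    by (rule moduleI[OF assms ab]) (auto simp: ring_module_def l_distr r_distr m_assoc)
qed

lemma module_zero_module: "cring S \<Longrightarrow> Module.module S (zero_module z)"
  by (rule moduleI) (auto simp: zero_module_def intro!: abelian_groupI)

lemma module_prod_module:
  assumes "cring S" "\<And>i. i \<in> I \<Longrightarrow> Module.module S (M i)"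
  shows "Module.module S (prod_module I M)"
proof (rule moduleI[OF assms(1)])
  have ab: "abelian_group (M i)" if "i \<in> I" for i
    using assms(2)[OF that] by (rule module.axioms)
  have am: "abelian_monoid (M i)" if "i \<in> I" for i
    using ab[OF that] by (rule abelian_group.axioms)
  note am_simps = abelian_monoid.a_closed[OF am] abelian_monoid.zero_closed[OF am]
    abelian_monoid.a_assoc[OF am] abelian_monoid.l_zero[OF am]
  show "abelian_group (prod_module I M)"
  proof (rule abelian_groupI)
    fix f assume "f \<in> carrier (prod_module I M)"
    then show "\<exists>g\<in>carrier (prod_module I M). g \<oplus>\<^bsub>prod_module I M\<^esub> f = \<zero>\<^bsub>prod_module I M\<^esub>"
      by (intro bexI[of _ "\<lambda>i\<in>I. \<ominus>\<^bsub>M i\<^esub> f i"])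
        (auto simp: prod_module_def PiE_iff abelian_group.l_neg[OF ab] abelian_group.a_inv_closed[OF ab]
          intro!: restrict_ext)
  next
    fix f g assume "f \<in> carrier (prod_module I M)" "g \<in> carrier (prod_module I M)"
    then show "f \<oplus>\<^bsub>prod_module I M\<^esub> g = g \<oplus>\<^bsub>prod_module I M\<^esub> f"
      by (auto simp: prod_module_def PiE_iff intro!: restrict_ext abelian_monoid.a_comm[OF am])
  next
    fix f assume "f \<in> carrier (prod_module I M)"
    then show "\<zero>\<^bsub>prod_module I M\<^esub> \<oplus>\<^bsub>prod_module I M\<^esub> f = f"
      by (auto simp: prod_module_def PiE_iff am_simps fun_eq_iff extensional_def)
  qed (auto simp: prod_module_def PiE_iff am_simps intro!: restrict_ext)
qed (auto simp: prod_module_def PiE_iff module.smult_closed[OF assms(2)] module.smult_l_distr[OF assms(2)]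
    module.smult_r_distr[OF assms(2)] module.smult_assoc1[OF assms(2)] module.smult_one[OF assms(2)]
    fun_eq_iff extensional_def)

lemma (in module) module_submodule:
  assumes "H \<subseteq> carrier M" "\<zero>\<^bsub>M\<^esub> \<in> H" "\<And>x y. x \<in> H \<Longrightarrow> y \<in> H \<Longrightarrow> x \<oplus>\<^bsub>M\<^esub> y \<in> H"
    "\<And>a x. a \<in> carrier R \<Longrightarrow> x \<in> H \<Longrightarrow> a \<odot>\<^bsub>M\<^esub> x \<in> H"
  shows "Module.module R (M\<lparr>carrier := H\<rparr>)"
proof (rule moduleI[OF R.cring_axioms])
  show "abelian_group (M\<lparr>carrier := H\<rparr>)"
  proof (rule abelian_groupI)
    fix x assume "x \<in> carrier (M\<lparr>carrier := H\<rparr>)"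
    then have x: "x \<in> H" by simp
    then have "(\<ominus>\<^bsub>R\<^esub> \<one>\<^bsub>R\<^esub>) \<odot>\<^bsub>M\<^esub> x \<in> H" using assms(4) by simp
    moreover have "(\<ominus>\<^bsub>R\<^esub> \<one>\<^bsub>R\<^esub>) \<odot>\<^bsub>M\<^esub> x \<oplus>\<^bsub>M\<^esub> x = \<zero>\<^bsub>M\<^esub>"
      using x assms(1) by (auto simp: smult_l_minus M.l_neg)
    ultimately show "\<exists>y\<in>carrier (M\<lparr>carrier := H\<rparr>). y \<oplus>\<^bsub>M\<lparr>carrier := H\<rparr>\<^esub> x = \<zero>\<^bsub>M\<lparr>carrier := H\<rparr>\<^esub>"
      by auto
  qed (use assms in \<open>auto simp: subset_iff M.a_ac\<close>)
qed (use assms in \<open>auto simp: subset_iff smult_l_distr smult_r_distr smult_assoc1\<close>)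

lemma module_map_module:
  fixes M :: "('s, 'm) module"
  assumes "Module.module R M" and g: "\<And>x. x \<in> carrier M \<Longrightarrow> g (f x) = x"
  shows "Module.module R (map_module f g M)"
proof -
  interpret module R M by fact
  show ?thesis
proof (rule moduleI[OF R.cring_axioms])
  show "abelian_group (map_module f g M)"
  proof (rule abelian_groupI)
    fix x assume "x \<in> carrier (map_module f g M)"
    then obtain y where "y \<in> carrier M" "x = f y" by (auto simp: map_module_def)
    then show "\<exists>z\<in>carrier (map_module f g M). z \<oplus>\<^bsub>map_module f g M\<^esub> x = \<zero>\<^bsub>map_module f g M\<^esub>"
      by (intro bexI[of _ "f (\<ominus>\<^bsub>M\<^esub> y)"]) (auto simp: map_module_def g M.l_neg)
  qed (auto simp: map_module_def g M.a_ac)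
qed (auto simp: map_module_def g smult_l_distr smult_r_distr smult_assoc1)
qed

text \<open>Turns agreement along an edge from x to xs, which is an equality of cosets, into an
  equation in the stalk.\<close>

lemma coset_smult_image_eq_iff:
  fixes M :: "('s, 'm) module"
  assumes "Module.module R M" "a \<in> carrier R" "m \<in> carrier M" "n \<in> carrier M"
  shows "smult_image M a +>\<^bsub>M\<^esub> m = smult_image M a +>\<^bsub>M\<^esub> n \<longleftrightarrow>
    (\<exists>p\<in>carrier M. m = a \<odot>\<^bsub>M\<^esub> p \<oplus>\<^bsub>M\<^esub> n)"
proof -
  interpret module R M by fact
  show ?thesis
proof
  assume eq: "smult_image M a +>\<^bsub>M\<^esub> m = smult_image M a +>\<^bsub>M\<^esub> n"
  have "a \<odot>\<^bsub>M\<^esub> \<zero>\<^bsub>M\<^esub> \<oplus>\<^bsub>M\<^esub> m \<in> smult_image M a +>\<^bsub>M\<^esub> m"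
    by (auto simp: a_r_coset_def' smult_image_def)
  then have "m \<in> smult_image M a +>\<^bsub>M\<^esub> n" using assms eq by simp
  then show "\<exists>p\<in>carrier M. m = a \<odot>\<^bsub>M\<^esub> p \<oplus>\<^bsub>M\<^esub> n"
    by (auto simp: a_r_coset_def' smult_image_def)
next
  have sub: "smult_image M a +>\<^bsub>M\<^esub> x \<subseteq> smult_image M a +>\<^bsub>M\<^esub> y"
    if "p \<in> carrier M" "x = a \<odot>\<^bsub>M\<^esub> p \<oplus>\<^bsub>M\<^esub> y" "y \<in> carrier M" for x y p
  proof
    fix z assume "z \<in> smult_image M a +>\<^bsub>M\<^esub> x"
    then obtain q where q: "q \<in> carrier M" "z = a \<odot>\<^bsub>M\<^esub> q \<oplus>\<^bsub>M\<^esub> x"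
      by (auto simp: a_r_coset_def' smult_image_def)
    then have "z = a \<odot>\<^bsub>M\<^esub> (q \<oplus>\<^bsub>M\<^esub> p) \<oplus>\<^bsub>M\<^esub> y"
      using that assms by (simp add: smult_r_distr M.a_assoc)
    moreover have "a \<odot>\<^bsub>M\<^esub> (q \<oplus>\<^bsub>M\<^esub> p) \<in> smult_image M a"
      using q that by (auto simp: smult_image_def)
    ultimately show "z \<in> smult_image M a +>\<^bsub>M\<^esub> y"
      by (auto simp: a_r_coset_def')
  qed
  assume "\<exists>p\<in>carrier M. m = a \<odot>\<^bsub>M\<^esub> p \<oplus>\<^bsub>M\<^esub> n"
  then obtain p where p: "p \<in> carrier M" "m = a \<odot>\<^bsub>M\<^esub> p \<oplus>\<^bsub>M\<^esub> n" by blast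
  then have "n = a \<odot>\<^bsub>M\<^esub> (\<ominus>\<^bsub>M\<^esub> p) \<oplus>\<^bsub>M\<^esub> m"
    using assms by (simp add: smult_r_distr M.l_neg flip: M.a_assoc smult_r_distr)
  then show "smult_image M a +>\<^bsub>M\<^esub> m = smult_image M a +>\<^bsub>M\<^esub> n"
    using sub[OF p assms(4)] sub[of "\<ominus>\<^bsub>M\<^esub> p" n m] p assms by blast
qed
qed

section \<open>Edges and pairs of vertices\<close>

context irreducible_root_system
begin

text \<open>The order condition on an edge in the form given by \<open>aff_less_iff\<close>: a sign
  condition on one root.\<close>

definition is_edge :: "'v aff_map \<Rightarrow> 'v aff_map \<Rightarrow> 'v \<times> rat \<Rightarrow> bool" where
  "is_edge x y \<gamma> \<longleftrightarrow> x \<in> carrier W \<and> \<gamma> \<in> \<Phi>\<^sup>+ \<and> y = rr \<gamma> \<otimes>\<^bsub>W\<^esub> x \<and> act (inv\<^bsub>W\<^esub> x) \<gamma> \<in> \<Phi>\<^sup>+"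

lemma aff_less_W: "(x, y) \<in> aff_less R B \<Longrightarrow> x \<in> carrier W"
  unfolding aff_less_def bruhat_less_def by (induction rule: converse_trancl_induct) auto

lemma edges_aff_graph: "(x, y, \<gamma>) \<in> edges (aff_graph R B) \<longleftrightarrow> is_edge x y \<gamma>"
  using aff_less_W[of x y] aff_less_iff[of x \<gamma>] by (auto simp: aff_graph_def is_edge_def)

lemma is_edgeD:
  assumes "is_edge x y \<gamma>"
  shows "x \<in> carrier W" "y \<in> carrier W" "\<gamma> \<in> \<Phi>" "y = rr \<gamma> \<otimes>\<^bsub>W\<^esub> x" "x \<noteq> y"
  using assms root_refl_mult_ne[of \<gamma> x] by (auto simp: is_edge_def pos_root_root root_refl_W)

lemma is_edge_x: "is_edge x y \<gamma> \<Longrightarrow> x = rr \<gamma> \<otimes>\<^bsub>W\<^esub> y"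
  by (auto simp: is_edge_def root_refl_mult_cancel pos_root_root)

abbreviation pc where "pc \<equiv> pair_coset R"

context
  fixes \<alpha> s
  assumes \<alpha>: "\<alpha> \<in> \<Delta>" and s: "s = rr \<alpha>"
begin

lemma s_W: "s \<in> carrier W"
  by (simp add: s root_refl_W simple_root \<alpha>)

lemma mult_s_s: "x \<in> carrier W \<Longrightarrow> x \<otimes>\<^bsub>W\<^esub> s \<otimes>\<^bsub>W\<^esub> s = x"
  using \<alpha> by (simp add: s root_refl_W simple_root W.m_assoc root_refl_square)

lemma mult_s_ne: "x \<in> carrier W \<Longrightarrow> x \<otimes>\<^bsub>W\<^esub> s \<noteq> x"
  using root_refl_ne_one[OF simple_root[OF \<alpha>]] s_W by (simp add: s)

lemma mult_s_eq_iff: "x \<in> carrier W \<Longrightarrow> y \<in> carrier W \<Longrightarrow> x \<otimes>\<^bsub>W\<^esub> s = y \<longleftrightarrow> x = y \<otimes>\<^bsub>W\<^esub> s"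
  using mult_s_s by metis

lemma pc_eq: "pc s x = {x, x \<otimes>\<^bsub>W\<^esub> s}"
  by (simp add: pair_coset_def)

lemma pc_mult_s: "x \<in> carrier W \<Longrightarrow> pc s (x \<otimes>\<^bsub>W\<^esub> s) = pc s x"
  by (auto simp: pc_eq mult_s_s)

lemma pc_eq_iff:
  "x \<in> carrier W \<Longrightarrow> y \<in> carrier W \<Longrightarrow> pc s x = pc s y \<longleftrightarrow> y = x \<or> y = x \<otimes>\<^bsub>W\<^esub> s"
  using mult_s_s mult_s_ne by (auto simp: pc_eq doubleton_eq_iff)

lemma act_mult_s: "x \<in> carrier W \<Longrightarrow> act (x \<otimes>\<^bsub>W\<^esub> s) \<alpha> = - act x \<alpha>"
  using \<alpha> s_W by (simp add: act_mult s act_root_refl simple_root lin_refl_self act_neg)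

lemma root_refl_act_simple: "x \<in> carrier W \<Longrightarrow> rr (act x \<alpha>) \<otimes>\<^bsub>W\<^esub> x = x \<otimes>\<^bsub>W\<^esub> s"
  using \<alpha> by (simp add: root_refl_act_mult simple_root s)

lemma act_simple_root: "x \<in> carrier W \<Longrightarrow> act x \<alpha> \<in> \<Phi>"
  using \<alpha> by (simp add: act_root simple_root)

lemma simple_edge:
  assumes "x \<in> carrier W" "act x \<alpha> \<in> \<Phi>\<^sup>+"
  shows "is_edge x (x \<otimes>\<^bsub>W\<^esub> s) (act x \<alpha>)"
  using assms \<alpha> by (simp add: is_edge_def root_refl_act_simple act_inv_act simple_pos)

lemma simple_edge_root:
  assumes "x \<in> carrier W" "\<gamma> \<in> \<Phi>" "rr \<gamma> \<otimes>\<^bsub>W\<^esub> x = x \<otimes>\<^bsub>W\<^esub> s"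
  shows "\<gamma> = act x \<alpha> \<or> \<gamma> = - act x \<alpha>"
proof (rule root_refl_inj)
  show "rr (act x \<alpha>) = rr \<gamma>"
    using assms root_refl_act_simple[OF assms(1)] act_simple_root[OF assms(1)] root_refl_W
    by (metis W.right_cancel)
qed (use assms act_simple_root in auto)

text \<open>The simple reflection preserves the sign of every positive root except \<alpha>, and
  \<alpha> belongs to the excluded edge from x to xs; so E and Es point the same way.\<close>

lemma edge_shift:
  assumes "is_edge x y \<gamma>" "y \<noteq> x \<otimes>\<^bsub>W\<^esub> s"
  shows "is_edge (x \<otimes>\<^bsub>W\<^esub> s) (y \<otimes>\<^bsub>W\<^esub> s) \<gamma>"
proof -
  note e = is_edgeD[OF assms(1)]
  have "act (inv\<^bsub>W\<^esub> x) \<gamma> \<noteq> \<alpha>"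
  proof
    assume "act (inv\<^bsub>W\<^esub> x) \<gamma> = \<alpha>"
    then have "\<gamma> = act x \<alpha>" using act_act_inv[OF e(1)] by metis
    then show False using assms(2) e root_refl_act_simple by simp
  qed
  then have "lin_refl R \<alpha> (act (inv\<^bsub>W\<^esub> x) \<gamma>) \<in> \<Phi>\<^sup>+"
    using simple_refl_pos assms(1) \<alpha> by (auto simp: is_edge_def)
  moreover have "act (inv\<^bsub>W\<^esub> (x \<otimes>\<^bsub>W\<^esub> s)) \<gamma> = lin_refl R \<alpha> (act (inv\<^bsub>W\<^esub> x) \<gamma>)"
    using e \<alpha> s_W by (simp add: W.inv_mult_group act_mult s inv_root_refl act_root_refl simple_root)
  ultimately show ?thesis
    using assms(1) e s_W by (simp add: is_edge_def W.m_assoc root_refl_W)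
qed

lemma edge_ne_shift:
  assumes "is_edge x y \<gamma>" "y \<noteq> x \<otimes>\<^bsub>W\<^esub> s"
  shows "pc s x \<noteq> pc s y" "y \<otimes>\<^bsub>W\<^esub> s \<noteq> x \<otimes>\<^bsub>W\<^esub> s \<otimes>\<^bsub>W\<^esub> s" "x \<notin> pc s y" "x \<otimes>\<^bsub>W\<^esub> s \<notin> pc s y"
    "y \<notin> pc s x" "y \<otimes>\<^bsub>W\<^esub> s \<notin> pc s x"
  using is_edgeD[OF assms(1)] assms(2) s_W mult_s_s mult_s_eq_iff[of x y] mult_s_eq_iff[of y x]
  by (auto simp: pc_eq_iff) (auto simp: pc_eq)

text \<open>The source of a lift lies in a pair, which leaves two choices, and the root \<gamma>
  then determines the target.\<close>

lemma edge_lifts_eq: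
  assumes "is_edge x y \<gamma>" "y \<noteq> x \<otimes>\<^bsub>W\<^esub> s" "graph M = aff_graph R B"
  shows "edge_lifts R s (graph M) (pc s x, pc s y, \<gamma>) =
    {(x, y, \<gamma>), (x \<otimes>\<^bsub>W\<^esub> s, y \<otimes>\<^bsub>W\<^esub> s, \<gamma>)}"
proof -
  note e = is_edgeD[OF assms(1)] and e' = edge_shift[OF assms(1,2)]
  have "(u, v) = (x, y) \<or> (u, v) = (x \<otimes>\<^bsub>W\<^esub> s, y \<otimes>\<^bsub>W\<^esub> s)"
    if uv: "is_edge u v \<gamma>" "pc s u = pc s x" for u v
  proof -
    have "u = x \<or> u = x \<otimes>\<^bsub>W\<^esub> s"
      using pc_eq_iff[OF e(1) is_edgeD(1)[OF uv(1)]] uv(2) by simp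
    then show ?thesis
      using is_edgeD(4)[OF uv(1)] e(4) is_edgeD(4)[OF e'] by auto
  qed
  moreover have "pc s (x \<otimes>\<^bsub>W\<^esub> s) = pc s x" "pc s (y \<otimes>\<^bsub>W\<^esub> s) = pc s y"
    using e by (simp_all add: pc_mult_s)
  ultimately have iff: "(u, v, \<delta>) \<in> edge_lifts R s (graph M) (pc s x, pc s y, \<gamma>) \<longleftrightarrow>
      (u, v, \<delta>) \<in> {(x, y, \<gamma>), (x \<otimes>\<^bsub>W\<^esub> s, y \<otimes>\<^bsub>W\<^esub> s, \<gamma>)}" for u v \<delta>
    using assms(1) e' unfolding edge_lifts_def assms(3) by (auto simp: edges_aff_graph)
  show ?thesis
  proof (rule Set.set_eqI)
    fix E :: "('v aff_map, 'v \<times> rat) edge"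
    obtain u v \<delta> where E: "E = (u, v, \<delta>)" by (rule prod_cases3)
    show "E \<in> edge_lifts R s (graph M) (pc s x, pc s y, \<gamma>) \<longleftrightarrow>
        E \<in> {(x, y, \<gamma>), (x \<otimes>\<^bsub>W\<^esub> s, y \<otimes>\<^bsub>W\<^esub> s, \<gamma>)}"
      unfolding E by (rule iff)
  qed
qed

end

end

text \<open>Sections see an edge only through this relation, so the invariants of the induction are
  stated for it and not for the restriction maps, whose values become ever deeper families.\<close>

definition agrees ::
  "('x, 'i, 's, 'm, 'n) graph_sheaf \<Rightarrow> 'x \<Rightarrow> 'x \<Rightarrow> 'i \<Rightarrow> 'm \<Rightarrow> 'm \<Rightarrow> bool" where
  "agrees M x y \<gamma> m n \<longleftrightarrow> res M x (x, y, \<gamma>) m = res M y (x, y, \<gamma>) n"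

text \<open>The invariants carried along the translations. \<open>divisible\<close> and
  \<open>agree_cancel\<close> need each other: cancellation on the edge from x to xs is divisibility
  in a stalk, and divisibility in a stalk made of sections over a pair requires the quotients at the
  two vertices to agree. \<open>support_edge\<close> makes edges that leave \<open>J\<close>
  vacuous, since non-proportionality of labels is available only inside \<open>J\<close>.\<close>

locale good_sheaf = labelled_root_system R B F
  for R B :: "'v::rat_vector set" and F :: "'f::field itself" +
  fixes M :: "('v, 'f) aff_sheaf" and J :: "'v aff_map set"
  assumes graph_M: "graph M = aff_graph R B" and J_W: "J \<subseteq> carrier W"
    and stalk_module: "x \<in> carrier W \<Longrightarrow> Module.module S (stalk M x)"
    and torsion_free: "x \<in> carrier W \<Longrightarrow> \<gamma> \<in> \<Phi> \<Longrightarrow> m \<in> carrier (stalk M x) \<Longrightarrow>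
      lab \<gamma> \<odot>\<^bsub>stalk M x\<^esub> m = \<zero>\<^bsub>stalk M x\<^esub> \<Longrightarrow> m = \<zero>\<^bsub>stalk M x\<^esub>"
    and divisible: "x \<in> carrier W \<Longrightarrow> \<gamma> \<in> \<Phi> \<Longrightarrow> \<delta> \<in> \<Phi> \<Longrightarrow> \<not> prp (lab \<delta>) (lab \<gamma>) \<Longrightarrow>
      m \<in> carrier (stalk M x) \<Longrightarrow> n \<in> carrier (stalk M x) \<Longrightarrow>
      lab \<delta> \<odot>\<^bsub>stalk M x\<^esub> m = lab \<gamma> \<odot>\<^bsub>stalk M x\<^esub> n \<Longrightarrow> \<exists>p\<in>carrier (stalk M x). m = lab \<gamma> \<odot>\<^bsub>stalk M x\<^esub> p"
    and agree_add: "is_edge x y \<gamma> \<Longrightarrow>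
      m \<in> carrier (stalk M x) \<Longrightarrow> m' \<in> carrier (stalk M x) \<Longrightarrow>
      n \<in> carrier (stalk M y) \<Longrightarrow> n' \<in> carrier (stalk M y) \<Longrightarrow>
      agrees M x y \<gamma> m n \<Longrightarrow>
      agrees M x y \<gamma> m' n' \<Longrightarrow>
      agrees M x y \<gamma> (m \<oplus>\<^bsub>stalk M x\<^esub> m') (n \<oplus>\<^bsub>stalk M y\<^esub> n')"
    and agree_smult: "is_edge x y \<gamma> \<Longrightarrow> a \<in> carrier S \<Longrightarrow>
      m \<in> carrier (stalk M x) \<Longrightarrow> n \<in> carrier (stalk M y) \<Longrightarrow>
      agrees M x y \<gamma> m n \<Longrightarrow>
      agrees M x y \<gamma> (a \<odot>\<^bsub>stalk M x\<^esub> m) (a \<odot>\<^bsub>stalk M y\<^esub> n)"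
    and agree_label: "is_edge x y \<gamma> \<Longrightarrow>
      m \<in> carrier (stalk M x) \<Longrightarrow> n \<in> carrier (stalk M y) \<Longrightarrow>
      agrees M x y \<gamma> (lab \<gamma> \<odot>\<^bsub>stalk M x\<^esub> m) (lab \<gamma> \<odot>\<^bsub>stalk M y\<^esub> n)"
    and agree_cancel: "is_edge x y \<gamma> \<Longrightarrow> \<delta> \<in> \<Phi> \<Longrightarrow> \<not> prp (lab \<delta>) (lab \<gamma>) \<Longrightarrow>
      m \<in> carrier (stalk M x) \<Longrightarrow> n \<in> carrier (stalk M y) \<Longrightarrow>
      agrees M x y \<gamma> (lab \<delta> \<odot>\<^bsub>stalk M x\<^esub> m) (lab \<delta> \<odot>\<^bsub>stalk M y\<^esub> n) \<Longrightarrow>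
      agrees M x y \<gamma> m n"
    and support: "x \<in> carrier W \<Longrightarrow> x \<notin> J \<Longrightarrow> m \<in> carrier (stalk M x) \<Longrightarrow> m = \<zero>\<^bsub>stalk M x\<^esub>"
    and support_edge: "is_edge x y \<gamma> \<Longrightarrow> x \<notin> J \<or> y \<notin> J \<Longrightarrow>
      m \<in> carrier (stalk M x) \<Longrightarrow> n \<in> carrier (stalk M y) \<Longrightarrow>
      agrees M x y \<gamma> m n"
begin

abbreviation st where "st \<equiv> stalk M"

abbreviation agree where "agree \<equiv> agrees M"

lemmas st_closed [simp, intro] =
    abelian_monoid.a_closed[OF abelian_group.axioms(1), OF module.axioms(2), OF stalk_module]
    abelian_monoid.zero_closed[OF abelian_group.axioms(1), OF module.axioms(2), OF stalk_module]
    module.smult_closed[OF stalk_module]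
  and st_l_distr = module.smult_l_distr[OF stalk_module]
  and st_r_distr = module.smult_r_distr[OF stalk_module]
  and st_assoc1 = module.smult_assoc1[OF stalk_module]
  and st_one [simp] = module.smult_one[OF stalk_module]
  and st_smult_zero [simp] = module.smult_r_null[OF stalk_module]
  and st_zero_smult [simp] = module.smult_l_null[OF stalk_module]
  and st_add_zero [simp] =
    abelian_monoid.r_zero[OF abelian_group.axioms(1), OF module.axioms(2), OF stalk_module]
    abelian_monoid.l_zero[OF abelian_group.axioms(1), OF module.axioms(2), OF stalk_module]

lemma agree_zero: "is_edge x y \<gamma> \<Longrightarrow> agree x y \<gamma> \<zero>\<^bsub>st x\<^esub> \<zero>\<^bsub>st y\<^esub>"
  using agree_label[of x y \<gamma> "\<zero>\<^bsub>st x\<^esub>" "\<zero>\<^bsub>st y\<^esub>"] is_edgeD[of x y \<gamma>] by (simp add: lab_root_S)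

lemma agree_label_add:
  assumes "is_edge x y \<gamma>" "m \<in> carrier (st x)" "n \<in> carrier (st y)" "p \<in> carrier (st x)"
    "agree x y \<gamma> m n"
  shows "agree x y \<gamma> (m \<oplus>\<^bsub>st x\<^esub> lab \<gamma> \<odot>\<^bsub>st x\<^esub> p) n"
  using agree_add[OF assms(1,2) _ assms(3) _ assms(5), of "lab \<gamma> \<odot>\<^bsub>st x\<^esub> p" "\<zero>\<^bsub>st y\<^esub>"]
    agree_label[OF assms(1,4), of "\<zero>\<^bsub>st y\<^esub>"] assms is_edgeD[OF assms(1)]
  by (simp add: lab_root_S)

text \<open>Multiples of the label agree with anything of the same kind, so scalars at the two ends
  need only be congruent modulo it. This is how the structure algebra and the weights x(\<alpha>)
  act on sections.\<close>

lemma agree_scalars: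
  assumes "is_edge x y \<gamma>" "m \<in> carrier (st x)" "n \<in> carrier (st y)" "agree x y \<gamma> m n"
    and "a \<in> carrier S" "b \<in> carrier S" "e \<in> carrier S" "a = b \<oplus>\<^bsub>S\<^esub> lab \<gamma> \<otimes>\<^bsub>S\<^esub> e"
  shows "agree x y \<gamma> (a \<odot>\<^bsub>st x\<^esub> m) (b \<odot>\<^bsub>st y\<^esub> n)"
proof -
  note e = is_edgeD[OF assms(1)]
  have "a \<odot>\<^bsub>st x\<^esub> m = b \<odot>\<^bsub>st x\<^esub> m \<oplus>\<^bsub>st x\<^esub> lab \<gamma> \<odot>\<^bsub>st x\<^esub> (e \<odot>\<^bsub>st x\<^esub> m)"
    using assms e by (simp add: st_l_distr st_assoc1 lab_root_S)
  then show ?thesis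
    using agree_label_add[OF assms(1), of "b \<odot>\<^bsub>st x\<^esub> m" "b \<odot>\<^bsub>st y\<^esub> n" "e \<odot>\<^bsub>st x\<^esub> m"]
      agree_smult[OF assms(1,6,2,3,4)] assms e by simp
qed

definition sec :: "'v aff_map set \<Rightarrow> ('v aff_map \<Rightarrow> ('v, 'f) vert_elt) set" where
  "sec \<Omega> = carrier (sections M \<Omega>)"

lemma sec_iff:
  "m \<in> sec \<Omega> \<longleftrightarrow> m \<in> (\<Pi>\<^sub>E x\<in>\<Omega>. carrier (st x)) \<and>
    (\<forall>x y \<gamma>. is_edge x y \<gamma> \<longrightarrow> x \<in> \<Omega> \<longrightarrow> y \<in> \<Omega> \<longrightarrow> agree x y \<gamma> (m x) (m y))"
proof -
  have "(\<forall>(x, y, i)\<in>E. Q x y i) \<longleftrightarrow> (\<forall>x y i. (x, y, i) \<in> E \<longrightarrow> Q x y i)"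
    for E :: "('v aff_map, 'v \<times> rat) edge set" and Q by auto
  then show ?thesis
    by (simp add: sec_def sections_def graph_M agrees_def edges_aff_graph imp_conjL
        del: split_paired_All)
qed

lemma sec_mem: "m \<in> sec \<Omega> \<Longrightarrow> x \<in> \<Omega> \<Longrightarrow> m x \<in> carrier (st x)"
  and sec_agree: "m \<in> sec \<Omega> \<Longrightarrow> is_edge x y \<gamma> \<Longrightarrow> x \<in> \<Omega> \<Longrightarrow> y \<in> \<Omega> \<Longrightarrow> agree x y \<gamma> (m x) (m y)"
  and sec_ext: "m \<in> sec \<Omega> \<Longrightarrow> m \<in> extensional \<Omega>"
  unfolding sec_iff by (auto simp: PiE_def simp del: split_paired_All)

lemma sec_eqI: "m \<in> sec \<Omega> \<Longrightarrow> n \<in> sec \<Omega> \<Longrightarrow> (\<And>x. x \<in> \<Omega> \<Longrightarrow> m x = n x) \<Longrightarrow> m = n"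
  using sec_ext extensionalityI by metis

lemma secI:
  "(\<And>x. x \<in> \<Omega> \<Longrightarrow> m x \<in> carrier (st x)) \<Longrightarrow>
   (\<And>x y \<gamma>. is_edge x y \<gamma> \<Longrightarrow> x \<in> \<Omega> \<Longrightarrow> y \<in> \<Omega> \<Longrightarrow> agree x y \<gamma> (m x) (m y)) \<Longrightarrow> restrict m \<Omega> \<in> sec \<Omega>"
  by (auto simp: sec_iff)

lemma sec_restrict: "m \<in> sec \<Omega> \<Longrightarrow> \<Omega>' \<subseteq> \<Omega> \<Longrightarrow> restrict m \<Omega>' \<in> sec \<Omega>'"
  by (rule secI) (auto intro: sec_mem sec_agree)

lemma sec_add: "\<Omega> \<subseteq> carrier W \<Longrightarrow> m \<in> sec \<Omega> \<Longrightarrow> n \<in> sec \<Omega> \<Longrightarrow> (\<lambda>x\<in>\<Omega>. m x \<oplus>\<^bsub>st x\<^esub> n x) \<in> sec \<Omega>"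
  by (rule secI) (auto simp: subset_iff intro: agree_add sec_mem sec_agree)

text \<open>The congruence is asked for only between vertices of \<open>J\<close>, because the
  remaining edges impose no condition.\<close>

lemma sec_scalars:
  assumes "\<Omega> \<subseteq> carrier W" "m \<in> sec \<Omega>" "\<And>x. x \<in> \<Omega> \<Longrightarrow> a x \<in> carrier S"
    "\<And>x y \<gamma>. is_edge x y \<gamma> \<Longrightarrow> x \<in> \<Omega> \<Longrightarrow> y \<in> \<Omega> \<Longrightarrow> x \<in> J \<Longrightarrow> y \<in> J \<Longrightarrow>
      \<exists>e\<in>carrier S. a x = a y \<oplus>\<^bsub>S\<^esub> lab \<gamma> \<otimes>\<^bsub>S\<^esub> e"
  shows "(\<lambda>x\<in>\<Omega>. a x \<odot>\<^bsub>st x\<^esub> m x) \<in> sec \<Omega>"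
proof (rule secI)
  show "a x \<odot>\<^bsub>st x\<^esub> m x \<in> carrier (st x)" if "x \<in> \<Omega>" for x
    using assms that by (auto intro: sec_mem)
  fix x y \<gamma> assume e: "is_edge x y \<gamma>" "x \<in> \<Omega>" "y \<in> \<Omega>"
  have m: "m x \<in> carrier (st x)" "m y \<in> carrier (st y)" using sec_mem[OF assms(2)] e by auto
  show "agree x y \<gamma> (a x \<odot>\<^bsub>st x\<^esub> m x) (a y \<odot>\<^bsub>st y\<^esub> m y)"
  proof (cases "x \<in> J \<and> y \<in> J")
    case True
    then obtain c where "c \<in> carrier S" "a x = a y \<oplus>\<^bsub>S\<^esub> lab \<gamma> \<otimes>\<^bsub>S\<^esub> c"
      using assms(4) e by blast
    then show ?thesis
      using agree_scalars[OF e(1) m sec_agree[OF assms(2) e]] assms(3) e by blast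
  next
    case False
    then show ?thesis
      using m assms(1,3) e by (intro support_edge[OF e(1)]) auto
  qed
qed

lemma sec_smult: "\<Omega> \<subseteq> carrier W \<Longrightarrow> m \<in> sec \<Omega> \<Longrightarrow> a \<in> carrier S \<Longrightarrow> (\<lambda>x\<in>\<Omega>. a \<odot>\<^bsub>st x\<^esub> m x) \<in> sec \<Omega>"
  by (rule sec_scalars) (auto intro!: bexI[of _ "\<zero>\<^bsub>S\<^esub>"] simp: is_edgeD lab_root_S)

lemma sec_zero: "\<Omega> \<subseteq> carrier W \<Longrightarrow> (\<lambda>x\<in>\<Omega>. \<zero>\<^bsub>st x\<^esub>) \<in> sec \<Omega>"
  by (rule secI) (auto simp: agree_zero)

lemma sections_ops:
  "\<zero>\<^bsub>sections M \<Omega>\<^esub> = (\<lambda>x\<in>\<Omega>. \<zero>\<^bsub>st x\<^esub>)"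
  "m \<oplus>\<^bsub>sections M \<Omega>\<^esub> n = (\<lambda>x\<in>\<Omega>. m x \<oplus>\<^bsub>st x\<^esub> n x)"
  "a \<odot>\<^bsub>sections M \<Omega>\<^esub> m = (\<lambda>x\<in>\<Omega>. a \<odot>\<^bsub>st x\<^esub> m x)"
  by (simp_all add: sections_def prod_module_def)

lemma module_sections: "\<Omega> \<subseteq> carrier W \<Longrightarrow> Module.module S (sections M \<Omega>)"
proof -
  assume \<Omega>: "\<Omega> \<subseteq> carrier W"
  have "Module.module S (prod_module \<Omega> st)"
    by (rule module_prod_module[OF S.cring_axioms]) (use stalk_module \<Omega> in blast)
  then interpret Pr: module S "prod_module \<Omega> st" .
  have "Module.module S ((prod_module \<Omega> st)\<lparr>carrier := sec \<Omega>\<rparr>)"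
  proof (rule Pr.module_submodule)
    show "sec \<Omega> \<subseteq> carrier (prod_module \<Omega> st)" using sec_iff by (auto simp: prod_module_def)
    show "\<zero>\<^bsub>prod_module \<Omega> st\<^esub> \<in> sec \<Omega>" using sec_zero[OF \<Omega>] by (simp add: prod_module_def)
    fix f g a assume f: "f \<in> sec \<Omega>"
    show "a \<odot>\<^bsub>prod_module \<Omega> st\<^esub> f \<in> sec \<Omega>" if "a \<in> carrier S"
      using sec_smult[OF \<Omega> f that] by (simp add: prod_module_def)
    assume g: "g \<in> sec \<Omega>"
    show "f \<oplus>\<^bsub>prod_module \<Omega> st\<^esub> g \<in> sec \<Omega>"
      using sec_add[OF \<Omega> f g] by (simp add: prod_module_def)
  qed
  then show ?thesis by (simp add: sections_def sec_def)
qed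

end

section \<open>Translation functors\<close>

lemma restrict_eq_restrict_iff: "restrict f A = restrict g A \<longleftrightarrow> (\<forall>a\<in>A. f a = g a)"
  by (auto simp: restrict_def fun_eq_iff)

text \<open>All restriction maps are constant, so agreement always holds; torsion freeness and
  divisibility of the stalk at the identity are \<open>lab_regular\<close> and
  \<open>lab_coprime\<close>.\<close>

lemma (in labelled_root_system) good_unit_sheaf: "good_sheaf R B (unit_sheaf R B :: ('v, 'f) aff_sheaf) {\<one>\<^bsub>W\<^esub>}"
proof -
  have ring: "Module.module S (map_module Elt elt (ring_module S) :: (_, ('v, 'f) vert_elt) module)"
    by (rule module_map_module[OF module_ring_module[OF S.cring_axioms]]) simp
  let ?U = "unit_sheaf R B :: ('v, 'f) aff_sheaf"
  have agr: "agrees ?U x y \<gamma> m n" for x y \<gamma> m n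
    by (simp add: agrees_def unit_sheaf_def)
  have st: "stalk ?U x = (if x = \<one>\<^bsub>W\<^esub> then map_module Elt elt (ring_module S) else zero_module (Elt \<zero>\<^bsub>S\<^esub>))" for x
    by (simp add: unit_sheaf_def)
  have one: "carrier (stalk ?U \<one>\<^bsub>W\<^esub>) = Elt ` carrier S" "\<zero>\<^bsub>stalk ?U \<one>\<^bsub>W\<^esub>\<^esub> = Elt \<zero>\<^bsub>S\<^esub>"
    "a \<odot>\<^bsub>stalk ?U \<one>\<^bsub>W\<^esub>\<^esub> Elt b = Elt (a \<otimes>\<^bsub>S\<^esub> b)" for a b
    by (simp_all add: st map_module_def ring_module_def)
  have other: "carrier (stalk ?U x) = {\<zero>\<^bsub>stalk ?U x\<^esub>}" "a \<odot>\<^bsub>stalk ?U x\<^esub> m = \<zero>\<^bsub>stalk ?U x\<^esub>"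
    if "x \<noteq> \<one>\<^bsub>W\<^esub>" for x a m
    using that by (simp_all add: st zero_module_def)
  show ?thesis
  proof (intro good_sheaf.intro[OF labelled_root_system_axioms] good_sheaf_axioms.intro, goal_cases)
    case 1
    show ?case by (simp add: unit_sheaf_def)
  next
    case 2
    show ?case by simp
  next
    case (3 x)
    show ?case
      using ring module_zero_module[OF S.cring_axioms, of "Elt \<zero>\<^bsub>S\<^esub> :: ('v, 'f) vert_elt"]
      by (simp add: st)
  next
    case (4 x \<gamma> m)
    show ?case
    proof (cases "x = \<one>\<^bsub>W\<^esub>")
      case True
      obtain a where a: "m = Elt a" "a \<in> carrier S" using 4(3) unfolding True one by blast
      have "lab \<gamma> \<otimes>\<^bsub>S\<^esub> a = \<zero>\<^bsub>S\<^esub>" using 4(4) unfolding True a one by simp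
      from lab_regular[OF 4(2) a(2) this] show ?thesis unfolding True a one by simp
    next
      case False
      then show ?thesis using 4(3) other by blast
    qed
  next
    case (5 x \<gamma> \<delta> m n)
    show ?case
    proof (cases "x = \<one>\<^bsub>W\<^esub>")
      case True
      obtain a where a: "m = Elt a" "a \<in> carrier S" using 5(5) unfolding True one by blast
      obtain b where b: "n = Elt b" "b \<in> carrier S" using 5(6) unfolding True one by blast
      have "lab \<delta> \<otimes>\<^bsub>S\<^esub> a = lab \<gamma> \<otimes>\<^bsub>S\<^esub> b" using 5(7) unfolding True a b one by simp
      from lab_coprime[OF 5(2,3,4) a(2) b(2) this] obtain z where "z \<in> carrier S" "a = lab \<gamma> \<otimes>\<^bsub>S\<^esub> z"
        by blast
      then show ?thesis unfolding True a one by (intro bexI[of _ "Elt z"]) (simp_all add: one)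
    next
      case False
      then show ?thesis using 5(5) other[OF False] by simp
    qed
  next
    case (10 x m)
    then show ?case using other[of x] by blast
  qed (rule agr)+
qed

section \<open>Translated lower sets\<close>

context irreducible_root_system
begin

text \<open>For \<open>z = 1\<close> these are the lower sets of the Bruhat order; the others are their left translates.\<close>

definition lower_set :: "'v aff_map \<Rightarrow> 'v aff_map set \<Rightarrow> bool" where
  "lower_set z \<Omega> \<longleftrightarrow> \<Omega> \<subseteq> carrier W \<and> (\<forall>v\<in>\<Omega>. \<forall>\<gamma>\<in>\<Phi>. act (inv\<^bsub>W\<^esub> z) \<gamma> \<in> \<Phi>\<^sup>+ \<longrightarrow>
     act (inv\<^bsub>W\<^esub> v) \<gamma> \<notin> \<Phi>\<^sup>+ \<longrightarrow> rr \<gamma> \<otimes>\<^bsub>W\<^esub> v \<in> \<Omega>)"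

text \<open>At the vertex z itself the condition asks the same root to be positive and not
  positive.\<close>

lemma lower_set_singleton: "z \<in> carrier W \<Longrightarrow> lower_set z {z}"
  by (auto simp: lower_set_def)

context
  fixes \<alpha> s
  assumes \<alpha>: "\<alpha> \<in> \<Delta>" and s: "s = rr \<alpha>"
begin

text \<open>Passing from v to vs applies one more simple reflection, which changes the sign of
  \<alpha> only, up to negation; and the root that is \<alpha> up to sign belongs to the edge
  between v and vs.\<close>

lemma neg_shift:
  assumes "v \<in> carrier W" "\<gamma> \<in> \<Phi>" "act (inv\<^bsub>W\<^esub> v) \<gamma> \<notin> \<Phi>\<^sup>+"
  shows "rr \<gamma> \<otimes>\<^bsub>W\<^esub> v = v \<otimes>\<^bsub>W\<^esub> s \<or> act (inv\<^bsub>W\<^esub> (v \<otimes>\<^bsub>W\<^esub> s)) \<gamma> \<notin> \<Phi>\<^sup>+"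
proof -
  let ?\<delta> = "act (inv\<^bsub>W\<^esub> v) (- \<gamma>)"
  have neg: "- \<gamma> \<in> \<Phi>" using assms by (simp add: neg_aff_root)
  have sr: "\<alpha> \<in> \<Phi>" using \<alpha> by (rule simple_root)
  have \<delta>: "?\<delta> = - act (inv\<^bsub>W\<^esub> v) \<gamma>" using assms by (simp add: act_neg)
  then have pos: "?\<delta> \<in> \<Phi>\<^sup>+" using assms pos_or_neg[of "act (inv\<^bsub>W\<^esub> v) \<gamma>"] act_root by auto
  show ?thesis
  proof (cases "?\<delta> = \<alpha>")
    case True
    then have "- \<gamma> = act v \<alpha>" using act_act_inv[OF assms(1)] by metis
    then have "rr \<gamma> \<otimes>\<^bsub>W\<^esub> v = v \<otimes>\<^bsub>W\<^esub> s"
      using root_refl_act_simple[OF \<alpha> s assms(1)] root_refl_neg[OF assms(2)] by simp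
    then show ?thesis ..
  next
    case False
    then have "lin_refl R \<alpha> ?\<delta> \<in> \<Phi>\<^sup>+" using simple_refl_pos[OF pos \<alpha>] by blast
    moreover have "act (inv\<^bsub>W\<^esub> (v \<otimes>\<^bsub>W\<^esub> s)) (- \<gamma>) = lin_refl R \<alpha> ?\<delta>"
      using assms sr s_W[OF \<alpha> s]
      by (simp add: W.inv_mult_group act_mult s inv_root_refl act_root_refl)
    moreover have "act (inv\<^bsub>W\<^esub> (v \<otimes>\<^bsub>W\<^esub> s)) (- \<gamma>) = - act (inv\<^bsub>W\<^esub> (v \<otimes>\<^bsub>W\<^esub> s)) \<gamma>"
      using assms s_W[OF \<alpha> s] by (intro act_neg) simp
    ultimately show ?thesis using pos_not_neg[of "act (inv\<^bsub>W\<^esub> (v \<otimes>\<^bsub>W\<^esub> s)) \<gamma>"] by auto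
  qed
qed

lemma lower_set_inter:
  assumes "lower_set z \<Omega>"
  shows "lower_set z {x \<in> \<Omega>. x \<otimes>\<^bsub>W\<^esub> s \<in> \<Omega>}"
  unfolding lower_set_def
proof (intro conjI ballI impI)
  show "{x \<in> \<Omega>. x \<otimes>\<^bsub>W\<^esub> s \<in> \<Omega>} \<subseteq> carrier W" using assms by (auto simp: lower_set_def)
  fix v \<gamma> assume v: "v \<in> {x \<in> \<Omega>. x \<otimes>\<^bsub>W\<^esub> s \<in> \<Omega>}" and \<gamma>: "\<gamma> \<in> \<Phi>"
    and z: "act (inv\<^bsub>W\<^esub> z) \<gamma> \<in> \<Phi>\<^sup>+" and neg: "act (inv\<^bsub>W\<^esub> v) \<gamma> \<notin> \<Phi>\<^sup>+"
  have vW: "v \<in> carrier W" using v assms by (auto simp: lower_set_def)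
  have low: "rr \<gamma> \<otimes>\<^bsub>W\<^esub> u \<in> \<Omega>" if "u \<in> \<Omega>" "act (inv\<^bsub>W\<^esub> u) \<gamma> \<notin> \<Phi>\<^sup>+" for u
    using assms that \<gamma> z unfolding lower_set_def by blast
  have "rr \<gamma> \<otimes>\<^bsub>W\<^esub> v \<otimes>\<^bsub>W\<^esub> s \<in> \<Omega>"
    using neg_shift[OF vW \<gamma> neg]
  proof
    assume "rr \<gamma> \<otimes>\<^bsub>W\<^esub> v = v \<otimes>\<^bsub>W\<^esub> s"
    then show ?thesis using v vW mult_s_s[OF \<alpha> s] by simp
  next
    assume "act (inv\<^bsub>W\<^esub> (v \<otimes>\<^bsub>W\<^esub> s)) \<gamma> \<notin> \<Phi>\<^sup>+"
    then have "rr \<gamma> \<otimes>\<^bsub>W\<^esub> (v \<otimes>\<^bsub>W\<^esub> s) \<in> \<Omega>" using low v by blast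
    then show ?thesis using vW \<gamma> s_W[OF \<alpha> s] by (simp add: W.m_assoc root_refl_W)
  qed
  then show "rr \<gamma> \<otimes>\<^bsub>W\<^esub> v \<in> {x \<in> \<Omega>. x \<otimes>\<^bsub>W\<^esub> s \<in> \<Omega>}" using low v neg by blast
qed

lemma lower_set_union:
  assumes "lower_set z \<Omega>"
  shows "lower_set z {x \<in> carrier W. x \<in> \<Omega> \<or> x \<otimes>\<^bsub>W\<^esub> s \<in> \<Omega>}"
  unfolding lower_set_def
proof (intro conjI ballI impI)
  fix v \<gamma> assume v: "v \<in> {x \<in> carrier W. x \<in> \<Omega> \<or> x \<otimes>\<^bsub>W\<^esub> s \<in> \<Omega>}" and \<gamma>: "\<gamma> \<in> \<Phi>"
    and z: "act (inv\<^bsub>W\<^esub> z) \<gamma> \<in> \<Phi>\<^sup>+" and neg: "act (inv\<^bsub>W\<^esub> v) \<gamma> \<notin> \<Phi>\<^sup>+"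
  have vW: "v \<in> carrier W" and rW: "rr \<gamma> \<otimes>\<^bsub>W\<^esub> v \<in> carrier W" using v \<gamma> by (auto simp: root_refl_W)
  have low: "rr \<gamma> \<otimes>\<^bsub>W\<^esub> u \<in> \<Omega>" if "u \<in> \<Omega>" "act (inv\<^bsub>W\<^esub> u) \<gamma> \<notin> \<Phi>\<^sup>+" for u
    using assms that \<gamma> z unfolding lower_set_def by blast
  consider "v \<in> \<Omega>" | "v \<otimes>\<^bsub>W\<^esub> s \<in> \<Omega>" "rr \<gamma> \<otimes>\<^bsub>W\<^esub> v = v \<otimes>\<^bsub>W\<^esub> s"
    | "v \<otimes>\<^bsub>W\<^esub> s \<in> \<Omega>" "act (inv\<^bsub>W\<^esub> (v \<otimes>\<^bsub>W\<^esub> s)) \<gamma> \<notin> \<Phi>\<^sup>+"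
    using neg_shift[OF vW \<gamma> neg] v by blast
  then show "rr \<gamma> \<otimes>\<^bsub>W\<^esub> v \<in> {x \<in> carrier W. x \<in> \<Omega> \<or> x \<otimes>\<^bsub>W\<^esub> s \<in> \<Omega>}"
  proof cases
    case 1
    then show ?thesis using low neg rW by blast
  next
    case 2
    then show ?thesis using rW by simp
  next
    case 3
    then have "rr \<gamma> \<otimes>\<^bsub>W\<^esub> (v \<otimes>\<^bsub>W\<^esub> s) \<in> \<Omega>" using low by blast
    then show ?thesis using vW \<gamma> s_W[OF \<alpha> s] by (simp add: W.m_assoc root_refl_W)
  qed
qed auto

text \<open>Call a root positive at x if the inverse of x sends it to a positive root, and choose
  the sign of \<gamma> so that it is positive at z. The reflection leads from u out of the lower
  set, so \<gamma> is positive at u. Unless q = u it is positive at us as well, hence negative at q,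
  which is the reflection of us; the lower set property at q then puts us into \<Omega>, a
  contradiction.\<close>

lemma lower_set_no_crossing:
  assumes "lower_set z \<Omega>" "z \<in> carrier W" "\<gamma> \<in> \<Phi>" "u \<in> \<Omega>" "q \<in> \<Omega>" "u \<otimes>\<^bsub>W\<^esub> s \<notin> \<Omega>" "q \<otimes>\<^bsub>W\<^esub> s \<notin> \<Omega>"
    "rr \<gamma> \<otimes>\<^bsub>W\<^esub> u = q \<otimes>\<^bsub>W\<^esub> s"
  shows "q = u"
proof -
  have main: ?thesis if \<gamma>: "\<gamma> \<in> \<Phi>" "act (inv\<^bsub>W\<^esub> z) \<gamma> \<in> \<Phi>\<^sup>+" "rr \<gamma> \<otimes>\<^bsub>W\<^esub> u = q \<otimes>\<^bsub>W\<^esub> s" for \<gamma>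
  proof (rule ccontr)
    assume ne: "q \<noteq> u"
    have W: "u \<in> carrier W" "q \<in> carrier W" "rr \<gamma> \<in> carrier W" "s \<in> carrier W"
      using assms \<gamma> s_W[OF \<alpha> s] by (auto simp: lower_set_def root_refl_W)
    have low: "rr \<gamma> \<otimes>\<^bsub>W\<^esub> v \<in> \<Omega>" if "v \<in> \<Omega>" "act (inv\<^bsub>W\<^esub> v) \<gamma> \<notin> \<Phi>\<^sup>+" for v
      using assms that \<gamma> unfolding lower_set_def by blast
    have "act (inv\<^bsub>W\<^esub> u) \<gamma> \<in> \<Phi>\<^sup>+" using low[OF assms(4)] \<gamma>(3) assms(7) by auto
    then have "act (inv\<^bsub>W\<^esub> u) (- \<gamma>) \<notin> \<Phi>\<^sup>+" using pos_not_neg W by (simp add: act_neg)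
    from neg_shift[OF W(1) neg_aff_root[OF \<gamma>(1)] this]
    have "rr \<gamma> \<otimes>\<^bsub>W\<^esub> u = u \<otimes>\<^bsub>W\<^esub> s \<or> act (inv\<^bsub>W\<^esub> (u \<otimes>\<^bsub>W\<^esub> s)) (- \<gamma>) \<notin> \<Phi>\<^sup>+"
      by (simp add: root_refl_neg \<gamma>)
    moreover have "rr \<gamma> \<otimes>\<^bsub>W\<^esub> u \<noteq> u \<otimes>\<^bsub>W\<^esub> s" using ne \<gamma>(3) W by simp
    ultimately have "act (inv\<^bsub>W\<^esub> (u \<otimes>\<^bsub>W\<^esub> s)) \<gamma> \<in> \<Phi>\<^sup>+"
      using pos_or_neg[OF act_root[OF _ \<gamma>(1)], of "inv\<^bsub>W\<^esub> (u \<otimes>\<^bsub>W\<^esub> s)"] W by (auto simp: act_neg)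
    then have n: "act (inv\<^bsub>W\<^esub> (rr \<gamma> \<otimes>\<^bsub>W\<^esub> (u \<otimes>\<^bsub>W\<^esub> s))) \<gamma> \<notin> \<Phi>\<^sup>+"
      using pos_not_neg W \<gamma> act_inv_reflected[of "u \<otimes>\<^bsub>W\<^esub> s" \<gamma>] by simp
    have "rr \<gamma> \<otimes>\<^bsub>W\<^esub> (u \<otimes>\<^bsub>W\<^esub> s) = rr \<gamma> \<otimes>\<^bsub>W\<^esub> u \<otimes>\<^bsub>W\<^esub> s" using W by (simp add: W.m_assoc)
    also have "\<dots> = q" unfolding \<gamma>(3) by (rule mult_s_s[OF \<alpha> s W(2)])
    finally have q: "rr \<gamma> \<otimes>\<^bsub>W\<^esub> (u \<otimes>\<^bsub>W\<^esub> s) = q" .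
    then have "rr \<gamma> \<otimes>\<^bsub>W\<^esub> q \<in> \<Omega>" using low[OF assms(5)] n by simp
    moreover have "rr \<gamma> \<otimes>\<^bsub>W\<^esub> q = u \<otimes>\<^bsub>W\<^esub> s"
      unfolding q[symmetric] using W \<gamma> by (simp add: root_refl_mult_cancel)
    ultimately show False using assms(6) by simp
  qed
  show ?thesis
  proof (cases "act (inv\<^bsub>W\<^esub> z) \<gamma> \<in> \<Phi>\<^sup>+")
    case True
    then show ?thesis using main assms by blast
  next
    case False
    then have "act (inv\<^bsub>W\<^esub> z) (- \<gamma>) \<in> \<Phi>\<^sup>+"
      using pos_or_neg[OF act_root[OF _ assms(3)]] assms(2) by (auto simp: act_neg)
    then show ?thesis
      using main[of "- \<gamma>"] assms by (simp add: neg_aff_root root_refl_neg)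
  qed
qed

end
end

context good_sheaf
begin

definition extends_sections :: bool where
  "extends_sections \<longleftrightarrow> (\<forall>z\<in>carrier W. \<forall>\<Omega>. lower_set z \<Omega> \<longrightarrow>
     (\<forall>m\<in>sec \<Omega>. \<exists>n\<in>sec (carrier W). \<forall>x\<in>\<Omega>. n x = m x))"

section \<open>Stalks and agreement for the translated sheaf\<close>

context
  fixes \<alpha> s
  assumes \<alpha>: "\<alpha> \<in> \<Delta>" and s: "s = rr \<alpha>"
begin

abbreviation Th where "Th \<equiv> theta R B s M"
abbreviation "pcs \<equiv> pair_coset R s"

lemmas s_W = s_W[OF \<alpha> s] and mult_s_s = mult_s_s[OF \<alpha> s] and mult_s_ne = mult_s_ne[OF \<alpha> s]
  and mult_s_eq_iff = mult_s_eq_iff[OF \<alpha> s] and pc_eq = pc_eq[OF \<alpha> s] and pc_mult_s = pc_mult_s[OF \<alpha> s]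
  and pc_eq_iff = pc_eq_iff[OF \<alpha> s] and act_mult_s = act_mult_s[OF \<alpha> s]
  and act_simple_root = act_simple_root[OF \<alpha> s] and simple_edge = simple_edge[OF \<alpha> s]
  and simple_edge_root = simple_edge_root[OF \<alpha> s] and edge_shift = edge_shift[OF \<alpha> s]
  and edge_ne_shift = edge_ne_shift[OF \<alpha> s] and edge_lifts_eq = edge_lifts_eq[OF \<alpha> s]

lemma pc_W: "x \<in> carrier W \<Longrightarrow> pcs x \<subseteq> carrier W"
  using s_W by (auto simp: pc_eq)

lemma Th_stalk: "stalk Th x = map_module Fam fam (sections M (pcs x))"
  by (simp add: theta_def theta_out_def theta_on_def)

lemma Th_stalk_mult_s: "x \<in> carrier W \<Longrightarrow> stalk Th (x \<otimes>\<^bsub>W\<^esub> s) = stalk Th x"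
  by (simp add: Th_stalk pc_mult_s)

lemma Th_Fam: "m \<in> sec (pcs x) \<Longrightarrow> Fam m \<in> carrier (stalk Th x)"
  by (simp add: Th_stalk map_module_def sec_def)

lemma Th_fam: "u \<in> carrier (stalk Th x) \<Longrightarrow> fam u \<in> sec (pcs x)"
  by (auto simp: Th_stalk map_module_def sec_def)

lemma Th_Fam_fam: "u \<in> carrier (stalk Th x) \<Longrightarrow> Fam (fam u) = u"
  by (auto simp: Th_stalk map_module_def sec_def)

lemma Th_fam_mem: "u \<in> carrier (stalk Th x) \<Longrightarrow> z \<in> pcs x \<Longrightarrow> fam u z \<in> carrier (st z)"
  using Th_fam sec_mem by blast

lemma Th_eqI:
  assumes "u \<in> carrier (stalk Th x)" "v \<in> carrier (stalk Th x)" "\<And>z. z \<in> pcs x \<Longrightarrow> fam u z = fam v z"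
  shows "u = v"
  using sec_eqI[OF Th_fam[OF assms(1)] Th_fam[OF assms(2)] assms(3)] Th_Fam_fam[OF assms(1)]
    Th_Fam_fam[OF assms(2)] by metis

lemma Th_add: "z \<in> pcs x \<Longrightarrow> fam (u \<oplus>\<^bsub>stalk Th x\<^esub> v) z = fam u z \<oplus>\<^bsub>st z\<^esub> fam v z"
  and Th_smult: "z \<in> pcs x \<Longrightarrow> fam (a \<odot>\<^bsub>stalk Th x\<^esub> u) z = a \<odot>\<^bsub>st z\<^esub> fam u z"
  and Th_zero: "z \<in> pcs x \<Longrightarrow> fam \<zero>\<^bsub>stalk Th x\<^esub> z = \<zero>\<^bsub>st z\<^esub>"
  by (simp_all add: Th_stalk map_module_def sections_ops)

lemma module_Th: "x \<in> carrier W \<Longrightarrow> Module.module S (stalk Th x)"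
  unfolding Th_stalk using module_sections pc_W by (intro module_map_module) auto

lemma agree_Th_same:
  assumes "is_edge x y \<gamma>" "y = x \<otimes>\<^bsub>W\<^esub> s" "u \<in> carrier (stalk Th x)" "v \<in> carrier (stalk Th x)"
  shows "agrees Th x y \<gamma> u v \<longleftrightarrow>
    (\<exists>p\<in>carrier (stalk Th x). u = lab \<gamma> \<odot>\<^bsub>stalk Th x\<^esub> p \<oplus>\<^bsub>stalk Th x\<^esub> v)"
proof -
  have "agrees Th x y \<gamma> u v \<longleftrightarrow> smult_image (stalk Th x) (lab \<gamma>) +>\<^bsub>stalk Th x\<^esub> u
      = smult_image (stalk Th x) (lab \<gamma>) +>\<^bsub>stalk Th x\<^esub> v"
    using assms(2) by (simp add: agrees_def theta_def theta_out_def)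
  also have "\<dots> \<longleftrightarrow> (\<exists>p\<in>carrier (stalk Th x). u = lab \<gamma> \<odot>\<^bsub>stalk Th x\<^esub> p \<oplus>\<^bsub>stalk Th x\<^esub> v)"
    using module_Th is_edgeD[OF assms(1)] assms by (intro coset_smult_image_eq_iff) (auto simp: lab_root_S)
  finally show ?thesis .
qed

text \<open>The edge of the quotient graph has exactly the two lifts E and Es, and its restriction
  map records the images along both.\<close>

lemma agree_Th_other:
  assumes "is_edge x y \<gamma>" "y \<noteq> x \<otimes>\<^bsub>W\<^esub> s"
  shows "agrees Th x y \<gamma> u v \<longleftrightarrow> agree x y \<gamma> (fam u x) (fam v y) \<and>
    agree (x \<otimes>\<^bsub>W\<^esub> s) (y \<otimes>\<^bsub>W\<^esub> s) \<gamma> (fam u (x \<otimes>\<^bsub>W\<^esub> s)) (fam v (y \<otimes>\<^bsub>W\<^esub> s))"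
proof -
  have res: "res Th z (x, y, \<gamma>) w = Fam (\<lambda>E\<in>{(x, y, \<gamma>), (x \<otimes>\<^bsub>W\<^esub> s, y \<otimes>\<^bsub>W\<^esub> s, \<gamma>)}.
      res M (end_in (pcs z) E) E (fam w (end_in (pcs z) E)))" for z w
    using assms(2) edge_lifts_eq[OF assms graph_M]
    by (simp add: theta_def theta_out_def theta_on_def on_res_def)
  have "x \<in> pcs x" "x \<otimes>\<^bsub>W\<^esub> s \<in> pcs x" by (auto simp: pc_eq)
  then show ?thesis
    using edge_ne_shift[OF assms] by (simp add: agrees_def res restrict_eq_restrict_iff)
qed

lemma agree_Th_shift:
  assumes "is_edge x y \<gamma>" "y \<noteq> x \<otimes>\<^bsub>W\<^esub> s"
  shows "agrees Th (x \<otimes>\<^bsub>W\<^esub> s) (y \<otimes>\<^bsub>W\<^esub> s) \<gamma> u v \<longleftrightarrow> agrees Th x y \<gamma> u v"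
  using agree_Th_other[OF assms] agree_Th_other[OF edge_shift[OF assms] edge_ne_shift(2)[OF assms]]
    is_edgeD[OF assms(1)] by (auto simp: mult_s_s)

text \<open>Divide at the two vertices of the pair separately. The quotients agree on the edge
  between them, as \<gamma> times the quotient and \<delta> times it are both sections, and one of
  the two labels can be cancelled on that edge.\<close>

lemma Th_divisible:
  assumes "x \<in> carrier W" "\<gamma> \<in> \<Phi>" "\<delta> \<in> \<Phi>" "\<not> prp (lab \<delta>) (lab \<gamma>)"
    "m \<in> carrier (stalk Th x)" "n \<in> carrier (stalk Th x)"
    "lab \<delta> \<odot>\<^bsub>stalk Th x\<^esub> m = lab \<gamma> \<odot>\<^bsub>stalk Th x\<^esub> n"
  shows "\<exists>p\<in>carrier (stalk Th x). m = lab \<gamma> \<odot>\<^bsub>stalk Th x\<^esub> p"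
proof -
  interpret N: module S "stalk Th x" by (rule module_Th[OF assms(1)])
  have ex: "\<exists>p\<in>carrier (st z). fam m z = lab \<gamma> \<odot>\<^bsub>st z\<^esub> p" if z: "z \<in> pcs x" for z
  proof (rule divisible[OF _ assms(2,3,4)])
    show "lab \<delta> \<odot>\<^bsub>st z\<^esub> fam m z = lab \<gamma> \<odot>\<^bsub>st z\<^esub> fam n z"
      using assms(7) Th_smult[OF z] by metis
  qed (use z pc_W assms Th_fam_mem in auto)
  then obtain p where p: "\<And>z. z \<in> pcs x \<Longrightarrow> p z \<in> carrier (st z)"
    "\<And>z. z \<in> pcs x \<Longrightarrow> fam m z = lab \<gamma> \<odot>\<^bsub>st z\<^esub> p z" by metis
  have zW: "z \<in> carrier W" if "z \<in> pcs x" for z using that pc_W assms by blast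
  \<comment> \<open>Both sides agree after multiplication by the label of \<gamma>, which torsion
    freeness lets one cancel.\<close>
  have n: "fam n z = lab \<delta> \<odot>\<^bsub>st z\<^esub> p z" if z: "z \<in> pcs x" for z
  proof -
    interpret st: module S "st z" by (rule stalk_module[OF zW[OF z]])
    have nz: "fam n z \<in> carrier (st z)" using Th_fam_mem assms z by blast
    have l: "lab \<gamma> \<in> carrier S" "lab \<delta> \<in> carrier S" using assms lab_root_S by auto
    have "lab \<gamma> \<odot>\<^bsub>st z\<^esub> fam n z = lab \<delta> \<odot>\<^bsub>st z\<^esub> fam m z"
      using assms(7) Th_smult[OF z] by metis
    also have "\<dots> = lab \<gamma> \<odot>\<^bsub>st z\<^esub> (lab \<delta> \<odot>\<^bsub>st z\<^esub> p z)"
      using p[OF z] l S.m_comm by (simp flip: st.smult_assoc1)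
    finally have "lab \<gamma> \<odot>\<^bsub>st z\<^esub> (fam n z \<ominus>\<^bsub>st z\<^esub> lab \<delta> \<odot>\<^bsub>st z\<^esub> p z) = \<zero>\<^bsub>st z\<^esub>"
      using p[OF z] l nz by (simp add: a_minus_def st.smult_r_distr st.smult_r_minus st.M.r_neg)
    from torsion_free[OF zW[OF z] assms(2) _ this] show ?thesis
      using nz p[OF z] l by (simp add: st.M.diff_eq_zero_iff)
  qed
  have "restrict p (pcs x) \<in> sec (pcs x)"
  proof (rule secI)
    fix u v \<epsilon> assume e: "is_edge u v \<epsilon>" "u \<in> pcs x" "v \<in> pcs x"
    have \<epsilon>: "\<epsilon> \<in> \<Phi>" using is_edgeD[OF e(1)] by blast
    have pm: "p u \<in> carrier (st u)" "p v \<in> carrier (st v)" using p e by auto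
    \<comment> \<open>The labels of \<gamma> and \<delta> cannot both be proportional to that of
      \<epsilon>, as they would then be proportional to each other.\<close>
    show "agree u v \<epsilon> (p u) (p v)"
    proof (cases "prp (lab \<gamma>) (lab \<epsilon>)")
      case False
      have "agree u v \<epsilon> (fam m u) (fam m v)" using sec_agree[OF Th_fam] assms e by blast
      then show ?thesis using agree_cancel[OF e(1) assms(2) False pm] p(2) e by simp
    next
      case True
      then have "\<not> prp (lab \<delta>) (lab \<epsilon>)" using prp_trans[OF assms(3,2) \<epsilon>] assms(4) by blast
      moreover have "agree u v \<epsilon> (fam n u) (fam n v)" using sec_agree[OF Th_fam] assms e by blast
      ultimately show ?thesis using agree_cancel[OF e(1) assms(3) _ pm] n e by simp
    qed
  qed (rule p)
  then have P: "Fam (restrict p (pcs x)) \<in> carrier (stalk Th x)" by (rule Th_Fam)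
  moreover have "m = lab \<gamma> \<odot>\<^bsub>stalk Th x\<^esub> Fam (restrict p (pcs x))"
    by (rule Th_eqI[OF assms(5)]) (use P assms in \<open>auto simp: lab_root_S Th_smult p(2)\<close>)
  ultimately show ?thesis by blast
qed

abbreviation Js where "Js \<equiv> J \<union> (\<lambda>x. x \<otimes>\<^bsub>W\<^esub> s) ` J"

lemma notin_Js: "z \<in> carrier W \<Longrightarrow> z \<notin> Js \<Longrightarrow> z \<notin> J" "z \<in> carrier W \<Longrightarrow> z \<notin> Js \<Longrightarrow> z \<otimes>\<^bsub>W\<^esub> s \<notin> J"
  using imageI[of "z \<otimes>\<^bsub>W\<^esub> s" J "\<lambda>x. x \<otimes>\<^bsub>W\<^esub> s"] mult_s_s[of z] by auto

lemma Js_mult_s: "z \<in> Js \<Longrightarrow> z \<otimes>\<^bsub>W\<^esub> s \<in> Js"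
  using J_W mult_s_s by auto

lemma good_Th: "good_sheaf R B Th Js"
proof (intro good_sheaf.intro[OF labelled_root_system_axioms] good_sheaf_axioms.intro, goal_cases)
  case 1
  show ?case by (simp add: theta_def theta_out_def)
next
  case 2
  show ?case using J_W s_W by auto
next
  case (3 x)
  then show ?case by (rule module_Th)
next
  case (4 x \<gamma> m)
  interpret N: module S "stalk Th x" by (rule module_Th[OF 4(1)])
  show ?case
  proof (rule Th_eqI[OF 4(3) N.M.zero_closed])
    fix z assume z: "z \<in> pcs x"
    have "lab \<gamma> \<odot>\<^bsub>st z\<^esub> fam m z = \<zero>\<^bsub>st z\<^esub>"
      using Th_smult[OF z, of "lab \<gamma>" m] 4(4) Th_zero[OF z] by simp
    then show "fam m z = fam \<zero>\<^bsub>stalk Th x\<^esub> z"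
      using torsion_free[of z \<gamma> "fam m z"] z pc_W 4 Th_fam_mem by (auto simp: Th_zero)
  qed
next
  case (5 x \<gamma> \<delta> m n)
  then show ?case by (rule Th_divisible)
next
  case (6 x y \<gamma> m m' n n')
  note e = is_edgeD[OF 6(1)]
  show ?case
  proof (cases "y = x \<otimes>\<^bsub>W\<^esub> s")
    case True
    interpret N: module S "stalk Th x" by (rule module_Th[OF e(1)])
    have st: "stalk Th y = stalk Th x" using True e by (simp add: Th_stalk_mult_s)
    obtain p where p: "p \<in> carrier (stalk Th x)" "m = lab \<gamma> \<odot>\<^bsub>stalk Th x\<^esub> p \<oplus>\<^bsub>stalk Th x\<^esub> n"
      using 6 st agree_Th_same[OF 6(1) True] by auto
    obtain p' where p': "p' \<in> carrier (stalk Th x)" "m' = lab \<gamma> \<odot>\<^bsub>stalk Th x\<^esub> p' \<oplus>\<^bsub>stalk Th x\<^esub> n'"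
      using 6 st agree_Th_same[OF 6(1) True] by auto
    have "m \<oplus>\<^bsub>stalk Th x\<^esub> m' = lab \<gamma> \<odot>\<^bsub>stalk Th x\<^esub> (p \<oplus>\<^bsub>stalk Th x\<^esub> p') \<oplus>\<^bsub>stalk Th x\<^esub> (n \<oplus>\<^bsub>stalk Th x\<^esub> n')"
      using p p' 6 e st by (simp add: N.smult_r_distr N.M.a_ac lab_root_S)
    then show ?thesis
      unfolding st using p p' 6(2-5) st e by (subst agree_Th_same[OF 6(1) True]) (auto simp: lab_root_S)
  next
    case False
    note sh = edge_shift[OF 6(1) False] and es = is_edgeD[OF edge_shift[OF 6(1) False]]
    have "x \<in> pcs x" "x \<otimes>\<^bsub>W\<^esub> s \<in> pcs x" "y \<in> pcs y" "y \<otimes>\<^bsub>W\<^esub> s \<in> pcs y" by (auto simp: pc_eq)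
    then show ?thesis
      using 6 by (auto simp: agree_Th_other[OF 6(1) False] Th_add Th_fam_mem
          intro!: agree_add[OF 6(1)] agree_add[OF sh])
  qed
next
  case (7 x y \<gamma> a m n)
  note e = is_edgeD[OF 7(1)]
  show ?case
  proof (cases "y = x \<otimes>\<^bsub>W\<^esub> s")
    case True
    interpret N: module S "stalk Th x" by (rule module_Th[OF e(1)])
    have st: "stalk Th y = stalk Th x" using True e by (simp add: Th_stalk_mult_s)
    obtain p where p: "p \<in> carrier (stalk Th x)" "m = lab \<gamma> \<odot>\<^bsub>stalk Th x\<^esub> p \<oplus>\<^bsub>stalk Th x\<^esub> n"
      using 7 st agree_Th_same[OF 7(1) True] by auto
    have "a \<odot>\<^bsub>stalk Th x\<^esub> m = lab \<gamma> \<odot>\<^bsub>stalk Th x\<^esub> (a \<odot>\<^bsub>stalk Th x\<^esub> p) \<oplus>\<^bsub>stalk Th x\<^esub> a \<odot>\<^bsub>stalk Th x\<^esub> n"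
      using p 7 e st S.m_comm by (simp add: N.smult_r_distr lab_root_S flip: N.smult_assoc1)
    then show ?thesis
      unfolding st using p 7(2-4) st e by (subst agree_Th_same[OF 7(1) True]) (auto simp: lab_root_S)
  next
    case False
    note sh = edge_shift[OF 7(1) False]
    have "x \<in> pcs x" "x \<otimes>\<^bsub>W\<^esub> s \<in> pcs x" "y \<in> pcs y" "y \<otimes>\<^bsub>W\<^esub> s \<in> pcs y" by (auto simp: pc_eq)
    then show ?thesis
      using 7 by (auto simp: agree_Th_other[OF 7(1) False] Th_smult Th_fam_mem
          intro!: agree_smult[OF 7(1)] agree_smult[OF sh])
  qed
next
  case (8 x y \<gamma> m n)
  note e = is_edgeD[OF 8(1)]
  show ?case
  proof (cases "y = x \<otimes>\<^bsub>W\<^esub> s")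
    case True
    interpret N: module S "stalk Th x" by (rule module_Th[OF e(1)])
    have st: "stalk Th y = stalk Th x" using True e by (simp add: Th_stalk_mult_s)
    have "lab \<gamma> \<odot>\<^bsub>stalk Th x\<^esub> m = lab \<gamma> \<odot>\<^bsub>stalk Th x\<^esub> (m \<ominus>\<^bsub>stalk Th x\<^esub> n) \<oplus>\<^bsub>stalk Th x\<^esub> lab \<gamma> \<odot>\<^bsub>stalk Th x\<^esub> n"
      using 8 e st
      by (simp add: N.smult_r_distr lab_root_S a_minus_def N.smult_r_minus N.M.a_assoc N.M.l_neg)
    then show ?thesis
      unfolding st using 8 st e by (subst agree_Th_same[OF 8(1) True]) (auto simp: lab_root_S)
  next
    case False
    note sh = edge_shift[OF 8(1) False]
    have "x \<in> pcs x" "x \<otimes>\<^bsub>W\<^esub> s \<in> pcs x" "y \<in> pcs y" "y \<otimes>\<^bsub>W\<^esub> s \<in> pcs y" by (auto simp: pc_eq)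
    then show ?thesis
      using 8 by (auto simp: agree_Th_other[OF 8(1) False] Th_smult Th_fam_mem
          intro!: agree_label[OF 8(1)] agree_label[OF sh])
  qed
next
  case (9 x y \<gamma> \<delta> m n)
  note e = is_edgeD[OF 9(1)]
  show ?case
  proof (cases "y = x \<otimes>\<^bsub>W\<^esub> s")
    case True
    interpret N: module S "stalk Th x" by (rule module_Th[OF e(1)])
    have st: "stalk Th y = stalk Th x" using True e by (simp add: Th_stalk_mult_s)
    have l: "lab \<gamma> \<in> carrier S" "lab \<delta> \<in> carrier S" using 9 e lab_root_S by auto
    obtain p where p: "p \<in> carrier (stalk Th x)"
      "lab \<delta> \<odot>\<^bsub>stalk Th x\<^esub> m = lab \<gamma> \<odot>\<^bsub>stalk Th x\<^esub> p \<oplus>\<^bsub>stalk Th x\<^esub> lab \<delta> \<odot>\<^bsub>stalk Th x\<^esub> n"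
      using 9 st l agree_Th_same[OF 9(1) True] by auto
    \<comment> \<open>On the edge from x to xs agreement is congruence modulo the label, so
      cancelling becomes divisibility of the difference.\<close>
    have "lab \<delta> \<odot>\<^bsub>stalk Th x\<^esub> (m \<ominus>\<^bsub>stalk Th x\<^esub> n) = lab \<gamma> \<odot>\<^bsub>stalk Th x\<^esub> p"
      using 9 st l p
      by (simp add: N.smult_r_distr a_minus_def N.smult_r_minus N.M.a_assoc N.M.r_neg)
    then obtain q where q: "q \<in> carrier (stalk Th x)"
      "m \<ominus>\<^bsub>stalk Th x\<^esub> n = lab \<gamma> \<odot>\<^bsub>stalk Th x\<^esub> q"
      using Th_divisible[OF e(1,3) 9(2,3), of "m \<ominus>\<^bsub>stalk Th x\<^esub> n" p] 9 st p by auto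
    have "m = (m \<ominus>\<^bsub>stalk Th x\<^esub> n) \<oplus>\<^bsub>stalk Th x\<^esub> n"
      using 9 st by (simp add: a_minus_def N.M.a_assoc N.M.l_neg)
    then show ?thesis
      using 9 st q by (subst agree_Th_same[OF 9(1) True]) auto
  next
    case False
    note sh = edge_shift[OF 9(1) False]
    have "x \<in> pcs x" "x \<otimes>\<^bsub>W\<^esub> s \<in> pcs x" "y \<in> pcs y" "y \<otimes>\<^bsub>W\<^esub> s \<in> pcs y" by (auto simp: pc_eq)
    then show ?thesis
      using 9 by (auto simp: agree_Th_other[OF 9(1) False] Th_smult Th_fam_mem
          intro: agree_cancel[OF 9(1-3)] agree_cancel[OF sh 9(2,3)])
  qed
next
  case (10 x m)
  interpret N: module S "stalk Th x" by (rule module_Th[OF 10(1)])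
  note notin_Js[OF 10(1,2)]
  then show ?case
    using 10 s_W Th_fam_mem[OF 10(3)]
    by (intro Th_eqI[OF 10(3) N.M.zero_closed]) (auto simp: pc_eq Th_zero intro!: support)
next
  case (11 x y \<gamma> m n)
  note e = is_edgeD[OF 11(1)]
  show ?case
  proof (cases "y = x \<otimes>\<^bsub>W\<^esub> s")
    case True
    then have "x \<notin> Js" using 11(2) Js_mult_s by blast
    note nj = notin_Js[OF e(1) this]
    interpret N: module S "stalk Th x" by (rule module_Th[OF e(1)])
    have st: "stalk Th y = stalk Th x" using True e by (simp add: Th_stalk_mult_s)
    have zero: "u = \<zero>\<^bsub>stalk Th x\<^esub>" if "u \<in> carrier (stalk Th x)" for u
      using nj e s_W Th_fam_mem[OF that]
      by (intro Th_eqI[OF that N.M.zero_closed]) (auto simp: pc_eq Th_zero intro!: support)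
    show ?thesis
      using 11 st e zero[of m] zero[of n]
      by (subst agree_Th_same[OF 11(1) True]) (auto simp: lab_root_S intro!: bexI[of _ "\<zero>\<^bsub>stalk Th x\<^esub>"])
  next
    case False
    note sh = edge_shift[OF 11(1) False]
    have "x \<in> pcs x" "x \<otimes>\<^bsub>W\<^esub> s \<in> pcs x" "y \<in> pcs y" "y \<otimes>\<^bsub>W\<^esub> s \<in> pcs y" by (auto simp: pc_eq)
    \<comment> \<open>A vertex outside the enlarged support has its partner outside \<open>J\<close>
      too, so both lifts of the edge are vacuous.\<close>
    moreover have "(x \<notin> J \<and> x \<otimes>\<^bsub>W\<^esub> s \<notin> J) \<or> (y \<notin> J \<and> y \<otimes>\<^bsub>W\<^esub> s \<notin> J)"
      using 11(2) notin_Js[OF e(1)] notin_Js[OF e(2)] by blast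
    ultimately show ?thesis
      unfolding agree_Th_other[OF 11(1) False] using 11(3,4) Th_fam_mem
      by (intro conjI support_edge[OF 11(1)] support_edge[OF sh]) blast+
  qed
qed

subsection \<open>Extension of sections\<close>

interpretation T: good_sheaf R B F Th Js
  by (rule good_Th)

abbreviation "Nst \<equiv> stalk Th"

text \<open>Makes a section of \<open>M\<close> into one of the translated sheaf, constant on pairs;
  it is the counterpart on sheaves of the map \<open>dup\<close> on functions of
  subsequences.\<close>

definition incl :: "('v aff_map \<Rightarrow> ('v, 'f) vert_elt) \<Rightarrow> 'v aff_map \<Rightarrow> ('v, 'f) vert_elt" where
  "incl b x = Fam (restrict b (pcs x))"

abbreviation cw :: "'v aff_map \<Rightarrow> ('v, 'f) sym" where "cw x \<equiv> lab (act x \<alpha>)"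

definition stable :: "'v aff_map set \<Rightarrow> bool" where
  "stable \<Omega> \<longleftrightarrow> \<Omega> \<subseteq> carrier W \<and> (\<forall>x\<in>\<Omega>. x \<otimes>\<^bsub>W\<^esub> s \<in> \<Omega>)"

lemma stable_pcs: "stable \<Omega> \<Longrightarrow> x \<in> \<Omega> \<Longrightarrow> pcs x \<subseteq> \<Omega>"
  by (auto simp: stable_def pc_eq)

lemma cw_S: "x \<in> carrier W \<Longrightarrow> cw x \<in> carrier S"
  by (simp add: act_simple_root lab_root_S)

lemma cw_edge:
  assumes "is_edge x y \<gamma>"
  shows "\<exists>e\<in>carrier S. cw x = cw y \<oplus>\<^bsub>S\<^esub> lab \<gamma> \<otimes>\<^bsub>S\<^esub> e"
proof -
  note e = is_edgeD[OF assms]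
  have "act y \<alpha> = lin_refl R \<gamma> (act x \<alpha>)"
    using e by (simp add: act_mult root_refl_W act_root_refl)
  then show ?thesis
    using lab_lin_refl[OF e(3) root_X[OF act_simple_root[OF e(1)]]] by metis
qed

lemma incl_mem: "stable \<Omega> \<Longrightarrow> b \<in> sec \<Omega> \<Longrightarrow> x \<in> \<Omega> \<Longrightarrow> incl b x \<in> carrier (Nst x)"
  unfolding incl_def by (intro Th_Fam sec_restrict stable_pcs)

lemma incl_mult_s: "x \<in> carrier W \<Longrightarrow> incl b (x \<otimes>\<^bsub>W\<^esub> s) = incl b x"
  by (simp add: incl_def pc_mult_s)

lemma fam_incl: "z \<in> pcs x \<Longrightarrow> fam (incl b x) z = b z"
  by (simp add: incl_def)

lemma incl_sec:
  assumes "stable \<Omega>" "b \<in> sec \<Omega>"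
  shows "restrict (incl b) \<Omega> \<in> T.sec \<Omega>"
proof (rule T.secI)
  fix x y \<gamma> assume xy: "is_edge x y \<gamma>" "x \<in> \<Omega>" "y \<in> \<Omega>"
  note e = is_edgeD[OF xy(1)]
  show "T.agree x y \<gamma> (incl b x) (incl b y)"
  proof (cases "y = x \<otimes>\<^bsub>W\<^esub> s")
    case True
    interpret N: module S "Nst x" by (rule T.stalk_module[OF e(1)])
    have eq: "incl b y = incl b x" using True e(1) by (simp add: incl_mult_s)
    show ?thesis
      unfolding eq using e(3) incl_mem[OF assms xy(2)]
      by (subst agree_Th_same[OF xy(1) True])
        (auto simp: lab_root_S intro!: bexI[of _ "\<zero>\<^bsub>Nst x\<^esub>"])
  next
    case False
    have "x \<otimes>\<^bsub>W\<^esub> s \<in> \<Omega>" "y \<otimes>\<^bsub>W\<^esub> s \<in> \<Omega>" using assms(1) xy by (auto simp: stable_def)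
    then show ?thesis
      using sec_agree[OF assms(2) xy] sec_agree[OF assms(2) edge_shift[OF xy(1) False]]
      by (simp add: agree_Th_other[OF xy(1) False] fam_incl pc_eq)
  qed
qed (rule incl_mem[OF assms])

definition combo :: "('v aff_map \<Rightarrow> ('v, 'f) vert_elt) \<Rightarrow> ('v aff_map \<Rightarrow> ('v, 'f) vert_elt) \<Rightarrow>
    'v aff_map \<Rightarrow> ('v, 'f) vert_elt" where
  "combo b a x = incl b x \<oplus>\<^bsub>Nst x\<^esub> cw x \<odot>\<^bsub>Nst x\<^esub> incl a x"

lemma combo_sec:
  assumes "stable \<Omega>" "b \<in> sec \<Omega>" "a \<in> sec \<Omega>"
  shows "restrict (combo b a) \<Omega> \<in> T.sec \<Omega>"
proof -
  have \<Omega>: "\<Omega> \<subseteq> carrier W" using assms by (simp add: stable_def)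
  have "(\<lambda>x\<in>\<Omega>. cw x \<odot>\<^bsub>Nst x\<^esub> restrict (incl a) \<Omega> x) \<in> T.sec \<Omega>"
    using \<Omega> cw_S cw_edge by (intro T.sec_scalars[OF \<Omega> incl_sec[OF assms(1,3)]]) auto
  from T.sec_add[OF \<Omega> incl_sec[OF assms(1,2)] this]
  have "(\<lambda>x\<in>\<Omega>. restrict (incl b) \<Omega> x \<oplus>\<^bsub>Nst x\<^esub> (\<lambda>x\<in>\<Omega>. cw x \<odot>\<^bsub>Nst x\<^esub> restrict (incl a) \<Omega> x) x) \<in> T.sec \<Omega>" .
  moreover have "(\<lambda>x\<in>\<Omega>. restrict (incl b) \<Omega> x \<oplus>\<^bsub>Nst x\<^esub> (\<lambda>x\<in>\<Omega>. cw x \<odot>\<^bsub>Nst x\<^esub> restrict (incl a) \<Omega> x) x)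
      = restrict (combo b a) \<Omega>"
    by (rule restrict_ext) (simp add: combo_def)
  ultimately show ?thesis by simp
qed

lemma split_edge:
  assumes "x \<in> carrier W" "act x \<alpha> \<in> \<Phi>\<^sup>+" "u \<in> carrier (Nst x)" "v \<in> carrier (Nst x)"
    "T.agree x (x \<otimes>\<^bsub>W\<^esub> s) (act x \<alpha>) u v"
  shows "\<exists>c\<in>carrier (Nst x). \<exists>d\<in>carrier (Nst x).
    u = d \<oplus>\<^bsub>Nst x\<^esub> cw x \<odot>\<^bsub>Nst x\<^esub> c \<and> v = d \<oplus>\<^bsub>Nst x\<^esub> cw (x \<otimes>\<^bsub>W\<^esub> s) \<odot>\<^bsub>Nst x\<^esub> c"
proof -
  interpret N: module S "Nst x" by (rule T.stalk_module[OF assms(1)])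
  note S = cw_S[OF assms(1)] half_S
  obtain p where p: "p \<in> carrier (Nst x)" "u = cw x \<odot>\<^bsub>Nst x\<^esub> p \<oplus>\<^bsub>Nst x\<^esub> v"
    using agree_Th_same[OF simple_edge[OF assms(1,2)] refl assms(3,4)] assms(5) by blast
  let ?c = "half \<odot>\<^bsub>Nst x\<^esub> p"
  have c: "?c \<in> carrier (Nst x)" "?c \<oplus>\<^bsub>Nst x\<^esub> ?c = p"
    using p S half_half by (simp_all flip: N.smult_l_distr)
  have cs: "cw (x \<otimes>\<^bsub>W\<^esub> s) = \<ominus>\<^bsub>S\<^esub> cw x"
    using assms by (simp add: act_mult_s lab_neg root_X act_simple_root)
  \<comment> \<open>The mean of u and v: the difference of u and v is twice \<open>cw x\<close>
    times \<open>?c\<close>.\<close>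
  let ?d = "v \<oplus>\<^bsub>Nst x\<^esub> cw x \<odot>\<^bsub>Nst x\<^esub> ?c"
  have "u = v \<oplus>\<^bsub>Nst x\<^esub> cw x \<odot>\<^bsub>Nst x\<^esub> (?c \<oplus>\<^bsub>Nst x\<^esub> ?c)"
    using p S assms c by (simp add: N.M.a_comm)
  also have "\<dots> = ?d \<oplus>\<^bsub>Nst x\<^esub> cw x \<odot>\<^bsub>Nst x\<^esub> ?c"
    using c(1) S assms(4) by (simp only: N.smult_r_distr N.M.a_assoc N.smult_closed)
  finally have "u = ?d \<oplus>\<^bsub>Nst x\<^esub> cw x \<odot>\<^bsub>Nst x\<^esub> ?c" .
  moreover have "v = ?d \<oplus>\<^bsub>Nst x\<^esub> cw (x \<otimes>\<^bsub>W\<^esub> s) \<odot>\<^bsub>Nst x\<^esub> ?c"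
    unfolding cs using S assms(4) c(1)
    by (simp only: N.smult_l_minus N.M.a_assoc N.smult_closed N.M.a_inv_closed N.M.r_neg N.M.r_zero)
  ultimately show ?thesis using c(1) S assms(4) by (intro bexI[of _ ?c] bexI[of _ ?d]) auto
qed

text \<open>The edge inside the pair starts at the vertex that sends \<alpha> to a positive root, so
  the computation is made from that end.\<close>

lemma split_coset:
  assumes "x \<in> \<Omega>" "stable \<Omega>" "m \<in> T.sec \<Omega>"
  shows "\<exists>c\<in>carrier (Nst x). \<exists>d\<in>carrier (Nst x). \<forall>z\<in>pcs x. m z = d \<oplus>\<^bsub>Nst x\<^esub> cw z \<odot>\<^bsub>Nst x\<^esub> c"
proof -
  have main: ?thesis if y: "y \<in> \<Omega>" "act y \<alpha> \<in> \<Phi>\<^sup>+" "pcs y = pcs x" "Nst y = Nst x" for y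
  proof -
    have yW: "y \<in> carrier W" "y \<otimes>\<^bsub>W\<^esub> s \<in> \<Omega>" using y assms by (auto simp: stable_def)
    have "m y \<in> carrier (Nst y)" "m (y \<otimes>\<^bsub>W\<^esub> s) \<in> carrier (Nst y)"
      using T.sec_mem[OF assms(3)] y yW Th_stalk_mult_s by (metis)+
    from split_edge[OF yW(1) y(2) this T.sec_agree[OF assms(3) simple_edge[OF yW(1) y(2)] y(1) yW(2)]]
    show ?thesis unfolding y(3)[symmetric] y(4)[symmetric] by (auto simp: pc_eq)
  qed
  have xW: "x \<in> carrier W" "x \<otimes>\<^bsub>W\<^esub> s \<in> \<Omega>" using assms by (auto simp: stable_def)
  show ?thesis
  proof (cases "act x \<alpha> \<in> \<Phi>\<^sup>+")
    case True
    then show ?thesis using main assms(1) by blast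
  next
    case False
    then have "act (x \<otimes>\<^bsub>W\<^esub> s) \<alpha> \<in> \<Phi>\<^sup>+"
      using pos_or_neg[OF act_simple_root[OF xW(1)]] xW by (simp add: act_mult_s)
    then show ?thesis using main[OF xW(2)] xW by (simp add: pc_mult_s Th_stalk_mult_s)
  qed
qed

definition cancellable :: bool where
  "cancellable \<longleftrightarrow> (\<forall>x y \<gamma>. is_edge x y \<gamma> \<longrightarrow> x \<in> J \<longrightarrow> y \<in> J \<longrightarrow> y \<noteq> x \<otimes>\<^bsub>W\<^esub> s \<longrightarrow>
     \<not> prp (cw x) (lab \<gamma>))"

text \<open>The GKM property enters only here: on an edge \<open>x \<rightarrow> y\<close> other than \<open>x \<rightarrow> xs\<close> the weight
  \<open>x(\<alpha>)\<close> of the decomposition can be cancelled.\<close>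

lemma decompose:
  assumes gkm: "cancellable"
    and st: "stable \<Omega>" and m: "m \<in> T.sec \<Omega>"
  shows "\<exists>b\<in>sec \<Omega>. \<exists>a\<in>sec \<Omega>. \<forall>x\<in>\<Omega>. m x = combo b a x"
proof -
  define good where "good X p \<longleftrightarrow> (\<forall>x\<in>X. fst p \<in> carrier (Nst x) \<and> snd p \<in> carrier (Nst x) \<and>
    m x = snd p \<oplus>\<^bsub>Nst x\<^esub> cw x \<odot>\<^bsub>Nst x\<^esub> fst p)" for X p
  \<comment> \<open>The choice depends on the coset alone, so the two components come out equal at x
    and at xs.\<close>
  define P where "P X = (SOME p. good X p)" for X
  have \<Omega>W: "x \<in> carrier W" if "x \<in> \<Omega>" for x using st that by (auto simp: stable_def)
  have good: "good (pcs x) (P (pcs x))" if x: "x \<in> \<Omega>" for x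
  proof -
    obtain c d where cd: "c \<in> carrier (Nst x)" "d \<in> carrier (Nst x)"
      "\<forall>z\<in>pcs x. m z = d \<oplus>\<^bsub>Nst x\<^esub> cw z \<odot>\<^bsub>Nst x\<^esub> c" using split_coset[OF x st m] by blast
    have "Nst z = Nst x" if "z \<in> pcs x" for z
      using that \<Omega>W[OF x] Th_stalk_mult_s by (auto simp: pc_eq)
    then have "good (pcs x) (c, d)" using cd by (simp add: good_def)
    then show ?thesis unfolding P_def by (rule someI)
  qed
  define A where "A x = fst (P (pcs x))" for x
  define D where "D x = snd (P (pcs x))" for x
  have x_cl: "x \<in> pcs x" for x by (simp add: pc_eq)
  have A: "A x \<in> carrier (Nst x)" and D: "D x \<in> carrier (Nst x)"
    and m_eq: "m x = D x \<oplus>\<^bsub>Nst x\<^esub> cw x \<odot>\<^bsub>Nst x\<^esub> A x" if "x \<in> \<Omega>" for x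
    using good[OF that] x_cl unfolding good_def A_def D_def by blast+
  have AD_s: "A (x \<otimes>\<^bsub>W\<^esub> s) = A x" "D (x \<otimes>\<^bsub>W\<^esub> s) = D x" if "x \<in> \<Omega>" for x
    using \<Omega>W[OF that] by (simp_all add: A_def D_def pc_mult_s)
  have agreeAD: "agree x y \<gamma> (fam (A x) x) (fam (A y) y) \<and> agree x y \<gamma> (fam (D x) x) (fam (D y) y)"
    if xy: "is_edge x y \<gamma>" "x \<in> \<Omega>" "y \<in> \<Omega>" for x y \<gamma>
  proof (cases "y = x \<otimes>\<^bsub>W\<^esub> s")
    case True
    have "y \<in> pcs x" using True by (simp add: pc_eq)
    then show ?thesis
      using sec_agree[OF Th_fam[OF A[OF xy(2)]] xy(1) x_cl] sec_agree[OF Th_fam[OF D[OF xy(2)]] xy(1) x_cl]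
        AD_s[OF xy(2)] True by simp
  next
    case False
    note e = is_edgeD[OF xy(1)]
    show ?thesis
    proof (cases "x \<in> J \<and> y \<in> J")
      case out: False
      have "x \<notin> J \<or> y \<notin> J" using out by blast
      then show ?thesis
        using support_edge[OF xy(1)] Th_fam_mem[OF A x_cl] Th_fam_mem[OF D x_cl] xy by blast
    next
      case True
      have np: "\<not> prp (cw x) (lab \<gamma>)" using gkm xy(1) True False unfolding cancellable_def by blast
      have xs: "x \<otimes>\<^bsub>W\<^esub> s \<in> \<Omega>" "y \<otimes>\<^bsub>W\<^esub> s \<in> \<Omega>" using st xy by (auto simp: stable_def)
      have Nx: "Nst (x \<otimes>\<^bsub>W\<^esub> s) = Nst x" "Nst (y \<otimes>\<^bsub>W\<^esub> s) = Nst y"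
        using e by (simp_all add: Th_stalk_mult_s)
      interpret Nx: module S "Nst x" by (rule T.stalk_module[OF e(1)])
      interpret Ny: module S "Nst y" by (rule T.stalk_module[OF e(2)])
      note cx = cw_S[OF e(1)] and cy = cw_S[OF e(2)]
      note mem = A[OF xy(2)] D[OF xy(2)] A[OF xy(3)] D[OF xy(3)]
      have cs: "cw (z \<otimes>\<^bsub>W\<^esub> s) = \<ominus>\<^bsub>S\<^esub> cw z" if "z \<in> carrier W" for z
        using that by (simp add: act_mult_s lab_neg root_X act_simple_root)
      have ms: "m (x \<otimes>\<^bsub>W\<^esub> s) = D x \<oplus>\<^bsub>Nst x\<^esub> (\<ominus>\<^bsub>S\<^esub> cw x) \<odot>\<^bsub>Nst x\<^esub> A x"
        "m (y \<otimes>\<^bsub>W\<^esub> s) = D y \<oplus>\<^bsub>Nst y\<^esub> (\<ominus>\<^bsub>S\<^esub> cw y) \<odot>\<^bsub>Nst y\<^esub> A y"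
        using m_eq[OF xs(1)] m_eq[OF xs(2)] AD_s xy e(1,2) cs by (simp_all add: Nx)
      have a1: "T.agree x y \<gamma> (m x) (m y)" by (rule T.sec_agree[OF m xy])
      have a2: "T.agree x y \<gamma> (m (x \<otimes>\<^bsub>W\<^esub> s)) (m (y \<otimes>\<^bsub>W\<^esub> s))"
        using T.sec_agree[OF m edge_shift[OF xy(1) False] xs] agree_Th_shift[OF xy(1) False] by blast
      have halve: "T.agree x y \<gamma> u v"
        if "u \<in> carrier (Nst x)" "v \<in> carrier (Nst y)" "T.agree x y \<gamma> (u \<oplus>\<^bsub>Nst x\<^esub> u) (v \<oplus>\<^bsub>Nst y\<^esub> v)" for u v
      proof -
        have "half \<odot>\<^bsub>Nst x\<^esub> (u \<oplus>\<^bsub>Nst x\<^esub> u) = u" "half \<odot>\<^bsub>Nst y\<^esub> (v \<oplus>\<^bsub>Nst y\<^esub> v) = v"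
          using that half_S half_half
          by (simp_all add: Nx.smult_r_distr Ny.smult_r_distr flip: Nx.smult_l_distr Ny.smult_l_distr)
        then show ?thesis using T.agree_smult[OF xy(1) half_S _ _ that(3)] that by simp
      qed
      \<comment> \<open>Adding the relations along E and Es cancels the weights, which have opposite
        signs at x and xs; what remains is twice the constant component.\<close>
      have aD: "T.agree x y \<gamma> (D x) (D y)"
      proof (rule halve[OF mem(2,4)])
        have "m x \<oplus>\<^bsub>Nst x\<^esub> m (x \<otimes>\<^bsub>W\<^esub> s) = D x \<oplus>\<^bsub>Nst x\<^esub> D x"
          unfolding m_eq[OF xy(2)] ms using mem cx
          by (simp add: Nx.smult_l_minus Nx.M.a_ac Nx.M.r_neg Nx.M.r_neg1 Nx.M.r_neg2)
        moreover have "m y \<oplus>\<^bsub>Nst y\<^esub> m (y \<otimes>\<^bsub>W\<^esub> s) = D y \<oplus>\<^bsub>Nst y\<^esub> D y"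
          unfolding m_eq[OF xy(3)] ms using mem cy
          by (simp add: Ny.smult_l_minus Ny.M.a_ac Ny.M.r_neg Ny.M.r_neg1 Ny.M.r_neg2)
        ultimately show "T.agree x y \<gamma> (D x \<oplus>\<^bsub>Nst x\<^esub> D x) (D y \<oplus>\<^bsub>Nst y\<^esub> D y)"
          using T.agree_add[OF xy(1) _ _ _ _ a1 a2] T.sec_mem[OF m xy(2)] T.sec_mem[OF m xy(3)]
            T.sec_mem[OF m xs(1)] T.sec_mem[OF m xs(2)] by (simp add: Nx)
      qed
      have "T.agree x y \<gamma> ((\<ominus>\<^bsub>S\<^esub> \<one>\<^bsub>S\<^esub>) \<odot>\<^bsub>Nst x\<^esub> D x) ((\<ominus>\<^bsub>S\<^esub> \<one>\<^bsub>S\<^esub>) \<odot>\<^bsub>Nst y\<^esub> D y)"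
        by (rule T.agree_smult[OF xy(1) _ mem(2,4) aD]) simp
      from T.agree_add[OF xy(1) _ _ _ _ a1 this] mem T.sec_mem[OF m xy(2)] T.sec_mem[OF m xy(3)]
      have "T.agree x y \<gamma> (m x \<oplus>\<^bsub>Nst x\<^esub> (\<ominus>\<^bsub>S\<^esub> \<one>\<^bsub>S\<^esub>) \<odot>\<^bsub>Nst x\<^esub> D x) (m y \<oplus>\<^bsub>Nst y\<^esub> (\<ominus>\<^bsub>S\<^esub> \<one>\<^bsub>S\<^esub>) \<odot>\<^bsub>Nst y\<^esub> D y)"
        by simp
      moreover have "m x \<oplus>\<^bsub>Nst x\<^esub> (\<ominus>\<^bsub>S\<^esub> \<one>\<^bsub>S\<^esub>) \<odot>\<^bsub>Nst x\<^esub> D x = cw x \<odot>\<^bsub>Nst x\<^esub> A x"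
        unfolding m_eq[OF xy(2)] using mem cx
        by (simp add: Nx.smult_l_minus Nx.M.a_ac Nx.M.r_neg Nx.M.r_neg1 Nx.M.r_neg2)
      moreover have "m y \<oplus>\<^bsub>Nst y\<^esub> (\<ominus>\<^bsub>S\<^esub> \<one>\<^bsub>S\<^esub>) \<odot>\<^bsub>Nst y\<^esub> D y = cw y \<odot>\<^bsub>Nst y\<^esub> A y"
        unfolding m_eq[OF xy(3)] using mem cy
        by (simp add: Ny.smult_l_minus Ny.M.a_ac Ny.M.r_neg Ny.M.r_neg1 Ny.M.r_neg2)
      ultimately have acA: "T.agree x y \<gamma> (cw x \<odot>\<^bsub>Nst x\<^esub> A x) (cw y \<odot>\<^bsub>Nst y\<^esub> A y)" by simp
      \<comment> \<open>The weights at x and y differ by a multiple of the label of the edge.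
        Replacing the one at y by the one at x produces a common scalar, as cancellation
        requires.\<close>
      have "T.agree x y \<gamma> (cw x \<odot>\<^bsub>Nst x\<^esub> A x) (cw x \<odot>\<^bsub>Nst y\<^esub> A y)"
      proof -
        obtain c where c: "c \<in> carrier S" "cw x = cw y \<oplus>\<^bsub>S\<^esub> lab \<gamma> \<otimes>\<^bsub>S\<^esub> c" using cw_edge[OF xy(1)] by blast
        have l: "lab \<gamma> \<in> carrier S" using e lab_root_S by blast
        have "T.agree x y \<gamma> (lab \<gamma> \<odot>\<^bsub>Nst x\<^esub> \<zero>\<^bsub>Nst x\<^esub>) (lab \<gamma> \<odot>\<^bsub>Nst y\<^esub> (c \<odot>\<^bsub>Nst y\<^esub> A y))"
          by (rule T.agree_label[OF xy(1)]) (use c mem in auto)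
        then have "T.agree x y \<gamma> \<zero>\<^bsub>Nst x\<^esub> (lab \<gamma> \<odot>\<^bsub>Nst y\<^esub> (c \<odot>\<^bsub>Nst y\<^esub> A y))" using l by simp
        from T.agree_add[OF xy(1) _ _ _ _ acA this]
        have "T.agree x y \<gamma> (cw x \<odot>\<^bsub>Nst x\<^esub> A x) (cw y \<odot>\<^bsub>Nst y\<^esub> A y \<oplus>\<^bsub>Nst y\<^esub> lab \<gamma> \<odot>\<^bsub>Nst y\<^esub> (c \<odot>\<^bsub>Nst y\<^esub> A y))"
          using c l mem cx cy by simp
        moreover have "cw y \<odot>\<^bsub>Nst y\<^esub> A y \<oplus>\<^bsub>Nst y\<^esub> lab \<gamma> \<odot>\<^bsub>Nst y\<^esub> (c \<odot>\<^bsub>Nst y\<^esub> A y) = cw x \<odot>\<^bsub>Nst y\<^esub> A y"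
          unfolding c(2) using c(1) l mem cy by (simp add: Ny.smult_l_distr Ny.smult_assoc1)
        ultimately show ?thesis by simp
      qed
      from T.agree_cancel[OF xy(1) act_simple_root[OF e(1)] np mem(1,3) this]
      have aA: "T.agree x y \<gamma> (A x) (A y)" .
      show ?thesis using aA aD unfolding agree_Th_other[OF xy(1) False] by blast
    qed
  qed
  define a where "a = (\<lambda>x\<in>\<Omega>. fam (A x) x)"
  define b where "b = (\<lambda>x\<in>\<Omega>. fam (D x) x)"
  have a: "a \<in> sec \<Omega>" unfolding a_def
    by (rule secI) (use Th_fam_mem[OF A x_cl] agreeAD in blast)+
  have b: "b \<in> sec \<Omega>" unfolding b_def
    by (rule secI) (use Th_fam_mem[OF D x_cl] agreeAD in blast)+
  have "m x = combo b a x" if x: "x \<in> \<Omega>" for x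
  proof -
    have xs: "x \<otimes>\<^bsub>W\<^esub> s \<in> \<Omega>" using x st by (simp add: stable_def)
    have "incl a x = A x"
      by (rule Th_eqI[OF incl_mem[OF st a x] A[OF x]])
        (use x xs AD_s[OF x] in \<open>auto simp: fam_incl a_def pc_eq\<close>)
    moreover have "incl b x = D x"
      by (rule Th_eqI[OF incl_mem[OF st b x] D[OF x]])
        (use x xs AD_s[OF x] in \<open>auto simp: fam_incl b_def pc_eq\<close>)
    ultimately show ?thesis using m_eq[OF x] by (simp add: combo_def)
  qed
  then show ?thesis using a b by blast
qed

lemma combo_cong:
  assumes "x \<in> carrier W" "\<And>z. z \<in> pcs x \<Longrightarrow> b z = b' z" "\<And>z. z \<in> pcs x \<Longrightarrow> a z = a' z"
  shows "combo b a x = combo b' a' x"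
proof -
  have "incl b x = incl b' x" "incl a x = incl a' x"
    unfolding incl_def using assms by (auto intro: restrict_ext)
  then show ?thesis by (simp add: combo_def)
qed

lemma stable_W: "stable (carrier W)"
  using s_W by (auto simp: stable_def)

text \<open>The two components of the section are sections of the original sheaf over the same set,
  so they extend separately and are then recombined.\<close>

lemma extend_stable:
  assumes "extends_sections" "z \<in> carrier W" "lower_set z \<Omega>" "stable \<Omega>" "m \<in> T.sec \<Omega>"
    and gkm: "cancellable"
  shows "\<exists>n\<in>T.sec (carrier W). \<forall>x\<in>\<Omega>. n x = m x"
proof -
  obtain b a where ba: "b \<in> sec \<Omega>" "a \<in> sec \<Omega>" "\<forall>x\<in>\<Omega>. m x = combo b a x"
    using decompose[OF gkm assms(4,5)] by blast
  obtain b' where b': "b' \<in> sec (carrier W)" "\<forall>x\<in>\<Omega>. b' x = b x"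
    using assms(1-3) ba(1) unfolding extends_sections_def by blast
  obtain a' where a': "a' \<in> sec (carrier W)" "\<forall>x\<in>\<Omega>. a' x = a x"
    using assms(1-3) ba(2) unfolding extends_sections_def by blast
  have "restrict (combo b' a') (carrier W) x = m x" if x: "x \<in> \<Omega>" for x
  proof -
    have xW: "x \<in> carrier W" using x assms(4) by (auto simp: stable_def)
    have "pcs x \<subseteq> \<Omega>" by (rule stable_pcs[OF assms(4) x])
    then have "combo b' a' x = combo b a x" using b'(2) a'(2) by (intro combo_cong[OF xW]) auto
    then show ?thesis using ba(3) x xW by simp
  qed
  then show ?thesis using combo_sec[OF stable_W b'(1) a'(1)] by blast
qed

text \<open>A section over a lower set is first corrected so as to vanish on the largest stable subset; it
  then extends to the stable set generated by being constant on the new pairs.\<close>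

lemma extends_sections_Th:
  assumes "extends_sections"
    and gkm: "cancellable"
  shows "T.extends_sections"
  unfolding T.extends_sections_def
proof (intro ballI allI impI)
  fix z \<Omega> m assume z: "z \<in> carrier W" and low: "lower_set z \<Omega>" and m: "m \<in> T.sec \<Omega>"
  have \<Omega>: "\<Omega> \<subseteq> carrier W" using low by (simp add: lower_set_def)
  let ?I = "{x \<in> \<Omega>. x \<otimes>\<^bsub>W\<^esub> s \<in> \<Omega>}" and ?U = "{x \<in> carrier W. x \<in> \<Omega> \<or> x \<otimes>\<^bsub>W\<^esub> s \<in> \<Omega>}"
  have stI: "stable ?I" and stU: "stable ?U"
    using \<Omega> s_W mult_s_s by (auto simp: stable_def)
  have "restrict m ?I \<in> T.sec ?I" by (rule T.sec_restrict[OF m]) auto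
  from extend_stable[OF assms(1) z lower_set_inter[OF \<alpha> s low] stI this gkm]
  obtain n where n: "n \<in> T.sec (carrier W)" "\<forall>x\<in>?I. n x = m x" by auto
  have nmem: "n x \<in> carrier (Nst x)" if "x \<in> carrier W" for x using T.sec_mem[OF n(1) that] .
  \<comment> \<open>On the stable part \<open>n\<close> equals \<open>m\<close>, so this difference
    vanishes there; it is written with the scalar -1 in order to use closure under scalars.\<close>
  define d where "d = (\<lambda>x\<in>\<Omega>. m x \<oplus>\<^bsub>Nst x\<^esub> (\<ominus>\<^bsub>S\<^esub> \<one>\<^bsub>S\<^esub>) \<odot>\<^bsub>Nst x\<^esub> n x)"
  have "(\<lambda>x\<in>\<Omega>. (\<ominus>\<^bsub>S\<^esub> \<one>\<^bsub>S\<^esub>) \<odot>\<^bsub>Nst x\<^esub> restrict n \<Omega> x) \<in> T.sec \<Omega>"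
    by (rule T.sec_smult[OF \<Omega> T.sec_restrict[OF n(1) \<Omega>]]) simp
  from T.sec_add[OF \<Omega> m this] have d: "d \<in> T.sec \<Omega>"
    unfolding d_def by (rule back_subst[of "\<lambda>f. f \<in> T.sec \<Omega>"]) (auto intro!: restrict_ext)
  have d0: "d x = \<zero>\<^bsub>Nst x\<^esub>" if "x \<in> ?I" for x
  proof -
    have x: "x \<in> carrier W" "x \<in> \<Omega>" using that \<Omega> by auto
    interpret N: module S "Nst x" by (rule T.stalk_module[OF x(1)])
    show ?thesis
      using n(2) that x nmem[OF x(1)] T.sec_mem[OF m x(2)]
      by (auto simp: d_def N.smult_l_minus N.M.r_neg)
  qed
  define e where "e x = (if x \<in> \<Omega> then d x else d (x \<otimes>\<^bsub>W\<^esub> s))" for x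
  have e_mem: "e x \<in> carrier (Nst x)" if "x \<in> ?U" for x
    using that T.sec_mem[OF d, of x] T.sec_mem[OF d, of "x \<otimes>\<^bsub>W\<^esub> s"] Th_stalk_mult_s[of x]
    by (cases "x \<in> \<Omega>") (auto simp: e_def)
  have "restrict e ?U \<in> T.sec ?U"
  proof (rule T.secI[OF e_mem])
    fix x y \<gamma> assume xy: "is_edge x y \<gamma>" "x \<in> ?U" "y \<in> ?U"
    note ed = is_edgeD[OF xy(1)]
    show "T.agree x y \<gamma> (e x) (e y)"
    proof (cases "y = x \<otimes>\<^bsub>W\<^esub> s")
      case True
      show ?thesis
      proof (cases "x \<in> \<Omega> \<and> y \<in> \<Omega>")
        case both: True
        then show ?thesis using T.sec_agree[OF d xy(1)] by (simp add: e_def)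
      next
        case False
        interpret N: module S "Nst x" by (rule T.stalk_module[OF ed(1)])
        have "e x = e y" using False xy True ed mult_s_s by (auto simp: e_def)
        moreover have "lab \<gamma> \<in> carrier S" using ed lab_root_S by blast
        ultimately show ?thesis
          using e_mem[OF xy(2)] True
          by (subst agree_Th_same[OF xy(1) True]) (auto intro!: bexI[of _ "\<zero>\<^bsub>Nst x\<^esub>"])
      qed
    next
      case False
      note sh = edge_shift[OF xy(1) False]
      have shift: "T.agree x y \<gamma> u v" if "T.agree (x \<otimes>\<^bsub>W\<^esub> s) (y \<otimes>\<^bsub>W\<^esub> s) \<gamma> u v" for u v
        using that agree_Th_shift[OF xy(1) False] by blast
      consider "x \<in> \<Omega>" "y \<in> \<Omega>" | "x \<notin> \<Omega>" "y \<notin> \<Omega>" | "x \<in> \<Omega>" "y \<notin> \<Omega>" | "x \<notin> \<Omega>" "y \<in> \<Omega>" by blast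
      then show ?thesis
      proof cases
        case 1
        then show ?thesis using T.sec_agree[OF d xy(1)] by (simp add: e_def)
      next
        case 2
        then show ?thesis using T.sec_agree[OF d sh] xy by (auto simp: e_def intro!: shift)
      next
        case 3
        then have ys: "y \<otimes>\<^bsub>W\<^esub> s \<in> \<Omega>" using xy by blast
        show ?thesis
        proof (cases "x \<otimes>\<^bsub>W\<^esub> s \<in> \<Omega>")
          case True
          have "x \<otimes>\<^bsub>W\<^esub> s \<in> ?I" using True 3 ed mult_s_s by auto
          \<comment> \<open>Both values vanish, as x and xs lie in the stable part. The value at xs
            may replace the one at x, and the edge from xs to ys lies inside \<Omega>.\<close>
          then have "d x = d (x \<otimes>\<^bsub>W\<^esub> s)"
            using d0[of x] d0[of "x \<otimes>\<^bsub>W\<^esub> s"] 3 True Th_stalk_mult_s[OF ed(1)] by simp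
          then show ?thesis
            using T.sec_agree[OF d sh True ys] 3 by (auto simp: e_def intro!: shift)
        next
          case no: False
          have yss: "y \<otimes>\<^bsub>W\<^esub> s \<otimes>\<^bsub>W\<^esub> s = y" by (rule mult_s_s[OF ed(2)])
          \<comment> \<open>Here x and ys lie in \<Omega> while xs and y do not, although the edge
            joins x to y. A lower set admits this only if ys = x, which means y = xs.\<close>
          have "y \<otimes>\<^bsub>W\<^esub> s = x"
            by (rule lower_set_no_crossing[OF \<alpha> s low z ed(3) 3(1) ys no])
              (unfold yss, use 3(2) ed(4) in simp_all)
          then show ?thesis using False yss by simp
        qed
      next
        case 4
        then have xs: "x \<otimes>\<^bsub>W\<^esub> s \<in> \<Omega>" using xy by blast
        show ?thesis
        proof (cases "y \<otimes>\<^bsub>W\<^esub> s \<in> \<Omega>")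
          case True
          have "y \<otimes>\<^bsub>W\<^esub> s \<in> ?I" using True 4 ed mult_s_s by auto
          then have "d y = d (y \<otimes>\<^bsub>W\<^esub> s)"
            using d0[of y] d0[of "y \<otimes>\<^bsub>W\<^esub> s"] 4 True Th_stalk_mult_s[OF ed(2)] by simp
          then show ?thesis
            using T.sec_agree[OF d sh xs True] 4 by (auto simp: e_def intro!: shift)
        next
          case no: False
          have xss: "x \<otimes>\<^bsub>W\<^esub> s \<otimes>\<^bsub>W\<^esub> s = x" by (rule mult_s_s[OF ed(1)])
          have "x \<otimes>\<^bsub>W\<^esub> s = y"
            by (rule lower_set_no_crossing[OF \<alpha> s low z ed(3) 4(2) xs no])
              (unfold xss, use 4(1) is_edge_x[OF xy(1), symmetric] in simp_all)
          then show ?thesis using False by simp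
        qed
      qed
    qed
  qed
  from extend_stable[OF assms(1) z lower_set_union[OF \<alpha> s low] stU this gkm]
  obtain f where f: "f \<in> T.sec (carrier W)" "\<forall>x\<in>?U. f x = e x" by auto
  have "(\<lambda>x\<in>carrier W. f x \<oplus>\<^bsub>Nst x\<^esub> n x) \<in> T.sec (carrier W)"
    by (rule T.sec_add[OF subset_refl f(1) n(1)])
  moreover have "f x \<oplus>\<^bsub>Nst x\<^esub> n x = m x" if x: "x \<in> \<Omega>" for x
  proof -
    have xW: "x \<in> carrier W" using x \<Omega> by blast
    interpret N: module S "Nst x" by (rule T.stalk_module[OF xW])
    have "f x = d x" using f(2) x xW by (auto simp: e_def)
    then show ?thesis
      using x nmem[OF xW] T.sec_mem[OF m x]
      by (simp add: d_def N.smult_l_minus N.M.a_assoc N.M.l_neg)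
  qed
  ultimately show "\<exists>n\<in>T.sec (carrier W). \<forall>x\<in>\<Omega>. n x = m x"
    using \<Omega> by (intro bexI[of _ "\<lambda>x\<in>carrier W. f x \<oplus>\<^bsub>Nst x\<^esub> n x"]) auto
qed

end
end

section \<open>Bott--Samelson sheaves\<close>

text \<open>The target inherits the module axioms from the source through the bijection, so the
  module structures of \<open>X_module\<close> and \<open>X_stalk\<close> come with the
  isomorphisms.\<close>

lemma module_iso_transfer:
  fixes M :: "('s, 'm) module" and N :: "('s, 'n) module"
  assumes M: "Module.module S M" and image: "h ` carrier M = carrier N" and inj: "inj_on h (carrier M)"
    and add: "\<And>m n. m \<in> carrier M \<Longrightarrow> n \<in> carrier M \<Longrightarrow> h (m \<oplus>\<^bsub>M\<^esub> n) = h m \<oplus>\<^bsub>N\<^esub> h n"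
    and zero: "h \<zero>\<^bsub>M\<^esub> = \<zero>\<^bsub>N\<^esub>"
    and smult: "\<And>a m. a \<in> carrier S \<Longrightarrow> m \<in> carrier M \<Longrightarrow> h (a \<odot>\<^bsub>M\<^esub> m) = a \<odot>\<^bsub>N\<^esub> h m"
  shows "module_iso S M N h"
proof -
  interpret module S M by fact
  have N: "Module.module S N"
  proof (rule moduleI[OF R.cring_axioms])
    show "abelian_group N"
    proof (rule abelian_groupI)
      fix x assume "x \<in> carrier N"
      then obtain m where "m \<in> carrier M" "x = h m" unfolding image[symmetric] by blast
      then show "\<exists>y\<in>carrier N. y \<oplus>\<^bsub>N\<^esub> x = \<zero>\<^bsub>N\<^esub>"
        unfolding image[symmetric]
        by (intro bexI[of _ "h (\<ominus>\<^bsub>M\<^esub> m)"]) (auto simp: M.l_neg zero simp flip: add)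
    qed (unfold image[symmetric], auto simp: M.a_ac simp flip: add zero)
  qed (unfold image[symmetric], auto simp: smult_l_distr smult_r_distr smult_assoc1 simp flip: add smult)
  have "h \<in> iso (add_monoid M) (add_monoid N)"
    using image inj add by (auto simp: iso_def hom_def bij_betw_def)
  then show ?thesis using M N smult by (simp add: module_iso_def)
qed

text \<open>The last functor applied contributes the outermost family, hence the recursion on the
  reversed subsequence.\<close>

primrec value_rev :: "'v::rat_vector set \<Rightarrow> ('v, 'f::field) vert_elt \<Rightarrow> 'v aff_map option list \<Rightarrow> ('v, 'f) sym" where
  "value_rev R m [] = elt m"
| "value_rev R m (u # \<tau>) = value_rev R (fam m (ev R (rev \<tau>))) \<tau>"

text \<open>An element of a stalk of a Bott--Samelson sheaf is a family of families of \<dots> of elements of the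
  symmetric algebra; its component at a subsequence \<open>\<sigma>\<close> is read off along the products of the
  initial segments of \<open>\<sigma>\<close>.\<close>

definition value_at :: "'v::rat_vector set \<Rightarrow> ('v, 'f::field) vert_elt \<Rightarrow> 'v aff_map option list \<Rightarrow> ('v, 'f) sym" where
  "value_at R m \<sigma> = value_rev R m (rev \<sigma>)"

lemma value_at_Nil: "value_at R m [] = elt m"
  and value_at_snoc: "value_at R m (\<sigma> @ [u]) = value_at R (fam m (ev R \<sigma>)) \<sigma>"
  by (simp_all add: value_at_def)

lemma subseqs_of_Nil: "subseqs_of [] = {[]}"
  by (simp add: subseqs_of_def)

lemma subseqs_of_snoc: "\<sigma> \<in> subseqs_of (ss @ [s]) \<longleftrightarrow>
    (\<exists>\<tau> u. \<sigma> = \<tau> @ [u] \<and> \<tau> \<in> subseqs_of ss \<and> (u = None \<or> u = Some s))"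
proof (cases \<sigma> rule: rev_cases)
  case (snoc \<tau> u)
  have "list_all2 P (\<tau> @ [u]) (ss @ [s]) \<longleftrightarrow> P u s \<and> list_all2 P \<tau> ss" for P
    using list_all2_rev[of P "\<tau> @ [u]" "ss @ [s]"] by (simp add: list_all2_rev)
  then show ?thesis by (auto simp: subseqs_of_def snoc)
qed (simp add: subseqs_of_def)

lemma subseqs_of_snocI: "\<tau> \<in> subseqs_of ss \<Longrightarrow> \<tau> @ [None] \<in> subseqs_of (ss @ [s])"
  "\<tau> \<in> subseqs_of ss \<Longrightarrow> \<tau> @ [Some s] \<in> subseqs_of (ss @ [s])"
  by (auto simp: subseqs_of_snoc)

lemma subseqs_of_set: "\<sigma> \<in> subseqs_of ss \<Longrightarrow> Some u \<in> set \<sigma> \<Longrightarrow> u \<in> set ss"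
  unfolding subseqs_of_def
  by (auto simp: list_all2_conv_all_nth in_set_conv_nth) (metis option.distinct(1) option.inject)

context irreducible_root_system
begin

lemma ev_Nil: "ev R [] = \<one>\<^bsub>W\<^esub>"
  by (simp add: ev_def word_prod_Nil)

lemma ev_W: "set ss \<subseteq> simp_refls \<Longrightarrow> \<sigma> \<in> subseqs_of ss \<Longrightarrow> ev R \<sigma> \<in> carrier W"
  unfolding ev_def by (rule word_prod_W) (auto dest: subseqs_of_set)

lemma ev_snoc_None: "ev R (\<sigma> @ [None]) = ev R \<sigma>"
  by (simp add: ev_def)

lemma ev_snoc_Some:
  assumes "set ss \<subseteq> simp_refls" "\<sigma> \<in> subseqs_of ss" "s \<in> simp_refls"
  shows "ev R (\<sigma> @ [Some s]) = ev R \<sigma> \<otimes>\<^bsub>W\<^esub> s"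
proof -
  have "set (map the (filter (\<lambda>u. u \<noteq> None) \<sigma>)) \<subseteq> simp_refls"
    using assms by (auto dest: subseqs_of_set)
  then show ?thesis
    using assms(3) simple_refl_W by (simp add: ev_def word_prod_append word_prod_Cons word_prod_Nil)
qed

lemma ev_set_Nil: "ev_set R [] = {\<one>\<^bsub>W\<^esub>}"
  by (simp add: ev_set_def subseqs_of_Nil ev_Nil)

lemma ev_set_snoc:
  assumes "set ss \<subseteq> simp_refls" "s \<in> simp_refls"
  shows "ev_set R (ss @ [s]) = ev_set R ss \<union> (\<lambda>x. x \<otimes>\<^bsub>W\<^esub> s) ` ev_set R ss"
proof
  show "ev_set R (ss @ [s]) \<subseteq> ev_set R ss \<union> (\<lambda>x. x \<otimes>\<^bsub>W\<^esub> s) ` ev_set R ss"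
    using assms by (auto simp: ev_set_def subseqs_of_snoc ev_snoc_None ev_snoc_Some)
  have "ev R \<tau> \<in> ev_set R (ss @ [s])" "ev R \<tau> \<otimes>\<^bsub>W\<^esub> s \<in> ev_set R (ss @ [s])"
    if "\<tau> \<in> subseqs_of ss" for \<tau>
    using imageI[OF subseqs_of_snocI(1)[OF that], of "ev R" s]
      imageI[OF subseqs_of_snocI(2)[OF that], of "ev R" s]
    by (simp_all add: ev_set_def ev_snoc_None ev_snoc_Some[OF assms(1) that assms(2)])
  then show "ev_set R ss \<union> (\<lambda>x. x \<otimes>\<^bsub>W\<^esub> s) ` ev_set R ss \<subseteq> ev_set R (ss @ [s])"
    by (auto simp: ev_set_def[of R ss])
qed

lemma simple_root_of_eq: "\<alpha> \<in> \<Delta> \<Longrightarrow> simple_root_of R B (rr \<alpha>) = \<alpha>"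
  unfolding simple_root_of_def
proof (rule the_equality)
  fix \<gamma> assume "\<alpha> \<in> \<Delta>" "\<gamma> \<in> \<Delta> \<and> rr \<gamma> = rr \<alpha>"
  then show "\<gamma> = \<alpha>"
    using root_refl_inj[of \<alpha> \<gamma>] pos_not_neg[of \<alpha>] simple_pos[of \<gamma>] simple_pos[of \<alpha>] simple_root by metis
qed simp

end

lemma bott_samelson_Nil: "bott_samelson R B [] = unit_sheaf R B"
  and bott_samelson_snoc: "bott_samelson R B (ss @ [s]) = theta R B s (bott_samelson R B ss)"
  by (simp_all add: bott_samelson_def)

context labelled_root_system
begin

abbreviation Gr :: "('v aff_map, 'v \<times> rat, ('v, 'f) sym) moment_graph" where "Gr \<equiv> aff_graph R B"

lemma gkm_edges:
  assumes "gkm R (full_subgraph Gr H)" "is_edge x y \<gamma>" "is_edge x' y' \<gamma>'"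
    "(x, y, \<gamma>) \<noteq> (x', y', \<gamma>')" "{x, y} \<inter> {x', y'} \<noteq> {}" "{x, y, x', y'} \<subseteq> H"
  shows "\<not> prp (lab \<gamma>) (lab \<gamma>')"
proof -
  have "(x, y, \<gamma>) \<in> edges (full_subgraph Gr H)" "(x', y', \<gamma>') \<in> edges (full_subgraph Gr H)"
    using assms(2,3,6) by (auto simp: full_subgraph_def edges_aff_graph)
  moreover have "label (full_subgraph Gr H) (u, v, \<delta>) = lab \<delta>" for u v \<delta>
    by (simp add: full_subgraph_def aff_graph_def)
  ultimately show ?thesis
    using assms(1,4,5) unfolding gkm_def by (metis ends.simps)
qed

end

section \<open>Values of sections at subsequences\<close>

context good_sheaf
begin

definition values_on :: "'v aff_map list \<Rightarrow> bool" where
  "values_on ss \<longleftrightarrow> (\<forall>x\<in>carrier W. \<forall>m\<in>carrier (st x).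
     (\<forall>\<sigma>\<in>subseqs_at R ss x. value_at R m \<sigma> \<in> carrier S \<and>
       (\<forall>n\<in>carrier (st x). value_at R (m \<oplus>\<^bsub>st x\<^esub> n) \<sigma> = value_at R m \<sigma> \<oplus>\<^bsub>S\<^esub> value_at R n \<sigma>) \<and>
       (\<forall>a\<in>carrier S. value_at R (a \<odot>\<^bsub>st x\<^esub> m) \<sigma> = a \<otimes>\<^bsub>S\<^esub> value_at R m \<sigma>)) \<and>
     (\<forall>n\<in>carrier (st x). (\<forall>\<sigma>\<in>subseqs_at R ss x. value_at R m \<sigma> = value_at R n \<sigma>) \<longrightarrow> m = n))"

definition phi :: "'v aff_map list \<Rightarrow> ('v aff_map \<Rightarrow> ('v, 'f) vert_elt) \<Rightarrow> ('v, 'f) subseq_fun" where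
  "phi ss m = (\<lambda>\<sigma>\<in>subseqs_of ss. value_at R (m (ev R \<sigma>)) \<sigma>)"

end

text \<open>The full induction hypothesis. \<open>extends\<close> serves both the next translation
  and, at the end, surjectivity onto stalks.\<close>

locale realized_sheaf = good_sheaf R B F M "ev_set R ss"
  for R B :: "'v::rat_vector set" and F :: "'f::field itself" and M :: "('v, 'f) aff_sheaf"
    and ss :: "'v aff_map list" +
  assumes ss: "set ss \<subseteq> simp_refls" and extends: "extends_sections" and vals: "values_on ss"
    and X_carrier_eq: "X_carrier R B ss = phi ss ` sec (carrier W)"

context good_sheaf
begin

context
  fixes \<alpha> s ss
  assumes \<alpha>: "\<alpha> \<in> \<Delta>" and s: "s = rr \<alpha>" and ss: "set ss \<subseteq> simp_refls" and J: "J = ev_set R ss"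
    and vals: "values_on ss"
begin

interpretation T: good_sheaf R B F "theta R B s M" "J \<union> (\<lambda>x. x \<otimes>\<^bsub>W\<^esub> s) ` J"
  by (rule good_Th[OF \<alpha> s])

lemma s_simp: "s \<in> simp_refls"
  using \<alpha> s by (auto simp: simple_refls_def)

lemma subseqs_at_snocE:
  assumes "\<sigma> \<in> subseqs_at R (ss @ [s]) x" "x \<in> carrier W"
  obtains \<tau> u where "\<sigma> = \<tau> @ [u]" "\<tau> \<in> subseqs_at R ss (ev R \<tau>)" "ev R \<tau> \<in> pair_coset R s x"
    "ev R \<tau> \<in> carrier W" "\<tau> \<in> subseqs_of ss"
proof -
  obtain \<tau> u where \<tau>: "\<sigma> = \<tau> @ [u]" "\<tau> \<in> subseqs_of ss" "u = None \<or> u = Some s"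
    using assms(1) by (auto simp: subseqs_at_def subseqs_of_snoc)
  have W: "ev R \<tau> \<in> carrier W" by (rule ev_W[OF ss \<tau>(2)])
  have "x = ev R \<tau> \<or> x = ev R \<tau> \<otimes>\<^bsub>W\<^esub> s"
    using assms(1) \<tau> ev_snoc_Some[OF ss \<tau>(2) s_simp] by (auto simp: subseqs_at_def ev_snoc_None)
  then have "ev R \<tau> \<in> pair_coset R s x"
    using mult_s_s[OF \<alpha> s W] by (auto simp: pair_coset_def)
  then show thesis using that[OF \<tau>(1) _ _ W \<tau>(2)] \<tau>(2) by (simp add: subseqs_at_def)
qed

lemma subseqs_at_snocI:
  assumes "x \<in> carrier W" "z \<in> pair_coset R s x" "\<tau> \<in> subseqs_at R ss z"
  shows "\<exists>u. \<tau> @ [u] \<in> subseqs_at R (ss @ [s]) x"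
proof -
  have \<tau>: "\<tau> \<in> subseqs_of ss" "ev R \<tau> = z" using assms(3) by (auto simp: subseqs_at_def)
  from assms(2) consider "z = x" | "z = x \<otimes>\<^bsub>W\<^esub> s" by (auto simp: pair_coset_def)
  then show ?thesis
  proof cases
    case 1
    then show ?thesis
      using \<tau> subseqs_of_snocI(1)[OF \<tau>(1)] by (auto simp: subseqs_at_def ev_snoc_None intro!: exI[of _ None])
  next
    case 2
    then show ?thesis
      using \<tau> subseqs_of_snocI(2)[OF \<tau>(1)] ev_snoc_Some[OF ss \<tau>(1) s_simp] mult_s_s[OF \<alpha> s assms(1)]
      by (intro exI[of _ "Some s"]) (simp add: subseqs_at_def)
  qed
qed

lemma values_onD:
  assumes "x \<in> carrier W" "m \<in> carrier (st x)" "\<sigma> \<in> subseqs_at R ss x"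
  shows "value_at R m \<sigma> \<in> carrier S"
    "n \<in> carrier (st x) \<Longrightarrow> value_at R (m \<oplus>\<^bsub>st x\<^esub> n) \<sigma> = value_at R m \<sigma> \<oplus>\<^bsub>S\<^esub> value_at R n \<sigma>"
    "a \<in> carrier S \<Longrightarrow> value_at R (a \<odot>\<^bsub>st x\<^esub> m) \<sigma> = a \<otimes>\<^bsub>S\<^esub> value_at R m \<sigma>"
  using vals assms unfolding values_on_def by blast+

lemma values_on_inj:
  assumes "x \<in> carrier W" "m \<in> carrier (st x)" "n \<in> carrier (st x)"
    "\<And>\<sigma>. \<sigma> \<in> subseqs_at R ss x \<Longrightarrow> value_at R m \<sigma> = value_at R n \<sigma>"
  shows "m = n"
  using vals assms unfolding values_on_def by blast

text \<open>The stalk at x consists of families over x and xs. Likewise the longer subsequences at x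
  are those at x followed by a blank and those at xs followed by s.\<close>

lemma values_on_Th: "T.values_on (ss @ [s])"
  unfolding T.values_on_def
proof (intro ballI conjI impI)
  fix x m \<sigma> assume x: "x \<in> carrier W" and m: "m \<in> carrier (T.st x)"
    and \<sigma>: "\<sigma> \<in> subseqs_at R (ss @ [s]) x"
  obtain \<tau> u where \<tau>: "\<sigma> = \<tau> @ [u]" "\<tau> \<in> subseqs_at R ss (ev R \<tau>)"
    "ev R \<tau> \<in> pair_coset R s x" "ev R \<tau> \<in> carrier W" using subseqs_at_snocE[OF \<sigma> x] by blast
  note mem = Th_fam_mem[OF \<alpha> s _ \<tau>(3)]
  show "value_at R m \<sigma> \<in> carrier S"
    using values_onD(1)[OF \<tau>(4) mem[OF m] \<tau>(2)] by (simp add: \<tau>(1) value_at_snoc)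
  show "value_at R (m \<oplus>\<^bsub>T.st x\<^esub> n) \<sigma> = value_at R m \<sigma> \<oplus>\<^bsub>S\<^esub> value_at R n \<sigma>" if "n \<in> carrier (T.st x)" for n
    using values_onD(2)[OF \<tau>(4) mem[OF m] \<tau>(2) mem[OF that]]
    by (simp add: \<tau>(1) value_at_snoc Th_add[OF \<alpha> s \<tau>(3)])
  show "value_at R (a \<odot>\<^bsub>T.st x\<^esub> m) \<sigma> = a \<otimes>\<^bsub>S\<^esub> value_at R m \<sigma>" if "a \<in> carrier S" for a
    using values_onD(3)[OF \<tau>(4) mem[OF m] \<tau>(2) that]
    by (simp add: \<tau>(1) value_at_snoc Th_smult[OF \<alpha> s \<tau>(3)])
next
  fix x m n assume x: "x \<in> carrier W" and m: "m \<in> carrier (T.st x)" "n \<in> carrier (T.st x)"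
    and eq: "\<forall>\<sigma>\<in>subseqs_at R (ss @ [s]) x. value_at R m \<sigma> = value_at R n \<sigma>"
  show "m = n"
  proof (rule Th_eqI[OF \<alpha> s m])
    fix z assume z: "z \<in> pair_coset R s x"
    have zW: "z \<in> carrier W" using pc_W[OF \<alpha> s x] z by blast
    show "fam m z = fam n z"
    proof (rule values_on_inj[OF zW])
      show "fam m z \<in> carrier (st z)" "fam n z \<in> carrier (st z)"
        using Th_fam_mem[OF \<alpha> s _ z] m by auto
      fix \<tau> assume \<tau>: "\<tau> \<in> subseqs_at R ss z"
      obtain u where "\<tau> @ [u] \<in> subseqs_at R (ss @ [s]) x" using subseqs_at_snocI[OF x z \<tau>] by blast
      then have "value_at R m (\<tau> @ [u]) = value_at R n (\<tau> @ [u])" using eq by blast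
      moreover have "ev R \<tau> = z" using \<tau> by (simp add: subseqs_at_def)
      ultimately show "value_at R (fam m z) \<tau> = value_at R (fam n z) \<tau>" by (simp add: value_at_snoc)
    qed
  qed
qed

text \<open>Dropping the last entry of \<sigma> selects the component of the families, while the
  weight is taken at the vertex \<open>ev R \<sigma>\<close>. This is exactly how \<Delta> and the
  multiplication by the weight are indexed.\<close>

lemma phi_combo:
  assumes "b \<in> sec (carrier W)" "a \<in> sec (carrier W)"
  shows "T.phi (ss @ [s]) (restrict (combo \<alpha> s b a) (carrier W)) =
    dup (ss @ [s]) (phi ss b) \<oplus>\<^bsub>subseq_module R (ss @ [s])\<^esub>
      (weight_elt R (ev_set R (ss @ [s])) (simple_root_of R B s) \<odot>\<^bsub>subseq_module R (ss @ [s])\<^esub>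
        dup (ss @ [s]) (phi ss a))"
  (is "?L = ?R")
proof (rule extensionalityI[of _ "subseqs_of (ss @ [s])"])
  show "?L \<in> extensional (subseqs_of (ss @ [s]))" by (simp add: T.phi_def)
  show "?R \<in> extensional (subseqs_of (ss @ [s]))" by (simp add: subseq_module_def)
  fix \<sigma> assume \<sigma>: "\<sigma> \<in> subseqs_of (ss @ [s])"
  let ?x = "ev R \<sigma>"
  have xW: "?x \<in> carrier W" using ev_W[OF _ \<sigma>] ss s_simp by simp
  have at: "\<sigma> \<in> subseqs_at R (ss @ [s]) ?x" using \<sigma> by (simp add: subseqs_at_def)
  obtain \<tau> u where \<tau>: "\<sigma> = \<tau> @ [u]" "\<tau> \<in> subseqs_at R ss (ev R \<tau>)"
    "ev R \<tau> \<in> pair_coset R s ?x" "ev R \<tau> \<in> carrier W" "\<tau> \<in> subseqs_of ss"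
    using subseqs_at_snocE[OF at xW] by blast
  let ?z = "ev R \<tau>"
  note bz = sec_mem[OF assms(1) \<tau>(4)] and az = sec_mem[OF assms(2) \<tau>(4)]
  have c: "lab (act ?x \<alpha>) \<in> carrier S" by (rule cw_S[OF \<alpha> s xW])
  have J': "?x \<in> ev_set R (ss @ [s])" using \<sigma> by (simp add: ev_set_def)
  have "?L \<sigma> = value_at R (combo \<alpha> s b a ?x) \<sigma>" using \<sigma> xW by (simp add: T.phi_def)
  also have "\<dots> = value_at R (fam (combo \<alpha> s b a ?x) ?z) \<tau>"
    by (subst (2) \<tau>(1)) (simp add: value_at_snoc)
  also have "fam (combo \<alpha> s b a ?x) ?z = b ?z \<oplus>\<^bsub>st ?z\<^esub> lab (act ?x \<alpha>) \<odot>\<^bsub>st ?z\<^esub> a ?z"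
    by (simp add: combo_def[OF \<alpha> s] Th_add[OF \<alpha> s \<tau>(3)] Th_smult[OF \<alpha> s \<tau>(3)] fam_incl[OF \<alpha> s \<tau>(3)])
  also have "value_at R \<dots> \<tau> = value_at R (b ?z) \<tau> \<oplus>\<^bsub>S\<^esub> lab (act ?x \<alpha>) \<otimes>\<^bsub>S\<^esub> value_at R (a ?z) \<tau>"
    using values_onD(2)[OF \<tau>(4) bz \<tau>(2)] values_onD(3)[OF \<tau>(4) az \<tau>(2) c] \<tau>(4) az c by simp
  also have "\<dots> = ?R \<sigma>"
    using \<sigma> \<tau>(5) J' by (simp add: subseq_module_def dup_def phi_def weight_elt_def s simple_root_of_eq[OF \<alpha>] \<tau>(1))
  finally show "?L \<sigma> = ?R \<sigma>" .
qed

lemma X_carrier_Th: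
  assumes "X_carrier R B ss = phi ss ` sec (carrier W)" "cancellable \<alpha> s"
  shows "X_carrier R B (ss @ [s]) = T.phi (ss @ [s]) ` T.sec (carrier W)"
proof -
  have "X_carrier R B (ss @ [s]) = {dup (ss @ [s]) f \<oplus>\<^bsub>subseq_module R (ss @ [s])\<^esub>
      (weight_elt R (ev_set R (ss @ [s])) (simple_root_of R B s) \<odot>\<^bsub>subseq_module R (ss @ [s])\<^esub>
        dup (ss @ [s]) g) | f g. f \<in> phi ss ` sec (carrier W) \<and> g \<in> phi ss ` sec (carrier W)}"
    by (subst X_carrier.simps) (simp add: assms(1))
  also have "\<dots> = {T.phi (ss @ [s]) (restrict (combo \<alpha> s b a) (carrier W)) | b a.
      b \<in> sec (carrier W) \<and> a \<in> sec (carrier W)}"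
  proof (rule Collect_cong, rule iffI, goal_cases)
    case (1 h)
    then obtain b a where "b \<in> sec (carrier W)" "a \<in> sec (carrier W)"
      "h = dup (ss @ [s]) (phi ss b) \<oplus>\<^bsub>subseq_module R (ss @ [s])\<^esub>
        (weight_elt R (ev_set R (ss @ [s])) (simple_root_of R B s) \<odot>\<^bsub>subseq_module R (ss @ [s])\<^esub>
          dup (ss @ [s]) (phi ss a))" by blast
    then show ?case
      using phi_combo[of b a] by (intro exI[of _ b] exI[of _ a]) simp
  next
    case (2 h)
    then obtain b a where ba: "b \<in> sec (carrier W)" "a \<in> sec (carrier W)"
      "h = T.phi (ss @ [s]) (restrict (combo \<alpha> s b a) (carrier W))" by blast
    show ?case
      unfolding ba(3) phi_combo[OF ba(1,2)] using ba(1,2) by blast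
  qed
  also have "\<dots> = T.phi (ss @ [s]) ` T.sec (carrier W)"
  proof
    show "{T.phi (ss @ [s]) (restrict (combo \<alpha> s b a) (carrier W)) | b a.
      b \<in> sec (carrier W) \<and> a \<in> sec (carrier W)} \<subseteq> T.phi (ss @ [s]) ` T.sec (carrier W)"
      using combo_sec[OF \<alpha> s stable_W[OF \<alpha> s]] by blast
    show "T.phi (ss @ [s]) ` T.sec (carrier W) \<subseteq> {T.phi (ss @ [s]) (restrict (combo \<alpha> s b a) (carrier W)) | b a.
      b \<in> sec (carrier W) \<and> a \<in> sec (carrier W)}"
    proof
      fix f assume "f \<in> T.phi (ss @ [s]) ` T.sec (carrier W)"
      then obtain m where m: "m \<in> T.sec (carrier W)" "f = T.phi (ss @ [s]) m" by blast
      obtain b a where ba: "b \<in> sec (carrier W)" "a \<in> sec (carrier W)" "\<forall>x\<in>carrier W. m x = combo \<alpha> s b a x"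
        using decompose[OF \<alpha> s assms(2) stable_W[OF \<alpha> s] m(1)] by blast
      have "m = restrict (combo \<alpha> s b a) (carrier W)"
        by (rule extensionalityI[OF T.sec_ext[OF m(1)]]) (use ba in auto)
      then show "f \<in> {T.phi (ss @ [s]) (restrict (combo \<alpha> s b a) (carrier W)) | b a.
        b \<in> sec (carrier W) \<and> a \<in> sec (carrier W)}" using ba m(2) by blast
    qed
  qed
  finally show ?thesis .
qed

text \<open>The edge between x and xs and the given edge meet in x, and both lie in the enlarged
  support, where GKM is assumed. If the former starts at xs, its label is the negative of
  x(\<alpha>).\<close>

lemma gkm_cancellable:
  assumes gkm: "gkm R (full_subgraph Gr (J \<union> (\<lambda>x. x \<otimes>\<^bsub>W\<^esub> s) ` J))"
  shows "cancellable \<alpha> s"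
  unfolding cancellable_def[OF \<alpha> s]
proof (intro allI impI)
  fix x y \<gamma> assume e: "is_edge x y \<gamma>" "x \<in> J" "y \<in> J" "y \<noteq> x \<otimes>\<^bsub>W\<^esub> s"
  note W = is_edgeD[OF e(1)]
  have ax: "act x \<alpha> \<in> \<Phi>" by (rule act_simple_root[OF \<alpha> s W(1)])
  show "\<not> prp (lab (act x \<alpha>)) (lab \<gamma>)"
  proof (cases "act x \<alpha> \<in> \<Phi>\<^sup>+")
    case True
    show ?thesis
      by (rule gkm_edges[OF gkm simple_edge[OF \<alpha> s W(1) True] e(1)]) (use e in auto)
  next
    case False
    have xs: "x \<otimes>\<^bsub>W\<^esub> s \<in> carrier W" using W(1) s_W[OF \<alpha> s] by simp
    have neg: "act (x \<otimes>\<^bsub>W\<^esub> s) \<alpha> = - act x \<alpha>" by (rule act_mult_s[OF \<alpha> s W(1)])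
    have "act (x \<otimes>\<^bsub>W\<^esub> s) \<alpha> \<in> \<Phi>\<^sup>+" unfolding neg using pos_or_neg[OF ax] False by blast
    from simple_edge[OF \<alpha> s xs this]
    have "is_edge (x \<otimes>\<^bsub>W\<^esub> s) x (- act x \<alpha>)"
      unfolding neg mult_s_s[OF \<alpha> s W(1)] .
    from gkm_edges[OF gkm this e(1)] have "\<not> prp (lab (- act x \<alpha>)) (lab \<gamma>)"
      using e mult_s_ne[OF \<alpha> s W(1)] by auto
    then show ?thesis
      using prp_neg[of "- act x \<alpha>" \<gamma>] neg_aff_root[OF ax] W(3) by auto
  qed
qed

lemma realized_Th:
  assumes "X_carrier R B ss = phi ss ` sec (carrier W)" "extends_sections"
    and gkm: "gkm R (full_subgraph Gr (ev_set R (ss @ [s])))"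
  shows "realized_sheaf R B (theta R B s M) (ss @ [s])"
proof -
  have Js: "ev_set R (ss @ [s]) = J \<union> (\<lambda>x. x \<otimes>\<^bsub>W\<^esub> s) ` J"
    unfolding J by (rule ev_set_snoc[OF ss s_simp])
  have canc: "cancellable \<alpha> s" by (rule gkm_cancellable[OF gkm[unfolded Js]])
  show ?thesis
  proof (intro realized_sheaf.intro realized_sheaf_axioms.intro)
    show "good_sheaf R B (theta R B s M) (ev_set R (ss @ [s]))"
      unfolding Js by (rule good_Th[OF \<alpha> s])
    show "set (ss @ [s]) \<subseteq> simp_refls" using ss s_simp by simp
    show "T.extends_sections" by (rule extends_sections_Th[OF \<alpha> s assms(2) canc])
    show "T.values_on (ss @ [s])" by (rule values_on_Th)
    show "X_carrier R B (ss @ [s]) = T.phi (ss @ [s]) ` T.sec (carrier W)"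
      by (rule X_carrier_Th[OF assms(1) canc])
  qed
qed

end
end

context labelled_root_system
begin

abbreviation BS :: "'v aff_map list \<Rightarrow> ('v, 'f) aff_sheaf" where "BS \<equiv> bott_samelson R B"

lemma gkm_subset: "gkm R (full_subgraph Gr H) \<Longrightarrow> H' \<subseteq> H \<Longrightarrow> gkm R (full_subgraph Gr H')"
  unfolding gkm_def full_subgraph_def by (simp add: subset_iff)

lemma realized_unit: "realized_sheaf R B (unit_sheaf R B :: ('v, 'f) aff_sheaf) []"
proof -
  interpret good_sheaf R B F "unit_sheaf R B" "{\<one>\<^bsub>W\<^esub>}" by (rule good_unit_sheaf)
  have agr: "agree x y \<gamma> m n" for x y \<gamma> m n by (simp add: agrees_def unit_sheaf_def)
  have at: "subseqs_at R [] x = (if x = \<one>\<^bsub>W\<^esub> then {[]} else {})" for x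
    by (auto simp: subseqs_at_def subseqs_of_Nil ev_Nil)
  have st1: "st \<one>\<^bsub>W\<^esub> = map_module Elt elt (ring_module S)" by (simp add: unit_sheaf_def)
  have stx: "st x = zero_module (Elt \<zero>\<^bsub>S\<^esub>)" if "x \<noteq> \<one>\<^bsub>W\<^esub>" for x
    using that by (simp add: unit_sheaf_def)
  have one: "carrier (st \<one>\<^bsub>W\<^esub>) = Elt ` carrier S"
    by (simp add: st1 map_module_def ring_module_def)
  show ?thesis
  proof (intro realized_sheaf.intro realized_sheaf_axioms.intro)
    show "good_sheaf R B (unit_sheaf R B :: ('v, 'f) aff_sheaf) (ev_set R [])"
      unfolding ev_set_Nil by (rule good_unit_sheaf)
    show "set [] \<subseteq> simp_refls" by simp
    show "extends_sections"
      unfolding extends_sections_def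
    proof (intro ballI allI impI)
      fix z \<Omega> m assume low: "lower_set z \<Omega>" and m: "m \<in> sec \<Omega>"
      \<comment> \<open>Extension by zero works because no edge of the unit sheaf imposes a
        condition.\<close>
      let ?n = "\<lambda>x\<in>carrier W. if x \<in> \<Omega> then m x else \<zero>\<^bsub>st x\<^esub>"
      have "?n \<in> sec (carrier W)"
        by (rule secI[OF _ agr]) (use sec_mem[OF m] in auto)
      then show "\<exists>n\<in>sec (carrier W). \<forall>x\<in>\<Omega>. n x = m x"
        using low by (intro bexI[of _ ?n]) (auto simp: lower_set_def)
    qed
    show "values_on []"
      unfolding values_on_def
    proof
      fix x show "\<forall>m\<in>carrier (st x).
        (\<forall>\<sigma>\<in>subseqs_at R [] x. value_at R m \<sigma> \<in> carrier S \<and>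
          (\<forall>n\<in>carrier (st x). value_at R (m \<oplus>\<^bsub>st x\<^esub> n) \<sigma> = value_at R m \<sigma> \<oplus>\<^bsub>S\<^esub> value_at R n \<sigma>) \<and>
          (\<forall>a\<in>carrier S. value_at R (a \<odot>\<^bsub>st x\<^esub> m) \<sigma> = a \<otimes>\<^bsub>S\<^esub> value_at R m \<sigma>)) \<and>
        (\<forall>n\<in>carrier (st x). (\<forall>\<sigma>\<in>subseqs_at R [] x. value_at R m \<sigma> = value_at R n \<sigma>) \<longrightarrow> m = n)"
      proof (cases "x = \<one>\<^bsub>W\<^esub>")
        case True
        show ?thesis unfolding True
          by (auto simp: at st1 value_at_Nil map_module_def ring_module_def)
      next
        case False
        then show ?thesis by (simp add: at stx zero_module_def)
      qed
    qed
    show "X_carrier R B [] = phi [] ` sec (carrier W)"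
    proof -
    have "X_carrier R B [] = (\<Pi>\<^sub>E \<sigma>\<in>{[]}. carrier S)"
      by (subst X_carrier.simps) (simp add: subseq_module_def subseqs_of_Nil)
    also have "\<dots> = phi [] ` sec (carrier W)"
    proof
      show "phi [] ` sec (carrier W) \<subseteq> (\<Pi>\<^sub>E \<sigma>\<in>{[]}. carrier S)"
      proof
        fix f assume "f \<in> phi [] ` sec (carrier W)"
        then obtain m where m: "m \<in> sec (carrier W)" "f = phi [] m" by blast
        have "m \<one>\<^bsub>W\<^esub> \<in> Elt ` carrier S" using sec_mem[OF m(1), of "\<one>\<^bsub>W\<^esub>"] one by simp
        then show "f \<in> (\<Pi>\<^sub>E \<sigma>\<in>{[]}. carrier S)"
          unfolding m(2) phi_def by (auto simp: subseqs_of_Nil value_at_Nil ev_Nil)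
      qed
      show "(\<Pi>\<^sub>E \<sigma>\<in>{[]}. carrier S) \<subseteq> phi [] ` sec (carrier W)"
      proof
        fix f :: "('v, 'f) subseq_fun" assume f: "f \<in> (\<Pi>\<^sub>E \<sigma>\<in>{[]}. carrier S)"
        let ?m = "\<lambda>x\<in>carrier W. if x = \<one>\<^bsub>W\<^esub> then Elt (f []) else \<zero>\<^bsub>st x\<^esub>"
        have f0: "f [] \<in> carrier S" using f by (auto simp: PiE_iff)
        have "?m \<in> sec (carrier W)"
          by (rule secI[OF _ agr]) (use f0 one in auto)
        moreover have "f = phi [] ?m"
          by (rule extensionalityI[of _ "{[]}"])
            (use f in \<open>auto simp: PiE_iff phi_def subseqs_of_Nil value_at_Nil ev_Nil\<close>)
        ultimately show "f \<in> phi [] ` sec (carrier W)" by blast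
      qed
    qed
      finally show ?thesis .
    qed
  qed
qed

lemma realized_bott_samelson:
  assumes "set ss \<subseteq> simp_refls" "gkm R (full_subgraph Gr (ev_set R ss))"
  shows "realized_sheaf R B (BS ss) ss"
  using assms
proof (induction ss rule: rev_induct)
  case Nil
  show ?case unfolding bott_samelson_Nil by (rule realized_unit)
next
  case (snoc s ss)
  have ss: "set ss \<subseteq> simp_refls" and s: "s \<in> simp_refls" using snoc.prems by auto
  have "gkm R (full_subgraph Gr (ev_set R ss))"
    using gkm_subset[OF snoc.prems(2)] ev_set_snoc[OF ss s] by blast
  then interpret realized_sheaf R B F "BS ss" ss using snoc.IH ss by blast
  obtain \<alpha> where \<alpha>: "\<alpha> \<in> \<Delta>" "s = rr \<alpha>" using s by (auto simp: simple_refls_def)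
  show ?case
    unfolding bott_samelson_snoc
    by (rule realized_Th[OF \<alpha> ss refl vals X_carrier_eq extends snoc.prems(2)])
qed

section \<open>The structure algebra\<close>

lemma struct_alg_iff:
  "z \<in> carrier (struct_alg R H) \<longleftrightarrow> z \<in> (\<Pi>\<^sub>E x\<in>H. carrier S) \<and>
    (\<forall>\<gamma>\<in>\<Phi>. \<forall>x\<in>H. rr \<gamma> \<otimes>\<^bsub>W\<^esub> x \<in> H \<longrightarrow>
      (\<exists>e\<in>carrier S. z x = z (rr \<gamma> \<otimes>\<^bsub>W\<^esub> x) \<oplus>\<^bsub>S\<^esub> lab \<gamma> \<otimes>\<^bsub>S\<^esub> e))"
proof -
  have eq: "a \<ominus>\<^bsub>S\<^esub> b \<in> PIdl\<^bsub>S\<^esub> lab \<gamma> \<longleftrightarrow> (\<exists>e\<in>carrier S. a = b \<oplus>\<^bsub>S\<^esub> lab \<gamma> \<otimes>\<^bsub>S\<^esub> e)"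
    if "a \<in> carrier S" "b \<in> carrier S" "\<gamma> \<in> \<Phi>" for a b \<gamma>
  proof
    assume "a \<ominus>\<^bsub>S\<^esub> b \<in> PIdl\<^bsub>S\<^esub> lab \<gamma>"
    then obtain e where e: "e \<in> carrier S" "a \<ominus>\<^bsub>S\<^esub> b = e \<otimes>\<^bsub>S\<^esub> lab \<gamma>"
      by (auto simp: cgenideal_def)
    have "a = b \<oplus>\<^bsub>S\<^esub> (a \<ominus>\<^bsub>S\<^esub> b)"
      using that by (simp add: a_minus_def S.a_lcomm[of b] S.r_neg)
    then show "\<exists>e\<in>carrier S. a = b \<oplus>\<^bsub>S\<^esub> lab \<gamma> \<otimes>\<^bsub>S\<^esub> e"
      using e that by (intro bexI[of _ e]) (auto simp: S.m_comm lab_root_S)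
  next
    assume "\<exists>e\<in>carrier S. a = b \<oplus>\<^bsub>S\<^esub> lab \<gamma> \<otimes>\<^bsub>S\<^esub> e"
    then obtain e where e: "e \<in> carrier S" "a = b \<oplus>\<^bsub>S\<^esub> lab \<gamma> \<otimes>\<^bsub>S\<^esub> e" by blast
    then have "a \<ominus>\<^bsub>S\<^esub> b = e \<otimes>\<^bsub>S\<^esub> lab \<gamma>"
      using that by (simp add: a_minus_def S.a_ac S.m_comm lab_root_S S.r_neg2 S.r_neg1 S.r_neg)
    then show "a \<ominus>\<^bsub>S\<^esub> b \<in> PIdl\<^bsub>S\<^esub> lab \<gamma>" using e by (auto simp: cgenideal_def)
  qed
  show ?thesis
  proof (cases "z \<in> (\<Pi>\<^sub>E x\<in>H. carrier S)")
    case True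
    then have "z x \<in> carrier S" if "x \<in> H" for x using that by (auto simp: PiE_iff)
    then show ?thesis
      unfolding struct_alg_def using eq by simp
  qed (simp add: struct_alg_def)
qed

text \<open>An isomorphism of modules presupposes that the scalars form a commutative ring, so this
  belongs to the assertion about global sections.\<close>

lemma cring_struct_alg: "cring (struct_alg R H :: ('v aff_map \<Rightarrow> ('v, 'f) sym) ring)"
proof -
  let ?Z = "struct_alg R H :: ('v aff_map \<Rightarrow> ('v, 'f) sym) ring"
  have mem: "z x \<in> carrier S" if "z \<in> carrier ?Z" "x \<in> H" for z x
    using that by (auto simp: struct_alg_iff PiE_iff)
  have cong: "\<exists>e\<in>carrier S. z x = z (rr \<gamma> \<otimes>\<^bsub>W\<^esub> x) \<oplus>\<^bsub>S\<^esub> lab \<gamma> \<otimes>\<^bsub>S\<^esub> e"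
    if "z \<in> carrier ?Z" "\<gamma> \<in> \<Phi>" "x \<in> H" "rr \<gamma> \<otimes>\<^bsub>W\<^esub> x \<in> H" for z \<gamma> x
    using that struct_alg_iff by blast
  have I: "restrict z H \<in> carrier ?Z"
    if "\<And>x. x \<in> H \<Longrightarrow> z x \<in> carrier S"
      "\<And>\<gamma> x. \<gamma> \<in> \<Phi> \<Longrightarrow> x \<in> H \<Longrightarrow> rr \<gamma> \<otimes>\<^bsub>W\<^esub> x \<in> H \<Longrightarrow>
        \<exists>e\<in>carrier S. z x = z (rr \<gamma> \<otimes>\<^bsub>W\<^esub> x) \<oplus>\<^bsub>S\<^esub> lab \<gamma> \<otimes>\<^bsub>S\<^esub> e" for z
    using that by (simp add: struct_alg_iff)
  have ops: "z \<oplus>\<^bsub>?Z\<^esub> w = (\<lambda>x\<in>H. z x \<oplus>\<^bsub>S\<^esub> w x)" "z \<otimes>\<^bsub>?Z\<^esub> w = (\<lambda>x\<in>H. z x \<otimes>\<^bsub>S\<^esub> w x)"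
    "\<zero>\<^bsub>?Z\<^esub> = (\<lambda>x\<in>H. \<zero>\<^bsub>S\<^esub>)" "\<one>\<^bsub>?Z\<^esub> = (\<lambda>x\<in>H. \<one>\<^bsub>S\<^esub>)" for z w
    by (simp_all add: struct_alg_def)
  have const: "(\<lambda>x\<in>H. c) \<in> carrier ?Z" if "c \<in> carrier S" for c
    by (rule I) (use that in \<open>auto intro!: bexI[of _ "\<zero>\<^bsub>S\<^esub>"] simp: lab_root_S\<close>)
  have mult: "(\<lambda>x\<in>H. z x \<otimes>\<^bsub>S\<^esub> w x) \<in> carrier ?Z" if zw: "z \<in> carrier ?Z" "w \<in> carrier ?Z" for z w
  proof (rule I)
    fix \<gamma> x assume g: "\<gamma> \<in> \<Phi>" "x \<in> H" "rr \<gamma> \<otimes>\<^bsub>W\<^esub> x \<in> H"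
    let ?y = "rr \<gamma> \<otimes>\<^bsub>W\<^esub> x"
    obtain e where e: "e \<in> carrier S" "z x = z ?y \<oplus>\<^bsub>S\<^esub> lab \<gamma> \<otimes>\<^bsub>S\<^esub> e" using cong[OF zw(1) g] by blast
    obtain e' where e': "e' \<in> carrier S" "w x = w ?y \<oplus>\<^bsub>S\<^esub> lab \<gamma> \<otimes>\<^bsub>S\<^esub> e'" using cong[OF zw(2) g] by blast
    note m = mem[OF zw(1) g(3)] mem[OF zw(2) g(3)] mem[OF zw(1) g(2)] mem[OF zw(2) g(2)] lab_root_S[OF g(1)]
    \<comment> \<open>The factors are replaced one at a time; each replacement costs a multiple of
      the label.\<close>
    have "z x \<otimes>\<^bsub>S\<^esub> w x = z ?y \<otimes>\<^bsub>S\<^esub> w x \<oplus>\<^bsub>S\<^esub> lab \<gamma> \<otimes>\<^bsub>S\<^esub> (e \<otimes>\<^bsub>S\<^esub> w x)"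
      unfolding e(2) using m e by (simp add: S.l_distr S.m_assoc)
    also have "z ?y \<otimes>\<^bsub>S\<^esub> w x = z ?y \<otimes>\<^bsub>S\<^esub> w ?y \<oplus>\<^bsub>S\<^esub> lab \<gamma> \<otimes>\<^bsub>S\<^esub> (z ?y \<otimes>\<^bsub>S\<^esub> e')"
      unfolding e'(2) using m e' by (simp add: S.r_distr S.m_ac)
    finally have "z x \<otimes>\<^bsub>S\<^esub> w x =
        z ?y \<otimes>\<^bsub>S\<^esub> w ?y \<oplus>\<^bsub>S\<^esub> lab \<gamma> \<otimes>\<^bsub>S\<^esub> (z ?y \<otimes>\<^bsub>S\<^esub> e' \<oplus>\<^bsub>S\<^esub> e \<otimes>\<^bsub>S\<^esub> w x)"
      using m e(1) e'(1) by (simp add: S.r_distr S.a_assoc)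
    then show "\<exists>e\<in>carrier S. z x \<otimes>\<^bsub>S\<^esub> w x = z ?y \<otimes>\<^bsub>S\<^esub> w ?y \<oplus>\<^bsub>S\<^esub> lab \<gamma> \<otimes>\<^bsub>S\<^esub> e"
      using m e(1) e'(1) by blast
  qed (use mem zw in auto)
  have add: "(\<lambda>x\<in>H. z x \<oplus>\<^bsub>S\<^esub> w x) \<in> carrier ?Z" if zw: "z \<in> carrier ?Z" "w \<in> carrier ?Z" for z w
  proof (rule I)
    fix \<gamma> x assume g: "\<gamma> \<in> \<Phi>" "x \<in> H" "rr \<gamma> \<otimes>\<^bsub>W\<^esub> x \<in> H"
    let ?y = "rr \<gamma> \<otimes>\<^bsub>W\<^esub> x"
    obtain e where e: "e \<in> carrier S" "z x = z ?y \<oplus>\<^bsub>S\<^esub> lab \<gamma> \<otimes>\<^bsub>S\<^esub> e" using cong[OF zw(1) g] by blast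
    obtain e' where e': "e' \<in> carrier S" "w x = w ?y \<oplus>\<^bsub>S\<^esub> lab \<gamma> \<otimes>\<^bsub>S\<^esub> e'" using cong[OF zw(2) g] by blast
    note m = mem[OF zw(1) g(3)] mem[OF zw(2) g(3)] lab_root_S[OF g(1)]
    have "z x \<oplus>\<^bsub>S\<^esub> w x = z ?y \<oplus>\<^bsub>S\<^esub> w ?y \<oplus>\<^bsub>S\<^esub> lab \<gamma> \<otimes>\<^bsub>S\<^esub> (e \<oplus>\<^bsub>S\<^esub> e')"
      unfolding e(2) e'(2) using m e(1) e'(1) by (simp add: S.r_distr S.a_ac)
    then show "\<exists>e\<in>carrier S. z x \<oplus>\<^bsub>S\<^esub> w x = z ?y \<oplus>\<^bsub>S\<^esub> w ?y \<oplus>\<^bsub>S\<^esub> lab \<gamma> \<otimes>\<^bsub>S\<^esub> e"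
      using e(1) e'(1) by blast
  qed (use mem zw in auto)
  have ext: "z \<in> extensional H" if "z \<in> carrier ?Z" for z
    using that struct_alg_iff[of z H] PiE_iff[of z H] by simp
  have unit: "(\<lambda>x\<in>H. c \<otimes>\<^bsub>S\<^esub> z x) = z" if "z \<in> carrier ?Z" "c = \<one>\<^bsub>S\<^esub>" for z c
    by (rule extensionalityI[OF _ ext[OF that(1)]]) (use that mem in auto)
  have neutral: "(\<lambda>x\<in>H. \<zero>\<^bsub>S\<^esub> \<oplus>\<^bsub>S\<^esub> z x) = z" if "z \<in> carrier ?Z" for z
    by (rule extensionalityI[OF _ ext[OF that]]) (use that mem in auto)
  show ?thesis
  proof (rule cringI)
    show "abelian_group ?Z"
    proof (rule abelian_groupI)
      fix z w v assume z: "z \<in> carrier ?Z" "w \<in> carrier ?Z" "v \<in> carrier ?Z"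
      show "z \<oplus>\<^bsub>?Z\<^esub> w \<oplus>\<^bsub>?Z\<^esub> v = z \<oplus>\<^bsub>?Z\<^esub> (w \<oplus>\<^bsub>?Z\<^esub> v)"
        unfolding ops by (rule restrict_ext) (use mem z in \<open>simp add: S.a_assoc\<close>)
    next
      fix z w assume z: "z \<in> carrier ?Z" "w \<in> carrier ?Z"
      show "z \<oplus>\<^bsub>?Z\<^esub> w \<in> carrier ?Z" unfolding ops by (rule add[OF z])
      show "z \<oplus>\<^bsub>?Z\<^esub> w = w \<oplus>\<^bsub>?Z\<^esub> z"
        unfolding ops by (rule restrict_ext) (use mem z in \<open>simp add: S.a_comm\<close>)
    next
      show "\<zero>\<^bsub>?Z\<^esub> \<in> carrier ?Z" unfolding ops by (rule const) simp
    next
      fix z assume z: "z \<in> carrier ?Z"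
      have "(\<lambda>x\<in>H. \<zero>\<^bsub>S\<^esub> \<oplus>\<^bsub>S\<^esub> z x) = \<zero>\<^bsub>?Z\<^esub> \<oplus>\<^bsub>?Z\<^esub> z" unfolding ops by (rule restrict_ext) simp
      then show "\<zero>\<^bsub>?Z\<^esub> \<oplus>\<^bsub>?Z\<^esub> z = z" using neutral[OF z] by simp
      let ?n = "\<lambda>x\<in>H. (\<lambda>x\<in>H. \<ominus>\<^bsub>S\<^esub> \<one>\<^bsub>S\<^esub>) x \<otimes>\<^bsub>S\<^esub> z x"
      have "?n \<in> carrier ?Z" by (rule mult[OF const z]) simp
      moreover have "?n \<oplus>\<^bsub>?Z\<^esub> z = \<zero>\<^bsub>?Z\<^esub>"
        unfolding ops by (rule restrict_ext) (use mem z in \<open>simp add: S.l_minus S.l_neg\<close>)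
      ultimately show "\<exists>y\<in>carrier ?Z. y \<oplus>\<^bsub>?Z\<^esub> z = \<zero>\<^bsub>?Z\<^esub>" by blast
    qed
    show "Group.comm_monoid ?Z"
    proof (rule comm_monoidI)
      fix z w v assume z: "z \<in> carrier ?Z" "w \<in> carrier ?Z" "v \<in> carrier ?Z"
      show "z \<otimes>\<^bsub>?Z\<^esub> w \<otimes>\<^bsub>?Z\<^esub> v = z \<otimes>\<^bsub>?Z\<^esub> (w \<otimes>\<^bsub>?Z\<^esub> v)"
        unfolding ops by (rule restrict_ext) (use mem z in \<open>simp add: S.m_assoc\<close>)
    next
      fix z w assume z: "z \<in> carrier ?Z" "w \<in> carrier ?Z"
      show "z \<otimes>\<^bsub>?Z\<^esub> w \<in> carrier ?Z" unfolding ops by (rule mult[OF z])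
      show "z \<otimes>\<^bsub>?Z\<^esub> w = w \<otimes>\<^bsub>?Z\<^esub> z"
        unfolding ops by (rule restrict_ext) (use mem z in \<open>simp add: S.m_comm\<close>)
    next
      show "\<one>\<^bsub>?Z\<^esub> \<in> carrier ?Z" unfolding ops by (rule const) simp
    next
      fix z assume z: "z \<in> carrier ?Z"
      have "(\<lambda>x\<in>H. \<one>\<^bsub>S\<^esub> \<otimes>\<^bsub>S\<^esub> z x) = \<one>\<^bsub>?Z\<^esub> \<otimes>\<^bsub>?Z\<^esub> z" unfolding ops by (rule restrict_ext) simp
      then show "\<one>\<^bsub>?Z\<^esub> \<otimes>\<^bsub>?Z\<^esub> z = z" using unit[OF z refl] by simp
    qed
  next
    fix z w v assume z: "z \<in> carrier ?Z" "w \<in> carrier ?Z" "v \<in> carrier ?Z"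
    show "(z \<oplus>\<^bsub>?Z\<^esub> w) \<otimes>\<^bsub>?Z\<^esub> v = z \<otimes>\<^bsub>?Z\<^esub> v \<oplus>\<^bsub>?Z\<^esub> w \<otimes>\<^bsub>?Z\<^esub> v"
      unfolding ops by (rule restrict_ext) (use mem z in \<open>simp add: S.l_distr\<close>)
  qed
qed

end

section \<open>The two isomorphisms\<close>

context realized_sheaf
begin

abbreviation "J \<equiv> ev_set R ss"
abbreviation Z :: "('v aff_map \<Rightarrow> ('v, 'f) sym) ring" where "Z \<equiv> struct_alg R J"
abbreviation "GS \<equiv> global_sections R J M"

definition phi_at :: "'v aff_map \<Rightarrow> ('v, 'f) vert_elt \<Rightarrow> ('v, 'f) subseq_fun" where
  "phi_at x m = (\<lambda>\<sigma>\<in>subseqs_at R ss x. value_at R m \<sigma>)"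

lemma verts_M: "verts (graph M) = carrier W"
  by (simp add: graph_M aff_graph_def)

lemma value_ops:
  assumes "x \<in> carrier W" "m \<in> carrier (st x)" "\<sigma> \<in> subseqs_at R ss x"
  shows "value_at R m \<sigma> \<in> carrier S"
    "n \<in> carrier (st x) \<Longrightarrow> value_at R (m \<oplus>\<^bsub>st x\<^esub> n) \<sigma> = value_at R m \<sigma> \<oplus>\<^bsub>S\<^esub> value_at R n \<sigma>"
    "a \<in> carrier S \<Longrightarrow> value_at R (a \<odot>\<^bsub>st x\<^esub> m) \<sigma> = a \<otimes>\<^bsub>S\<^esub> value_at R m \<sigma>"
  using vals assms unfolding values_on_def by blast+

lemma values_zero: "x \<in> carrier W \<Longrightarrow> \<sigma> \<in> subseqs_at R ss x \<Longrightarrow> value_at R \<zero>\<^bsub>st x\<^esub> \<sigma> = \<zero>\<^bsub>S\<^esub>"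
  using value_ops(3)[of x "\<zero>\<^bsub>st x\<^esub>" \<sigma> "\<zero>\<^bsub>S\<^esub>"] value_ops(1)[of x "\<zero>\<^bsub>st x\<^esub>" \<sigma>] by simp

lemma values_eqI:
  assumes "x \<in> carrier W" "m \<in> carrier (st x)" "n \<in> carrier (st x)"
    "\<And>\<sigma>. \<sigma> \<in> subseqs_at R ss x \<Longrightarrow> value_at R m \<sigma> = value_at R n \<sigma>"
  shows "m = n"
  using vals assms unfolding values_on_def by blast

lemma subseq_W: "\<sigma> \<in> subseqs_of ss \<Longrightarrow> ev R \<sigma> \<in> carrier W"
  by (rule ev_W[OF ss])

lemma subseq_at: "\<sigma> \<in> subseqs_of ss \<Longrightarrow> \<sigma> \<in> subseqs_at R ss (ev R \<sigma>)"
  by (simp add: subseqs_at_def)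

lemma phi_restrict: "x \<in> carrier W \<Longrightarrow> restrict (phi ss m) (subseqs_at R ss x) = phi_at x (m x)"
  unfolding phi_at_def phi_def by (rule restrict_ext) (auto simp: subseqs_at_def)

lemma GS_simps:
  "carrier GS = sec (carrier W)" "\<zero>\<^bsub>GS\<^esub> = (\<lambda>x\<in>carrier W. \<zero>\<^bsub>st x\<^esub>)"
  "m \<oplus>\<^bsub>GS\<^esub> n = (\<lambda>x\<in>carrier W. m x \<oplus>\<^bsub>st x\<^esub> n x)"
  "z \<odot>\<^bsub>GS\<^esub> m = (\<lambda>x\<in>carrier W. if x \<in> J then z x \<odot>\<^bsub>st x\<^esub> m x else \<zero>\<^bsub>st x\<^esub>)"
  by (simp_all add: global_sections_def verts_M sec_def sections_ops)

lemma Z_mem: "z \<in> carrier Z \<Longrightarrow> x \<in> J \<Longrightarrow> z x \<in> carrier S"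
  by (auto simp: struct_alg_iff PiE_iff)

lemma module_GS: "Module.module Z GS"
proof (rule moduleI[OF cring_struct_alg])
  interpret Q: module S "sections M (carrier W)" by (rule module_sections) simp
  have car: "carrier (sections M (carrier W)) = sec (carrier W)" by (simp add: sec_def)
  have ops: "m \<oplus>\<^bsub>GS\<^esub> n = m \<oplus>\<^bsub>sections M (carrier W)\<^esub> n" "\<zero>\<^bsub>GS\<^esub> = \<zero>\<^bsub>sections M (carrier W)\<^esub>" for m n
    by (simp_all add: GS_simps sections_ops)
  show "abelian_group GS"
  proof (rule abelian_groupI)
    fix m assume "m \<in> carrier GS"
    then have m: "m \<in> carrier (sections M (carrier W))" by (simp add: GS_simps(1) car)
    show "\<exists>n\<in>carrier GS. n \<oplus>\<^bsub>GS\<^esub> m = \<zero>\<^bsub>GS\<^esub>"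
      unfolding ops GS_simps(1) car[symmetric] using Q.M.l_neg[OF m] Q.M.a_inv_closed[OF m] by blast
  qed (auto simp: GS_simps(1) ops Q.M.a_ac simp flip: car)
next
  fix z m assume z: "z \<in> carrier Z" and m: "m \<in> carrier GS"
  have m': "m \<in> sec (carrier W)" using m by (simp add: GS_simps)
  \<comment> \<open>Extending z by zero outside the support gives a family of scalars at all
    vertices, as \<open>sec_scalars\<close> requires.\<close>
  have "(\<lambda>x\<in>carrier W. (if x \<in> J then z x else \<zero>\<^bsub>S\<^esub>) \<odot>\<^bsub>st x\<^esub> m x) \<in> sec (carrier W)"
  proof (rule sec_scalars[OF subset_refl m'])
    show "(if x \<in> J then z x else \<zero>\<^bsub>S\<^esub>) \<in> carrier S" for x using Z_mem[OF z] by simp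
    fix x y \<gamma> assume e: "is_edge x y \<gamma>" "x \<in> J" "y \<in> J"
    then show "\<exists>e\<in>carrier S. (if x \<in> J then z x else \<zero>\<^bsub>S\<^esub>) = (if y \<in> J then z y else \<zero>\<^bsub>S\<^esub>) \<oplus>\<^bsub>S\<^esub> lab \<gamma> \<otimes>\<^bsub>S\<^esub> e"
      using z is_edgeD(3,4)[OF e(1)] by (simp add: struct_alg_iff)
  qed
  moreover have "(\<lambda>x\<in>carrier W. (if x \<in> J then z x else \<zero>\<^bsub>S\<^esub>) \<odot>\<^bsub>st x\<^esub> m x) = z \<odot>\<^bsub>GS\<^esub> m"
    unfolding GS_simps by (rule restrict_ext) (use sec_mem[OF m'] in auto)
  ultimately show "z \<odot>\<^bsub>GS\<^esub> m \<in> carrier GS" by (simp add: GS_simps)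
next
  fix z w m assume z: "z \<in> carrier Z" "w \<in> carrier Z" and m: "m \<in> carrier GS"
  note mm = sec_mem[OF m[unfolded GS_simps]] and zm = Z_mem[OF z(1)] Z_mem[OF z(2)]
  show "(z \<oplus>\<^bsub>Z\<^esub> w) \<odot>\<^bsub>GS\<^esub> m = z \<odot>\<^bsub>GS\<^esub> m \<oplus>\<^bsub>GS\<^esub> w \<odot>\<^bsub>GS\<^esub> m"
    unfolding GS_simps by (rule restrict_ext) (use mm zm in \<open>simp add: struct_alg_def st_l_distr\<close>)
  show "(z \<otimes>\<^bsub>Z\<^esub> w) \<odot>\<^bsub>GS\<^esub> m = z \<odot>\<^bsub>GS\<^esub> (w \<odot>\<^bsub>GS\<^esub> m)"
    unfolding GS_simps by (rule restrict_ext) (use mm zm in \<open>simp add: struct_alg_def st_assoc1\<close>)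
next
  fix z m n assume z: "z \<in> carrier Z" and m: "m \<in> carrier GS" "n \<in> carrier GS"
  note mm = sec_mem[OF m(1)[unfolded GS_simps]] sec_mem[OF m(2)[unfolded GS_simps]] and zm = Z_mem[OF z]
  show "z \<odot>\<^bsub>GS\<^esub> (m \<oplus>\<^bsub>GS\<^esub> n) = z \<odot>\<^bsub>GS\<^esub> m \<oplus>\<^bsub>GS\<^esub> z \<odot>\<^bsub>GS\<^esub> n"
    unfolding GS_simps by (rule restrict_ext) (use mm zm in \<open>simp add: st_r_distr\<close>)
next
  fix m assume m: "m \<in> carrier GS"
  note mm = sec_mem[OF m[unfolded GS_simps]]
  \<comment> \<open>The unit acts as zero outside the support, which is harmless because the stalks
    vanish there.\<close>
  have "m x = \<zero>\<^bsub>st x\<^esub>" if "x \<in> carrier W" "x \<notin> J" for x using support that mm by blast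
  then show "\<one>\<^bsub>Z\<^esub> \<odot>\<^bsub>GS\<^esub> m = m"
    unfolding GS_simps
    by (intro extensionalityI[OF _ sec_ext[OF m[unfolded GS_simps]]])
      (use mm in \<open>auto simp: struct_alg_def\<close>)
qed

lemma iso_global: "module_iso Z GS (X_module R B ss) (phi ss)"
proof (rule module_iso_transfer[OF module_GS])
  show "phi ss ` carrier GS = carrier (X_module R B ss)"
    by (simp add: GS_simps X_module_def X_carrier_eq)
  show "inj_on (phi ss) (carrier GS)"
  proof (rule inj_onI)
    fix m n assume m: "m \<in> carrier GS" "n \<in> carrier GS" and eq: "phi ss m = phi ss n"
    note mm = m[unfolded GS_simps]
    show "m = n"
    proof (rule sec_eqI[OF mm])
      fix x assume x: "x \<in> carrier W"
      show "m x = n x"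
      proof (rule values_eqI[OF x sec_mem[OF mm(1) x] sec_mem[OF mm(2) x]])
        fix \<sigma> assume "\<sigma> \<in> subseqs_at R ss x"
        then show "value_at R (m x) \<sigma> = value_at R (n x) \<sigma>"
          using fun_cong[OF eq, of \<sigma>] by (simp add: phi_def subseqs_at_def)
      qed
    qed
  qed
  show "phi ss \<zero>\<^bsub>GS\<^esub> = \<zero>\<^bsub>X_module R B ss\<^esub>"
    by (auto simp: phi_def GS_simps X_module_def subseq_module_def subseq_W values_zero subseq_at intro!: restrict_ext)
next
  fix m n assume m: "m \<in> carrier GS" "n \<in> carrier GS"
  note mm = sec_mem[OF m(1)[unfolded GS_simps]] sec_mem[OF m(2)[unfolded GS_simps]]
  have "phi ss (m \<oplus>\<^bsub>GS\<^esub> n) = (\<lambda>\<sigma>\<in>subseqs_of ss. phi ss m \<sigma> \<oplus>\<^bsub>S\<^esub> phi ss n \<sigma>)"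
    unfolding phi_def[of ss "m \<oplus>\<^bsub>GS\<^esub> n"]
    by (rule restrict_ext) (simp add: phi_def GS_simps subseq_W mm subseq_at value_ops(2))
  then show "phi ss (m \<oplus>\<^bsub>GS\<^esub> n) = phi ss m \<oplus>\<^bsub>X_module R B ss\<^esub> phi ss n"
    by (simp add: X_module_def subseq_module_def)
next
  fix z m assume z: "z \<in> carrier Z" and m: "m \<in> carrier GS"
  note mm = sec_mem[OF m[unfolded GS_simps]]
  have "phi ss (z \<odot>\<^bsub>GS\<^esub> m) = (\<lambda>\<sigma>\<in>subseqs_of ss. z (ev R \<sigma>) \<otimes>\<^bsub>S\<^esub> phi ss m \<sigma>)"
    unfolding phi_def[of ss "z \<odot>\<^bsub>GS\<^esub> m"]
  proof (rule restrict_ext)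
    fix \<sigma> assume \<sigma>: "\<sigma> \<in> subseqs_of ss"
    have J: "ev R \<sigma> \<in> J" using \<sigma> by (simp add: ev_set_def)
    show "value_at R ((z \<odot>\<^bsub>GS\<^esub> m) (ev R \<sigma>)) \<sigma> = z (ev R \<sigma>) \<otimes>\<^bsub>S\<^esub> phi ss m \<sigma>"
      using J \<sigma> value_ops(3)[OF subseq_W[OF \<sigma>] mm[OF subseq_W[OF \<sigma>]] subseq_at[OF \<sigma>] Z_mem[OF z J]]
      by (simp add: GS_simps phi_def subseq_W)
  qed
  then show "phi ss (z \<odot>\<^bsub>GS\<^esub> m) = z \<odot>\<^bsub>X_module R B ss\<^esub> phi ss m"
    by (simp add: X_module_def subseq_module_def)
qed

text \<open>A single vertex carries no edge, so every element of its stalk is a section over it, and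
  \<open>extends\<close> applies because the singleton is a translated lower set.\<close>

lemma global_section_through:
  assumes "x \<in> carrier W" "m \<in> carrier (st x)"
  shows "\<exists>n\<in>sec (carrier W). n x = m"
proof -
  have "restrict (\<lambda>_. m) {x} \<in> sec {x}"
    by (rule secI) (use assms is_edgeD(5) in auto)
  then have "\<exists>n\<in>sec (carrier W). \<forall>y\<in>{x}. n y = restrict (\<lambda>_. m) {x} y"
    using extends lower_set_singleton[OF assms(1)] assms(1) unfolding extends_sections_def by blast
  then show ?thesis by simp
qed

lemma iso_stalk:
  assumes x: "x \<in> carrier W"
  shows "module_iso S (st x) (X_stalk R B ss x) (phi_at x)"
proof (rule module_iso_transfer[OF stalk_module[OF x]])
  have "carrier (X_stalk R B ss x) = (\<lambda>m. restrict (phi ss m) (subseqs_at R ss x)) ` sec (carrier W)"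
    by (auto simp: X_stalk_def X_carrier_eq)
  also have "\<dots> = (\<lambda>m. phi_at x (m x)) ` sec (carrier W)" by (simp add: phi_restrict[OF x])
  also have "\<dots> = phi_at x ` carrier (st x)"
  proof
    show "(\<lambda>m. phi_at x (m x)) ` sec (carrier W) \<subseteq> phi_at x ` carrier (st x)"
      using sec_mem x by blast
    \<comment> \<open>Elements of \<open>X_stalk\<close> are by definition restrictions of global
      elements, so each element of the stalk has to be reached by a global section.\<close>
    show "phi_at x ` carrier (st x) \<subseteq> (\<lambda>m. phi_at x (m x)) ` sec (carrier W)"
      using global_section_through[OF x] by force
  qed
  finally show "phi_at x ` carrier (st x) = carrier (X_stalk R B ss x)" by simp
  show "inj_on (phi_at x) (carrier (st x))"
  proof (rule inj_onI)
    fix m n assume m: "m \<in> carrier (st x)" "n \<in> carrier (st x)" and eq: "phi_at x m = phi_at x n"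
    show "m = n"
    proof (rule values_eqI[OF x m])
      fix \<sigma> assume "\<sigma> \<in> subseqs_at R ss x"
      then show "value_at R m \<sigma> = value_at R n \<sigma>"
        using fun_cong[OF eq, of \<sigma>] by (simp add: phi_at_def)
    qed
  qed
  show "phi_at x \<zero>\<^bsub>st x\<^esub> = \<zero>\<^bsub>X_stalk R B ss x\<^esub>"
    by (auto simp: phi_at_def X_stalk_def prod_module_def ring_module_def values_zero x intro!: restrict_ext)
next
  fix m n assume m: "m \<in> carrier (st x)" "n \<in> carrier (st x)"
  then show "phi_at x (m \<oplus>\<^bsub>st x\<^esub> n) = phi_at x m \<oplus>\<^bsub>X_stalk R B ss x\<^esub> phi_at x n"
    by (auto simp: phi_at_def X_stalk_def prod_module_def ring_module_def value_ops(2) x intro!: restrict_ext)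
next
  fix a m assume "a \<in> carrier S" "m \<in> carrier (st x)"
  then show "phi_at x (a \<odot>\<^bsub>st x\<^esub> m) = a \<odot>\<^bsub>X_stalk R B ss x\<^esub> phi_at x m"
    by (auto simp: phi_at_def X_stalk_def prod_module_def ring_module_def value_ops(3) x intro!: restrict_ext)
qed

end

theorem theorem4p5p1:
  fixes R B :: "'v::rat_vector set" and ss :: "'v aff_map list"
  assumes "root_system R" and "reduced_roots R" and "irreducible_roots R"
    and "root_base R B"
    and "CHAR('f::field) \<noteq> 2"
    and "set ss \<subseteq> simple_refls R B"
    and "gkm R (full_subgraph
           (aff_graph R B :: ('v aff_map, 'v \<times> rat, ('v, 'f) sym) moment_graph) (ev_set R ss))"
  shows "\<exists>(\<phi> :: ('v aff_map \<Rightarrow> ('v, 'f) vert_elt) \<Rightarrow> ('v, 'f) subseq_fun)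
          (\<phi>x :: 'v aff_map \<Rightarrow> ('v, 'f) vert_elt \<Rightarrow> ('v, 'f) subseq_fun).
      module_iso (struct_alg R (ev_set R ss))
        (global_sections R (ev_set R ss) (bott_samelson R B ss)) (X_module R B ss) \<phi> \<and>
      (\<forall>x\<in>carrier (aff_weyl R).
        module_iso (aff_sym R) (stalk (bott_samelson R B ss) x) (X_stalk R B ss x) (\<phi>x x)) \<and>
      (\<forall>x\<in>carrier (aff_weyl R).
        \<forall>m\<in>carrier (global_sections R (ev_set R ss) (bott_samelson R B ss)).
          \<phi>x x (m x) = restrict (\<phi> m) (subseqs_at R ss x))"
proof -
  interpret labelled_root_system R B "TYPE('f)"
    by unfold_locales (use assms in auto)
  interpret realized_sheaf R B "TYPE('f)" "bott_samelson R B ss" ss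
    by (rule realized_bott_samelson[OF assms(6,7)])
  show ?thesis
    using iso_global iso_stalk phi_restrict by (intro exI[of _ "phi ss"] exI[of _ phi_at]) simp
qed

end
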